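(* Let $K_i\subset\mathbb{R}^3$ ($i=1,2,\dots$) be a sequence of rectifiable knots converging to a knot $K\subset\mathbb{R}^3$ of finite total curvature in the sense that $K_i$ is $(\delta_i,\pi/10)$-close to $K$ with $\delta_i\to 0$. Suppose that the $K_i$ have essential subarcs $\gamma_{p_iq_i}$ (with $p_i,q_i\in K_i$) with $p_i\to p$ and $q_i\to q$, where $p$ and $q$ are two distinct points of $K$. Then $\gamma_{pq}$ is an essential subarc of $K$.
   Context: Closeness. A rectifiable curve (one of finite length) has a well-defined tangent vector almost everywhere. Two rectifiable knots $K$ and $K'$ are $(\delta,\theta)$-close if there exists a homeomorphism between them such that corresponding points are within distance $\delta$ of each other, and corresponding tangent vectors are within angle $\theta$ of each other almost everywhere. A knot has finite total curvature if the supremum, over all inscribed polygons, of the sum of the turning angles at the vertices of the polygon is finite. Subarcs. If $p\neq q$ are two points along an oriented knot $K$, they divide $K$ into complementary subarcs $\gamma_{pq}$ (going from $p$ to $q$ along the orientation) and $\gamma_{qp}$ (going from $q$ to $p$). The knots $K_i$ and $K$ are oriented compatibly with the homeomorphisms that realize the $(\delta_i,\pi/10)$-closeness. Inessential and essential triples. Suppose $\alpha$, $\beta$, $\gamma$ are three simple arcs from $p$ to $q$, disjoint except at their endpoints, forming a knotted $\Theta$-graph in $\mathbb{R}^3$. The ordered triple $(\alpha,\beta,\gamma)$ is inessential if there is a disk $D$ bounded by the knot $\alpha\cup\beta$ and having no interior intersections with the knot $\alpha\cup\gamma$. (Self-intersections of $D$ are allowed, as are interior intersections of $D$ with $\beta$.)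 Otherwise the triple is essential. Essential arcs. The subarc $\gamma_{pq}$ is essential in $K$ if for every $\varepsilon>0$ there exists some $\varepsilon$-perturbation $S$ of the straight segment $\overline{pq}$ (with endpoints fixed; the perturbation need be small only in the pointwise sense) such that $K\cup S$ is an embedded $\Theta$-graph in which $(\gamma_{pq},S,\gamma_{qp})$ is essential. *)

theory Defs
  imports "HOL-Analysis.Analysis"
begin

type_synonym space = "real^3"

text \<open>An oriented knot is given by a simple closed path; the underlying point set is its
  \<^const>\<open>path_image\<close> and the orientation is that of increasing parameter.\<close>

definition knot :: "(real \<Rightarrow> space) \<Rightarrow> bool" where
  "knot g \<longleftrightarrow> simple_path g \<and> pathfinish g = pathstart g"


subsection \<open>Length, tangent vectors, total curvature\<close>

fun polyline_length :: "space list \<Rightarrow> real" where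
  "polyline_length (x # y # xs) = dist x y + polyline_length (y # xs)"
| "polyline_length _ = 0"

definition inscribed_lengths :: "(real \<Rightarrow> space) \<Rightarrow> real \<Rightarrow> real set" where
  "inscribed_lengths g t = {polyline_length (map g ts) | ts. sorted ts \<and> set ts \<subseteq> {0..t}}"

definition rectifiable :: "(real \<Rightarrow> space) \<Rightarrow> bool" where
  "rectifiable g \<longleftrightarrow> bdd_above (inscribed_lengths g 1)"

definition arclength :: "(real \<Rightarrow> space) \<Rightarrow> real \<Rightarrow> real" where
  "arclength g t = Sup (inscribed_lengths g t)"

definition arclength_param :: "(real \<Rightarrow> space) \<Rightarrow> real \<Rightarrow> space" where
  "arclength_param g = g \<circ> inv_into {0..1} (arclength g)"

text \<open>The tangent vector of the oriented curve is the derivative of its arclength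
  parametrization, which is a unit vector almost everywhere.  The base point is left without a
  tangent, which is immaterial because tangents are only used almost everywhere.\<close>

definition has_tangent :: "(real \<Rightarrow> space) \<Rightarrow> space \<Rightarrow> space \<Rightarrow> bool" where
  "has_tangent g x T \<longleftrightarrow>
     (\<exists>t\<in>{0<..<1}. g t = x \<and> (arclength_param g has_vector_derivative T) (at (arclength g t)))"

definition arclength_null :: "(real \<Rightarrow> space) \<Rightarrow> space set \<Rightarrow> bool" where
  "arclength_null g A \<longleftrightarrow> negligible (arclength g ` {t\<in>{0..1}. g t \<in> A})"

definition vec_angle :: "space \<Rightarrow> space \<Rightarrow> real" where
  "vec_angle u v = arccos ((u \<bullet> v) / (norm u * norm v))"

text \<open>The sum of the exterior angles of the closed polygon with the given vertices, in cyclic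
  order.\<close>

definition polygon_curvature :: "space list \<Rightarrow> real" where
  "polygon_curvature vs =
     (let n = length vs in
      \<Sum>i<n. vec_angle (vs ! i - vs ! ((i + n - 1) mod n)) (vs ! ((i + 1) mod n) - vs ! i))"

definition finite_total_curvature :: "(real \<Rightarrow> space) \<Rightarrow> bool" where
  "finite_total_curvature g \<longleftrightarrow>
     bdd_above {polygon_curvature (map g ts) | ts.
                  sorted_wrt (<) ts \<and> set ts \<subseteq> {0..<1} \<and> 3 \<le> length ts}"


subsection \<open>Closeness of oriented knots\<close>

text \<open>The map \<open>h\<close> between the two knots is an increasing reparametrization, up to a change of
  base point.\<close>

definition orientation_preserving ::
    "(real \<Rightarrow> space) \<Rightarrow> (real \<Rightarrow> space) \<Rightarrow> (space \<Rightarrow> space) \<Rightarrow> bool" where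
  "orientation_preserving g g' h \<longleftrightarrow>
     (\<exists>a\<in>{0..1}. \<exists>\<phi>. strict_mono_on {0..1} \<phi> \<and> \<phi> ` {0..1} = {0..1} \<and>
        (\<forall>t\<in>{0..1}. h (g t) = shiftpath a g' (\<phi> t)))"

text \<open>The homeomorphism need not be absolutely continuous, so ``almost everywhere'' is taken with
  respect to arclength on both knots; this makes closeness a symmetric relation.\<close>

definition close_knots ::
    "real \<Rightarrow> real \<Rightarrow> (real \<Rightarrow> space) \<Rightarrow> (real \<Rightarrow> space) \<Rightarrow> bool" where
  "close_knots \<delta> \<theta> g g' \<longleftrightarrow>
     knot g \<and> rectifiable g \<and> knot g' \<and> rectifiable g' \<and>
     (\<exists>h k. homeomorphism (path_image g) (path_image g') h k \<and>
        orientation_preserving g g' h \<and>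
        (\<forall>x\<in>path_image g. dist x (h x) \<le> \<delta>) \<and>
        (\<exists>N\<subseteq>path_image g. arclength_null g N \<and> arclength_null g' (h ` N) \<and>
           (\<forall>x\<in>path_image g - N. \<exists>T T'.
              has_tangent g x T \<and> has_tangent g' (h x) T' \<and> vec_angle T T' \<le> \<theta>)))"


subsection \<open>Essential subarcs\<close>

text \<open>The subarc from \<open>p\<close> to \<open>q\<close> along the orientation, for distinct points \<open>p\<close>, \<open>q\<close> of the knot:
  move the base point to \<open>p\<close> and follow the knot up to \<open>q\<close>.\<close>

definition subarc :: "(real \<Rightarrow> space) \<Rightarrow> space \<Rightarrow> space \<Rightarrow> space set" where
  "subarc g p q =
     (let r = shiftpath (inv_into {0..<1} g p) g in r ` {0..inv_into {0..<1} r q})"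

definition arc_between :: "space \<Rightarrow> space \<Rightarrow> space set \<Rightarrow> bool" where
  "arc_between p q A \<longleftrightarrow> (\<exists>c. arc c \<and> pathstart c = p \<and> pathfinish c = q \<and> path_image c = A)"

definition theta_graph ::
    "space \<Rightarrow> space \<Rightarrow> space set \<Rightarrow> space set \<Rightarrow> space set \<Rightarrow> bool" where
  "theta_graph p q \<alpha> \<beta> \<gamma> \<longleftrightarrow>
     arc_between p q \<alpha> \<and> arc_between p q \<beta> \<and> arc_between p q \<gamma> \<and>
     \<alpha> \<inter> \<beta> = {p, q} \<and> \<alpha> \<inter> \<gamma> = {p, q} \<and> \<beta> \<inter> \<gamma> = {p, q}"

text \<open>The spanning disk is a possibly singular one: a continuous map of the closed unit disk that
  is an embedding on the boundary circle.\<close>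

definition inessential_triple :: "space set \<Rightarrow> space set \<Rightarrow> space set \<Rightarrow> bool" where
  "inessential_triple \<alpha> \<beta> \<gamma> \<longleftrightarrow>
     (\<exists>D :: real^2 \<Rightarrow> space. continuous_on (cball 0 1) D \<and>
        inj_on D (sphere 0 1) \<and> D ` sphere 0 1 = \<alpha> \<union> \<beta> \<and>
        D ` ball 0 1 \<inter> (\<alpha> \<union> \<gamma>) = {})"

definition segment_perturbation :: "real \<Rightarrow> space \<Rightarrow> space \<Rightarrow> space set \<Rightarrow> bool" where
  "segment_perturbation \<epsilon> p q S \<longleftrightarrow>
     (\<exists>s. arc s \<and> pathstart s = p \<and> pathfinish s = q \<and> path_image s = S \<and>
        (\<forall>t\<in>{0..1}. dist (s t) (linepath p q t) \<le> \<epsilon>))"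

definition essential_subarc :: "(real \<Rightarrow> space) \<Rightarrow> space \<Rightarrow> space \<Rightarrow> bool" where
  "essential_subarc g p q \<longleftrightarrow>
     (\<forall>\<epsilon>>0. \<exists>S. segment_perturbation \<epsilon> p q S \<and>
        theta_graph p q (subarc g p q) S (subarc g q p) \<and>
        \<not> inessential_triple (subarc g p q) S (subarc g q p))"

end

theory Submission
  imports Defs
begin

text \<open>An essential subarc of \<open>K\<^sub>i\<close> is carried over to \<open>K\<close> by a homeomorphism of space.  Once \<open>K\<^sub>i\<close> is close enough
  to \<open>K\<close>, there is a homeomorphism \<open>H\<close> of space that moves no point far, takes \<open>K\<^sub>i\<close> into \<open>K\<close>, and takes the
  ends of the subarc to \<open>p\<close> and \<open>q\<close> (\<open>ambient_straightening\<close>).  It takes a perturbed segment \<open>S\<close> to a perturbed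
  segment, and it takes the two subarcs of \<open>K\<^sub>i\<close> to arcs in \<open>K\<close> between \<open>p\<close> and \<open>q\<close>; such an arc can
  only be a subarc (\<open>arc_in_knot\<close>), and which of the two it is can be read off from a single point.
  If the triple formed with \<open>H ` S\<close> were inessential, the inverse of \<open>H\<close> would take its spanning disk to one
  for \<open>S\<close>.

  The construction of \<open>H\<close> uses finite total curvature and the closeness of tangents only by way of
  chords.  A knot of finite total curvature splits into finitely many pieces, each of which has all of its
  chords almost parallel to a fixed vector, since infinitely many bends near one point would add
  up to infinite curvature (\<open>nearly_straight_pieces\<close>).  The chords of the corresponding piece of \<open>K\<^sub>i\<close> lie in a
  wider cone about the same vector, because a chord is the integral of the tangents, which are known almost
  everywhere (\<open>chords_of_corresponding_arcs\<close>).  So corresponding pieces are graphs of functions of small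
  slope over the same line.

  Moving points of \<open>K\<^sub>i\<close> to points of \<open>K\<close> of equal height over this line, and translating \<open>K\<^sub>i\<close>
  near each vertex of the subdivision, is a displacement of \<open>K\<^sub>i\<close> with Lipschitz constant at most 1/2.  It extends to a
  contraction of space, and the identity plus a contraction is a homeomorphism
  (\<open>contraction_perturbation\<close>, \<open>transversal_approximation\<close>).  After this move the knot lies in \<open>K\<close> except in small balls about
  the vertices of the subdivision, where each of the two knots consists of two arcs along which the distance from the
  vertex increases.

  In such a ball every sphere about the vertex meets each knot in two points.  A rotation,
  followed by a translation in a stereographic projection, takes these points to opposite points of the
  sphere.  It depends continuously on the radius, and so both knots can be straightened to the
  same diameter without moving the spheres (\<open>ball_straightening\<close>).  Straightening one knot and undoing
  the straightening of the other is the identity on the boundary of the ball, and between these two steps a given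
  point can be slid to the centre (\<open>straightening_vertex\<close>).  This works for every angle at the vertex, even at a
  cusp.\<close>

section \<open>Moving two points of a sphere to opposite positions\<close>

text \<open>Stereographic projection from the unit vector \<open>a\<close> identifies the rest of the unit sphere with the
  plane orthogonal to \<open>a\<close>.  This is the translation of that plane by \<open>c\<close>, carried back to the
  sphere; the formula is the result of clearing denominators, and in this form it also makes
  sense at \<open>a\<close>, which it fixes.\<close>

definition stereo_translation :: "'a::real_inner \<Rightarrow> 'a \<Rightarrow> 'a \<Rightarrow> 'a" where
  "stereo_translation a c x =
     a - (2 / (2 + 2 * (x \<bullet> c) + (1 - x \<bullet> a) * (c \<bullet> c))) *\<^sub>R
           ((1 - x \<bullet> a) *\<^sub>R (a - c) - (x - (x \<bullet> a) *\<^sub>R a))"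

text \<open>Away from \<open>a\<close> the denominator is \<open>1 - x \<bullet> a\<close> times one plus the squared norm of the translated
  projection of \<open>x\<close>; this is the identity for \<open>y \<bullet> y\<close> below.\<close>

lemma stereo_translation_denominator:
  fixes a c x :: "'a::real_inner"
  assumes "norm a = 1" "norm x = 1" "a \<bullet> c = 0"
  shows "2 + 2 * (x \<bullet> c) + (1 - x \<bullet> a) * (c \<bullet> c) > 0"
proof -
  define m where "m = 1 - x \<bullet> a"
  define y where "y = x - (x \<bullet> a) *\<^sub>R a + m *\<^sub>R c"
  have aa: "a \<bullet> a = 1" "x \<bullet> x = 1" "c \<bullet> a = 0" "a \<bullet> c = 0"
    using assms by (simp_all add: norm_eq_1 inner_commute)
  have "m \<ge> 0"
    using Cauchy_Schwarz_ineq2[of x a] assms by (simp add: m_def)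
  have "y \<bullet> y + m * m = m * (2 + 2 * (x \<bullet> c) + m * (c \<bullet> c))"
    unfolding y_def m_def using aa
    by (simp add: inner_diff inner_add algebra_simps inner_commute)
  show ?thesis
  proof (cases "m = 0")
    case True
    then have "(x - a) \<bullet> (x - a) = 0"
      using aa by (simp add: inner_diff m_def inner_commute)
    then have "x = a" by simp
    then show ?thesis using True aa by (simp add: m_def)
  next
    case False
    then have "0 < m" using \<open>m \<ge> 0\<close> by simp
    then have "0 < y \<bullet> y + m * m" by (simp add: add_nonneg_pos)
    then have "0 < m * (2 + 2 * (x \<bullet> c) + m * (c \<bullet> c))"
      using \<open>y \<bullet> y + m * m = _\<close> by simp
    then show ?thesis using \<open>0 < m\<close> by (simp add: zero_less_mult_iff m_def)
  qed
qed

lemma stereo_translation: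
  fixes a c x :: "'a::real_inner"
  assumes "norm a = 1" "norm x = 1" "a \<bullet> c = 0"
  shows norm_stereo_translation: "norm (stereo_translation a c x) = 1"
    and stereo_translation_inverse: "stereo_translation a (- c) (stereo_translation a c x) = x"
proof -
  define m where "m = 1 - x \<bullet> a"
  define p where "p = x - (x \<bullet> a) *\<^sub>R a"
  define D where "D = 2 + 2 * (p \<bullet> c) + m * (c \<bullet> c)"
  define m' where "m' = 2 * m / D"
  define p' where "p' = (2 / D) *\<^sub>R (p + m *\<^sub>R c)"
  have aa: "a \<bullet> a = 1" "x \<bullet> x = 1" "c \<bullet> a = 0" "a \<bullet> c = 0"
    using assms by (simp_all add: norm_eq_1 inner_commute)
  have pa: "p \<bullet> a = 0" "a \<bullet> p = 0" "p \<bullet> c = x \<bullet> c"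
    using aa by (simp_all add: p_def inner_diff inner_commute)
  have D: "D > 0"
    using stereo_translation_denominator[OF assms] pa by (simp add: D_def m_def)
  have pp: "p \<bullet> p = m * (2 - m)"
    unfolding p_def m_def using aa by (simp add: inner_diff algebra_simps inner_commute)
  have y: "stereo_translation a c x = (1 - m') *\<^sub>R a + p'"
  proof -
    define k where "k = 2 / D"
    have "stereo_translation a c x = a - k *\<^sub>R (m *\<^sub>R (a - c) - p)"
      by (simp only: stereo_translation_def k_def m_def p_def D_def pa(3)[unfolded p_def])
    also have "\<dots> = (1 - k * m) *\<^sub>R a + k *\<^sub>R (p + m *\<^sub>R c)"
      by (simp add: algebra_simps)
    also have "k * m = m'" by (simp add: k_def m'_def)
    finally show ?thesis by (simp only: p'_def k_def)
  qed
  have x: "x = (1 - m) *\<^sub>R a + p" by (simp add: m_def p_def)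
  have p'a: "p' \<bullet> a = 0" "a \<bullet> p' = 0"
    using pa aa by (simp_all add: p'_def inner_add inner_commute)
  have q: "(p + m *\<^sub>R c) \<bullet> (p + m *\<^sub>R c) = m * D - m * m"
    using pp by (simp add: inner_add D_def algebra_simps inner_commute)
  have "p' \<bullet> p' = (2 / D) * (2 / D) * (m * D - m * m)"
    unfolding p'_def using q by simp
  also have "\<dots> = m' * (2 - m')"
    using D by (simp add: m'_def field_simps)
  finally have p'p': "p' \<bullet> p' = m' * (2 - m')" .
  have "stereo_translation a c x \<bullet> stereo_translation a c x = 1"
    unfolding y using aa p'a p'p' by (simp add: inner_add algebra_simps)
  then show "norm (stereo_translation a c x) = 1" by (simp add: norm_eq_1)
  have xa: "stereo_translation a c x \<bullet> a = 1 - m'"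
    unfolding y using aa p'a by (simp add: inner_add)
  have xc: "stereo_translation a c x \<bullet> c = p' \<bullet> c"
    unfolding y using aa by (simp add: inner_add)
  have p'c: "p' \<bullet> c = (2 / D) * (p \<bullet> c + m * (c \<bullet> c))"
    by (simp add: p'_def inner_add)
  have D': "2 + 2 * (p' \<bullet> (- c)) + m' * (c \<bullet> c) = 4 / D"
    using D unfolding inner_minus_right p'c m'_def
    by (simp add: field_simps) (simp add: D_def algebra_simps)
  have "stereo_translation a (- c) (stereo_translation a c x)
      = a - (2 / (4 / D)) *\<^sub>R (m' *\<^sub>R (a + c) - p')"
    unfolding stereo_translation_def[of a "- c"] xa
    using D' xc y by (simp add: xa)
  also have "\<dots> = a - (D / 2 * m') *\<^sub>R (a + c) + (D / 2) *\<^sub>R p'"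
    by (simp add: algebra_simps)
  also have "D / 2 * m' = m" using D by (simp add: m'_def)
  also have "(D / 2) *\<^sub>R p' = p + m *\<^sub>R c" using D by (simp add: p'_def)
  also have "a - m *\<^sub>R (a + c) + (p + m *\<^sub>R c) = x"
    unfolding x by (simp add: algebra_simps)
  finally show "stereo_translation a (- c) (stereo_translation a c x) = x" .
qed

text \<open>Minus the stereographic projection of \<open>b\<close> from \<open>a\<close>: translating by it brings \<open>b\<close> to the origin of
  the plane, which is the projection of \<open>- a\<close>.\<close>

definition stereo_vector :: "'a::real_inner \<Rightarrow> 'a \<Rightarrow> 'a" where
  "stereo_vector a b = - ((b - (b \<bullet> a) *\<^sub>R a) /\<^sub>R (1 - b \<bullet> a))"

lemma unit_inner_less_1:
  fixes a b :: "'a::real_inner"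
  assumes "norm a = 1" "norm b = 1" "a \<noteq> b"
  shows "b \<bullet> a < 1"
proof -
  have "0 < (b - a) \<bullet> (b - a)" using assms by simp
  then show ?thesis using assms by (simp add: inner_diff inner_commute norm_eq_1)
qed

lemma stereo_vector:
  fixes a b :: "'a::real_inner"
  assumes "norm a = 1" "norm b = 1" "a \<noteq> b"
  shows "a \<bullet> stereo_vector a b = 0"
    and "stereo_translation a (stereo_vector a b) a = a"
    and "stereo_translation a (stereo_vector a b) b = - a"
proof -
  have aa: "a \<bullet> a = 1" "b \<bullet> b = 1" using assms by (simp_all add: norm_eq_1)
  show ac: "a \<bullet> stereo_vector a b = 0"
    using aa by (simp add: stereo_vector_def inner_diff inner_commute)
  show "stereo_translation a (stereo_vector a b) a = a"
    using aa ac by (simp add: stereo_translation_def)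
  define m where "m = 1 - b \<bullet> a"
  define p where "p = b - (b \<bullet> a) *\<^sub>R a"
  have m: "m > 0" using unit_inner_less_1[OF assms] by (simp add: m_def)
  have c: "stereo_vector a b = - (p /\<^sub>R m)" by (simp add: stereo_vector_def m_def p_def)
  have pp: "p \<bullet> p = m * (2 - m)" "b \<bullet> p = m * (2 - m)"
    unfolding p_def m_def using aa by (simp_all add: inner_diff algebra_simps inner_commute)
  have "2 + 2 * (b \<bullet> stereo_vector a b) + m * (stereo_vector a b \<bullet> stereo_vector a b)
     = 2 - 2 * (m * (2 - m)) / m + m * (m * (2 - m)) / (m * m)"
    unfolding c using m by (simp add: pp field_simps)
  also have "\<dots> = m" using m by (simp add: field_simps)
  finally have D: "2 + 2 * (b \<bullet> stereo_vector a b) + m * (stereo_vector a b \<bullet> stereo_vector a b) = m" .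
  have "stereo_translation a (stereo_vector a b) b
      = a - (2 / m) *\<^sub>R (m *\<^sub>R (a + p /\<^sub>R m) - p)"
    unfolding stereo_translation_def using D by (simp add: m_def[symmetric] c p_def[symmetric])
  also have "\<dots> = - a"
  proof -
    have "m *\<^sub>R (a + p /\<^sub>R m) - p = m *\<^sub>R a" using m by (simp add: algebra_simps)
    then show ?thesis using m by (simp add: scaleR_2)
  qed
  finally show "stereo_translation a (stereo_vector a b) b = - a" .
qed

text \<open>The rotation that takes \<open>a\<close> to \<open>w\<close> and fixes the orthogonal complement of their plane.  The
  formula depends continuously on \<open>a\<close>, except at \<open>a = - w\<close>.\<close>

definition rotation_between :: "'a::real_inner \<Rightarrow> 'a \<Rightarrow> 'a \<Rightarrow> 'a" where
  "rotation_between a w x = x - (((a + w) \<bullet> x) / (1 + a \<bullet> w)) *\<^sub>R (a + w) + (2 * (a \<bullet> x)) *\<^sub>R w"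

lemma rotation_between:
  fixes a w x :: "'a::real_inner"
  assumes "norm a = 1" "norm w = 1" "a \<bullet> w \<noteq> - 1"
  shows "norm (rotation_between a w x) = norm x" and "rotation_between w a (rotation_between a w x) = x" and "rotation_between a w a = w"
proof -
  define s where "s = 1 + a \<bullet> w"
  define u where "u = ((a + w) \<bullet> x) / s"
  have s: "s \<noteq> 0" using assms by (simp add: s_def)
  have aa: "a \<bullet> a = 1" "w \<bullet> w = 1" "w \<bullet> a = s - 1" "a \<bullet> w = s - 1"
    using assms by (simp_all add: norm_eq_1 inner_commute s_def)
  have r: "rotation_between a w x = x - u *\<^sub>R (a + w) + (2 * (a \<bullet> x)) *\<^sub>R w"
    by (simp add: rotation_between_def u_def s_def)
  have wx: "w \<bullet> x = u * s - a \<bullet> x" "x \<bullet> w = u * s - a \<bullet> x" "x \<bullet> a = a \<bullet> x"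
    using s by (simp_all add: u_def inner_add inner_commute)
  have "rotation_between a w x \<bullet> rotation_between a w x = x \<bullet> x"
    unfolding r by (simp add: inner_add inner_diff aa wx algebra_simps)
  then show "norm (rotation_between a w x) = norm x" by (simp add: norm_eq_sqrt_inner)
  have i1: "(w + a) \<bullet> rotation_between a w x = 2 * s * (a \<bullet> x) - u * s"
    unfolding r by (simp add: inner_add inner_diff aa wx algebra_simps)
  have i2: "w \<bullet> rotation_between a w x = a \<bullet> x"
    unfolding r by (simp add: inner_add inner_diff aa wx algebra_simps)
  have "rotation_between w a (rotation_between a w x) = rotation_between a w x - ((2 * s * (a \<bullet> x) - u * s) / s) *\<^sub>R (w + a) + (2 * (a \<bullet> x)) *\<^sub>R a"
    unfolding rotation_between_def[of w a] i1 i2 using aa by simp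
  also have "(2 * s * (a \<bullet> x) - u * s) / s = 2 * (a \<bullet> x) - u"
    using s by (simp add: field_simps)
  finally show "rotation_between w a (rotation_between a w x) = x"
    unfolding r by (simp add: algebra_simps)
  show "rotation_between a w a = w"
    using s aa by (simp add: rotation_between_def inner_add field_simps scaleR_2)
qed

text \<open>Rotate \<open>a\<close> to the fixed vector \<open>w\<close>, then push \<open>b\<close> to \<open>- w\<close> by a translation fixing \<open>w\<close>.  The
  translation works wherever \<open>b\<close> is, and no angle has to be chosen, so that the map is a
  continuous function of \<open>a\<close> and \<open>b\<close> even if \<open>b\<close> winds around \<open>a\<close> any number of times.\<close>

definition sphere_straightening :: "'a::real_inner \<Rightarrow> 'a \<Rightarrow> 'a \<Rightarrow> 'a \<Rightarrow> 'a" where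
  "sphere_straightening w a b x = stereo_translation w (stereo_vector w (rotation_between a w b)) (rotation_between a w x)"

lemma sphere_straightening:
  fixes a b w :: "'a::real_inner"
  assumes "norm a = 1" "norm b = 1" "norm w = 1" "a \<noteq> b" "a \<bullet> w \<noteq> - 1"
  shows "norm x = 1 \<Longrightarrow> norm (sphere_straightening w a b x) = 1"
    and "inj_on (sphere_straightening w a b) (sphere 0 1)"
    and "sphere_straightening w a b a = w"
    and "sphere_straightening w a b b = - w"
    and "norm y = 1 \<Longrightarrow> \<exists>x. norm x = 1 \<and> sphere_straightening w a b x = y"
proof -
  have aw: "w \<bullet> a \<noteq> - 1" using assms by (simp add: inner_commute)
  note R = rotation_between[OF assms(1,3,5)] and R' = rotation_between[OF assms(3,1) aw]
  have nb: "norm (rotation_between a w b) = 1" "w \<noteq> rotation_between a w b"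
    using R assms by (metis)+
  note v = stereo_vector[OF assms(3) nb]
  have v': "w \<bullet> - stereo_vector w (rotation_between a w b) = 0" using v(1) by simp
  show "norm (sphere_straightening w a b x) = 1" if "norm x = 1" for x
    unfolding sphere_straightening_def using norm_stereo_translation[OF assms(3) _ v(1)] R that by simp
  show "inj_on (sphere_straightening w a b) (sphere 0 1)"
    by (rule inj_on_inverseI[where g = "\<lambda>y. rotation_between w a (stereo_translation w (- stereo_vector w (rotation_between a w b)) y)"])
       (use stereo_translation_inverse[OF assms(3) _ v(1)] R in \<open>simp add: sphere_straightening_def\<close>)
  show "sphere_straightening w a b a = w" "sphere_straightening w a b b = - w"
    unfolding sphere_straightening_def using R v by simp_all
  show "\<exists>x. norm x = 1 \<and> sphere_straightening w a b x = y" if "norm y = 1"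
  proof (intro exI conjI)
    let ?z = "stereo_translation w (- stereo_vector w (rotation_between a w b)) y"
    have z: "norm ?z = 1" using norm_stereo_translation[OF assms(3) that v'] .
    show "norm (rotation_between w a ?z) = 1" using R' z by simp
    show "sphere_straightening w a b (rotation_between w a ?z) = y"
      unfolding sphere_straightening_def
      using R' stereo_translation_inverse[OF assms(3) that v'] by simp
  qed
qed

lemma continuous_on_sphere_straightening:
  fixes a b x :: "'b::topological_space \<Rightarrow> 'a::real_inner"
  assumes "continuous_on S a" "continuous_on S b" "continuous_on S x" "norm w = 1"
    and *: "\<And>s. s \<in> S \<Longrightarrow> norm (a s) = 1 \<and> norm (b s) = 1 \<and> norm (x s) = 1 \<and> a s \<noteq> b s \<and> a s \<bullet> w \<noteq> - 1"
  shows "continuous_on S (\<lambda>s. sphere_straightening w (a s) (b s) (x s))"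
proof -
  have 1: "1 + a s \<bullet> w \<noteq> 0" if "s \<in> S" for s using *[OF that] by auto
  have nb: "norm (rotation_between (a s) w (b s)) = 1" "w \<noteq> rotation_between (a s) w (b s)" if "s \<in> S" for s
    using rotation_between(1,3)[OF _ assms(4), of "a s"] rotation_between(2)[OF _ assms(4), of "a s"] *[OF that] by metis+
  have r: "continuous_on S (\<lambda>s. rotation_between (a s) w (b s))" "continuous_on S (\<lambda>s. rotation_between (a s) w (x s))"
    unfolding rotation_between_def using 1 by (intro continuous_intros assms; force)+
  have 2: "1 - rotation_between (a s) w (b s) \<bullet> w \<noteq> 0" if "s \<in> S" for s
    using unit_inner_less_1[OF assms(4) nb(1) nb(2), OF that that] by simp
  have v: "continuous_on S (\<lambda>s. stereo_vector w (rotation_between (a s) w (b s)))"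
    unfolding stereo_vector_def using 2 by (intro continuous_intros r) auto
  have 3: "2 + 2 * (rotation_between (a s) w (x s) \<bullet> stereo_vector w (rotation_between (a s) w (b s))) +
            (1 - rotation_between (a s) w (x s) \<bullet> w) * (stereo_vector w (rotation_between (a s) w (b s)) \<bullet> stereo_vector w (rotation_between (a s) w (b s))) \<noteq> 0"
    if "s \<in> S" for s
  proof -
    have "norm (rotation_between (a s) w (x s)) = 1"
      using rotation_between(1)[OF _ assms(4), of "a s"] *[OF that] by auto
    from stereo_translation_denominator[OF assms(4) this stereo_vector(1)[OF assms(4) nb[OF that]]]
    show ?thesis by linarith
  qed
  show ?thesis
    unfolding sphere_straightening_def stereo_translation_def
    using 3 by (intro continuous_intros r v) auto
qed

section \<open>Straightening two strands inside a ball\<close>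

text \<open>A curve that meets every sphere about the origin of radius at most \<open>r\<close> exactly once,
  parametrized by the radius.\<close>

definition radial_strand :: "real \<Rightarrow> (real \<Rightarrow> 'a::real_inner) \<Rightarrow> bool" where
  "radial_strand r e \<longleftrightarrow> continuous_on {0..r} e \<and> (\<forall>\<rho>\<in>{0..r}. norm (e \<rho>) = \<rho>)"

definition ball_straightening :: "'a::real_inner \<Rightarrow> (real \<Rightarrow> 'a) \<Rightarrow> (real \<Rightarrow> 'a) \<Rightarrow> 'a \<Rightarrow> 'a" where
  "ball_straightening w e f x =
     norm x *\<^sub>R sphere_straightening w (e (norm x) /\<^sub>R norm x) (f (norm x) /\<^sub>R norm x) (x /\<^sub>R norm x)"

text \<open>Two disjoint radial strands leaving the centre are taken to the two halves of a diameter, one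
  sphere at a time.  At the centre the maps of the spheres need not converge, but the
  spheres shrink to a point, so the result is continuous there all the same.  This is why strands
  meeting in a cusp, which may twist around each other infinitely often, need no special treatment.\<close>

lemma ball_straightening:
  fixes w :: "'a::real_inner"
  assumes w: "norm w = 1" and "r > 0" and e: "radial_strand r e" and f: "radial_strand r f"
    and apart: "\<forall>\<rho>\<in>{0<..r}. e \<rho> \<noteq> f \<rho> \<and> e \<rho> \<bullet> w > 0"
  defines "C \<equiv> ball_straightening w e f"
  shows "continuous_on (cball 0 r) C" and "inj_on C (cball 0 r)" and "C ` cball 0 r = cball 0 r"
    and "\<And>x. x \<in> cball 0 r \<Longrightarrow> norm (C x) = norm x"
    and "\<And>\<rho>. \<rho> \<in> {0..r} \<Longrightarrow> C (e \<rho>) = \<rho> *\<^sub>R w"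
    and "\<And>\<rho>. \<rho> \<in> {0..r} \<Longrightarrow> C (f \<rho>) = - (\<rho> *\<^sub>R w)"
proof -
  have ef: "e \<rho> \<noteq> f \<rho>" and ew: "e \<rho> \<bullet> w > 0" if "\<rho> \<in> {0<..r}" for \<rho>
    using apart that by auto
  let ?A = "\<lambda>\<rho>. e \<rho> /\<^sub>R \<rho>" and ?B = "\<lambda>\<rho>. f \<rho> /\<^sub>R \<rho>"
  have AB: "norm (?A \<rho>) = 1" "norm (?B \<rho>) = 1" "?A \<rho> \<noteq> ?B \<rho>" "?A \<rho> \<bullet> w \<noteq> - 1"
    if "\<rho> \<in> {0<..r}" for \<rho>
    using that e f ef[OF that] ew[OF that]
    by (auto simp: radial_strand_def field_simps intro: order_less_imp_not_eq2)
  note S = sphere_straightening[OF AB(1,2) w AB(3,4)]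
  have C0: "C 0 = 0" by (simp add: C_def ball_straightening_def)
  have u: "norm (x /\<^sub>R norm x) = 1" if "x \<noteq> 0" for x :: 'a using that by simp
  have pos: "norm x \<in> {0<..r}" if "x \<in> cball 0 r" "x \<noteq> 0" for x :: 'a using that by simp
  show nC: "norm (C x) = norm x" if "x \<in> cball 0 r" for x
  proof (cases "x = 0")
    case True then show ?thesis using C0 by simp
  next
    case False
    then show ?thesis
      using S(1)[OF pos[OF that False] pos[OF that False] pos[OF that False] pos[OF that False] u[OF False]]
      by (simp add: C_def ball_straightening_def)
  qed
  show Ce: "C (e \<rho>) = \<rho> *\<^sub>R w" if "\<rho> \<in> {0..r}" for \<rho>
  proof (cases "\<rho> = 0")
    case True
    then show ?thesis using that e nC[of "e \<rho>"] by (auto simp: radial_strand_def)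
  next
    case False
    then have "\<rho> \<in> {0<..r}" "norm (e \<rho>) = \<rho>" using that e by (auto simp: radial_strand_def)
    then show ?thesis using S(3) by (simp add: C_def ball_straightening_def)
  qed
  show Cf: "C (f \<rho>) = - (\<rho> *\<^sub>R w)" if "\<rho> \<in> {0..r}" for \<rho>
  proof (cases "\<rho> = 0")
    case True
    then show ?thesis using that f nC[of "f \<rho>"] by (auto simp: radial_strand_def)
  next
    case False
    then have "\<rho> \<in> {0<..r}" "norm (f \<rho>) = \<rho>" using that f by (auto simp: radial_strand_def)
    then show ?thesis using S(4) by (simp add: C_def ball_straightening_def)
  qed
  show "inj_on C (cball 0 r)"
  proof (rule inj_onI)
    fix x y assume xy: "x \<in> cball 0 r" "y \<in> cball 0 r" "C x = C y"
    then have n: "norm x = norm y" using nC by metis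
    show "x = y"
    proof (cases "x = 0")
      case True then show ?thesis using n by simp
    next
      case False
      then have y: "y \<noteq> 0" using n by auto
      note p = pos[OF xy(1) False]
      have "norm x *\<^sub>R sphere_straightening w (?A (norm x)) (?B (norm x)) (x /\<^sub>R norm x)
          = norm x *\<^sub>R sphere_straightening w (?A (norm x)) (?B (norm x)) (y /\<^sub>R norm x)"
        using xy(3) unfolding C_def ball_straightening_def n[symmetric] .
      then have "sphere_straightening w (?A (norm x)) (?B (norm x)) (x /\<^sub>R norm x)
          = sphere_straightening w (?A (norm x)) (?B (norm x)) (y /\<^sub>R norm x)"
        using False by (simp only: scaleR_cancel_left norm_eq_zero) simp
      then have "x /\<^sub>R norm x = y /\<^sub>R norm x"
        by (rule inj_onD[OF S(2)[OF p p p p]]) (use u[OF False] u[OF y] in \<open>simp_all add: n\<close>)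
      then show ?thesis using False by simp
    qed
  qed
  show "C ` cball 0 r = cball 0 r"
  proof (intro set_eqI iffI)
    fix y assume "y \<in> C ` cball 0 r" then show "y \<in> cball 0 r" using nC by auto
  next
    fix y :: 'a assume y: "y \<in> cball 0 r"
    show "y \<in> C ` cball 0 r"
    proof (cases "y = 0")
      case True then show ?thesis using C0 \<open>r > 0\<close> by (metis centre_in_cball image_eqI less_imp_le)
    next
      case False
      note p = pos[OF y False]
      from S(5)[OF p p p p u[OF False]] obtain z where z: "norm z = 1"
        "sphere_straightening w (?A (norm y)) (?B (norm y)) z = y /\<^sub>R norm y" by blast
      let ?x = "norm y *\<^sub>R z"
      have "norm ?x = norm y" using z by simp
      then have "C ?x = y" using z False by (simp add: C_def ball_straightening_def)
      then show ?thesis using y z by (intro image_eqI[of _ _ ?x]) auto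
    qed
  qed
  have cn: "continuous_on (cball 0 r - {0}) (\<lambda>x::'a. e (norm x))"
       "continuous_on (cball 0 r - {0}) (\<lambda>x::'a. f (norm x))"
  proof -
    have "(\<lambda>x::'a. norm x) ` (cball 0 r - {0}) \<subseteq> {0..r}" by auto
    moreover have "continuous_on (cball 0 r - {0}) (\<lambda>x::'a. norm x)" by (intro continuous_intros)
    ultimately show "continuous_on (cball 0 r - {0}) (\<lambda>x::'a. e (norm x))"
       "continuous_on (cball 0 r - {0}) (\<lambda>x::'a. f (norm x))"
      using e f unfolding radial_strand_def by (metis continuous_on_compose2)+
  qed
  have "continuous_on (cball 0 r - {0}) C"
    unfolding C_def ball_straightening_def
  proof (rule continuous_on_scaleR[OF _ continuous_on_sphere_straightening])
    have ni: "continuous_on (cball 0 r - {0}) (\<lambda>x::'a. inverse (norm x))"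
      by (intro continuous_intros) auto
    show "continuous_on (cball 0 r - {0}) (\<lambda>x::'a. norm x)" by (intro continuous_intros)
    show "continuous_on (cball 0 r - {0}) (\<lambda>x::'a. ?A (norm x))"
      "continuous_on (cball 0 r - {0}) (\<lambda>x::'a. ?B (norm x))"
      "continuous_on (cball 0 r - {0}) (\<lambda>x::'a. x /\<^sub>R norm x)"
      by (rule continuous_on_scaleR[OF ni]; rule cn continuous_on_id)+
    show "norm w = 1" by (rule w)
    fix x :: 'a assume "x \<in> cball 0 r - {0}"
    then have p: "norm x \<in> {0<..r}" "x \<noteq> 0" by auto
    then show "norm (?A (norm x)) = 1 \<and> norm (?B (norm x)) = 1 \<and> norm (x /\<^sub>R norm x) = 1
        \<and> ?A (norm x) \<noteq> ?B (norm x) \<and> ?A (norm x) \<bullet> w \<noteq> - 1"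
      using AB[OF p(1)] u[OF p(2)] by blast
  qed
  then have c1: "continuous (at x within cball 0 r) C" if "x \<in> cball 0 r" "x \<noteq> 0" for x
  proof -
    have "continuous (at x within cball 0 r - {0}) C"
      using that \<open>continuous_on _ C\<close> by (auto simp: continuous_on_eq_continuous_within)
    moreover have "at x within cball 0 r - {0} = at x within cball 0 r"
      using that by (intro at_within_nhd[of _ "- {0}"]) auto
    ultimately show ?thesis by (simp add: continuous_within)
  qed
  have c0: "continuous (at 0 within cball 0 r) C"
    unfolding continuous_within C0
  proof (rule Lim_null_comparison)
    show "\<forall>\<^sub>F x in at 0 within cball 0 r. norm (C x) \<le> norm x"
      using nC by (auto simp: eventually_at_filter)
    show "((\<lambda>x. norm x) \<longlongrightarrow> 0) (at 0 within cball (0::'a) r)"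
      by (intro tendsto_norm_zero tendsto_ident_at)
  qed
  show "continuous_on (cball 0 r) C"
    unfolding continuous_on_eq_continuous_within using c0 c1 by metis
qed

text \<open>The subtracted vector is a function of \<open>x\<close> with Lipschitz constant \<open>norm a / s\<close>, which is less than 1.\<close>

lemma bump_translation:
  fixes a c :: "'a::real_normed_vector"
  assumes "norm a < s" 
  defines "L \<equiv> \<lambda>x. x - max 0 (1 - norm (x - c) / s) *\<^sub>R a"
  shows "continuous_on UNIV L" "inj L"
proof -
  have s: "s > 0" using assms(1) norm_ge_zero[of a] by linarith
  show "continuous_on UNIV L" unfolding L_def using s by (intro continuous_intros) auto
  show "inj L"
  proof (rule injI)
    fix x y assume "L x = L y"
    then have "x - y = (max 0 (1 - norm (x - c) / s) - max 0 (1 - norm (y - c) / s)) *\<^sub>R a"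
      by (simp add: L_def algebra_simps)
    then have "norm (x - y) = \<bar>max 0 (1 - norm (x - c) / s) - max 0 (1 - norm (y - c) / s)\<bar> * norm a"
      by simp
    also have "\<bar>max 0 (1 - norm (x - c) / s) - max 0 (1 - norm (y - c) / s)\<bar>
        \<le> \<bar>norm (x - c) / s - norm (y - c) / s\<bar>" by linarith
    also have "\<dots> = \<bar>norm (x - c) - norm (y - c)\<bar> / s"
      using s by (simp add: diff_divide_distrib[symmetric])
    also have "\<dots> \<le> norm (x - y) / s"
      using s norm_triangle_ineq3[of "x - c" "y - c"] by (simp add: divide_right_mono)
    finally have "norm (x - y) \<le> norm (x - y) / s * norm a"
      by (simp add: mult_right_mono)
    then have "norm (x - y) * (s - norm a) \<le> 0" using s by (simp add: field_simps)
    then show "x = y" using assms(1) by (simp add: mult_le_0_iff)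
  qed
qed

text \<open>If two pairs of strands agree on the boundary sphere, straightening the pair \<open>e'\<close>, \<open>f'\<close> and undoing
  the straightening of \<open>e\<close>, \<open>f\<close> is the identity on that sphere, since the straightening
  of a sphere depends only on the two points in it.  In between, when both pairs have
  become the same diameter, a given point \<open>pt\<close> of the diameter can be slid to the centre.\<close>

lemma straightening_vertex:
  fixes w :: "'a::euclidean_space"
  assumes w: "norm w = 1" and "r > 0"
    and strands: "radial_strand r e" "radial_strand r f" "radial_strand r e'" "radial_strand r f'"
    and apart: "\<forall>\<rho>\<in>{0<..r}. e \<rho> \<noteq> f \<rho> \<and> e \<rho> \<bullet> w > 0"
    and apart': "\<forall>\<rho>\<in>{0<..r}. e' \<rho> \<noteq> f' \<rho> \<and> e' \<rho> \<bullet> w > 0"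
    and "e' r = e r" "f' r = f r"
    and pt: "pt \<in> e' ` {0..r} \<union> f' ` {0..r}" "norm pt < r / 2"
  obtains V where "continuous_on UNIV V" "inj V" "\<And>x. norm x \<ge> r \<Longrightarrow> V x = x"
    "\<And>x. norm x \<le> r \<Longrightarrow> norm (V x) \<le> r"
    "V ` (e' ` {0..r} \<union> f' ` {0..r}) \<subseteq> e ` {0..r} \<union> f ` {0..r}" "V pt = 0"
proof -
  define C where "C = ball_straightening w e f"
  define C' where "C' = ball_straightening w e' f'"
  note C = ball_straightening[OF w \<open>r > 0\<close> strands(1,2) apart, folded C_def]
  note C' = ball_straightening[OF w \<open>r > 0\<close> strands(3,4) apart', folded C'_def]
  let ?B = "cball (0::'a) r"
  define Ci where "Ci = inv_into ?B C"
  have Ci: "Ci (C x) = x" if "x \<in> ?B" for x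
    using C(2) that by (simp add: Ci_def inv_into_f_f)
  have Ci': "Ci y \<in> ?B" "C (Ci y) = y" if "y \<in> ?B" for y
    using that C(3) unfolding Ci_def by (metis inv_into_into, metis f_inv_into_f)
  have contCi: "continuous_on ?B Ci"
    using continuous_on_inv[OF C(1) compact_cball, of Ci] Ci C(3) by auto
  have onS: "C x = C' x" if "norm x = r" for x
    using that assms(9,10) by (simp add: C_def C'_def ball_straightening_def)
  have axis: "\<exists>s. C' x = s *\<^sub>R w" if "x \<in> e' ` {0..r} \<union> f' ` {0..r}" for x
    using that
  proof
    assume "x \<in> e' ` {0..r}"
    then show ?thesis using C'(5) by blast
  next
    assume "x \<in> f' ` {0..r}"
    then obtain \<rho> where "\<rho> \<in> {0..r}" "x = f' \<rho>" by blast
    then have "C' x = (- \<rho>) *\<^sub>R w" using C'(6) by simp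
    then show ?thesis by blast
  qed
  obtain \<alpha> where \<alpha>: "C' pt = \<alpha> *\<^sub>R w" using axis[OF pt(1)] by blast
  have n\<alpha>: "norm (\<alpha> *\<^sub>R w) = norm pt"
    using C'(4)[of pt] pt(2) \<open>r > 0\<close> \<alpha> by simp
  \<comment> \<open>the slide: it moves points in the direction of the diameter only, so it preserves the diameter\<close>
  define L where "L = (\<lambda>x. x - max 0 (1 - norm (x - \<alpha> *\<^sub>R w) / (r/2)) *\<^sub>R (\<alpha> *\<^sub>R w))"
  have L: "continuous_on UNIV L" "inj L"
    using bump_translation[of "\<alpha> *\<^sub>R w" "r/2" "\<alpha> *\<^sub>R w"] n\<alpha> pt(2) by (simp_all add: L_def)
  have Lout: "L x = x" if "norm x \<ge> r" for x
  proof -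
    have "norm (x - \<alpha> *\<^sub>R w) \<ge> r / 2"
      using that n\<alpha> pt(2) norm_triangle_ineq2[of x "\<alpha> *\<^sub>R w"] by linarith
    then show ?thesis using \<open>r > 0\<close> by (simp add: L_def field_simps)
  qed
  have Lin: "norm (L x) \<le> r" if "norm x \<le> r" for x
  proof (rule ccontr)
    assume "\<not> norm (L x) \<le> r"
    then have "L (L x) = L x" using Lout by simp
    then have "L x = x" using L(2) by (simp add: inj_eq)
    then show False using that \<open>\<not> _\<close> by simp
  qed
  have Lw: "\<exists>t. L (s *\<^sub>R w) = t *\<^sub>R w" for s
    by (rule exI[of _ "s - max 0 (1 - norm (s *\<^sub>R w - \<alpha> *\<^sub>R w) / (r/2)) * \<alpha>"])
       (simp add: L_def algebra_simps)
  define V where "V = (\<lambda>x. if norm x \<le> r then Ci (L (C' x)) else x)"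
  have C'B: "C' x \<in> ?B" if "norm x \<le> r" for x using C'(4)[of x] that by simp
  have LB: "L (C' x) \<in> ?B" if "norm x \<le> r" for x using Lin C'B[OF that] by simp
  have VB: "norm (V x) \<le> r" if "norm x \<le> r" for x
    using Ci'(1)[OF LB[OF that]] that by (simp add: V_def)
  have Vout: "V x = x" if "norm x \<ge> r" for x
  proof (cases "norm x = r")
    case True
    then have "norm (C' x) = r" using C'(4)[of x] by simp
    then have "V x = Ci (C x)" using True Lout onS by (simp add: V_def)
    then show ?thesis using Ci True by simp
  qed (use that in \<open>simp add: V_def\<close>)
  have "continuous_on {x. norm x \<le> r} (\<lambda>x. Ci (L (C' x)))"
  proof -
    have B: "{x::'a. norm x \<le> r} = ?B" by auto
    show ?thesis unfolding B
      by (rule continuous_on_compose2[OF contCi continuous_on_compose2[OF L(1) C'(1)]]) (use LB in auto)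
  qed
  moreover have "Ci (L (C' x)) = x" if "norm x = r" for x
    using Vout[of x] that by (simp add: V_def)
  ultimately have "continuous_on ({x. norm x \<le> r} \<union> {x. norm x \<ge> r}) V"
    unfolding V_def
    by (intro continuous_on_cases closed_Collect_le continuous_intros)
       auto
  moreover have "{x::'a. norm x \<le> r} \<union> {x. norm x \<ge> r} = UNIV" by auto
  ultimately have 1: "continuous_on UNIV V" by simp
  have 2: "inj V"
  proof (rule injI)
    fix x y assume xy: "V x = V y"
    consider "norm x \<le> r" "norm y \<le> r" | "norm x > r" "norm y > r"
      | "norm x \<le> r" "norm y > r" | "norm x > r" "norm y \<le> r" by linarith
    then show "x = y"
    proof cases
      case 1
      then have "Ci (L (C' x)) = Ci (L (C' y))" using xy by (simp add: V_def)
      then have "C (Ci (L (C' x))) = C (Ci (L (C' y)))" by (rule arg_cong)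
      then have "L (C' x) = L (C' y)"
        unfolding Ci'(2)[OF LB[OF 1(1)]] Ci'(2)[OF LB[OF 1(2)]] .
      then have "C' x = C' y" using L(2) by (simp add: inj_eq)
      then show ?thesis by (rule inj_onD[OF C'(2)]) (use 1 in simp_all)
    next
      case 2
      have "x = V x" using Vout[of x] 2(1) by simp
      also note xy
      also have "V y = y" using Vout[of y] 2(2) by simp
      finally show ?thesis .
    next
      case 3
      have "norm (V x) \<le> r" using VB 3(1) .
      moreover have "V y = y" using Vout 3(2) by simp
      ultimately have "norm y \<le> r" unfolding xy by (rule back_subst[where P = "\<lambda>z. norm z \<le> r"])
      then show ?thesis using 3(2) by linarith
    next
      case 4
      have "norm (V y) \<le> r" using VB 4(2) .
      moreover have "V x = x" using Vout 4(1) by simp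
      ultimately have "norm x \<le> r" unfolding xy[symmetric] by (rule back_subst[where P = "\<lambda>z. norm z \<le> r"])
      then show ?thesis using 4(1) by linarith
    qed
  qed
  have 3: "V x \<in> e ` {0..r} \<union> f ` {0..r}" if x: "x \<in> e' ` {0..r} \<union> f' ` {0..r}" for x
  proof -
    have nx: "norm x \<le> r" using x strands(3,4) by (auto simp: radial_strand_def)
    obtain s where "C' x = s *\<^sub>R w" using axis[OF x] by blast
    then obtain t where t: "L (C' x) = t *\<^sub>R w" using Lw by metis
    then have tr: "\<bar>t\<bar> \<le> r" using LB[OF nx] w by simp
    show ?thesis
    proof (cases "t \<ge> 0")
      case True
      then have "L (C' x) = C (e t)" using C(5)[of t] t tr by simp
      moreover have "e t \<in> ?B" using strands(1) tr True by (simp add: radial_strand_def)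
      ultimately have "V x = e t" using Ci nx by (simp add: V_def)
      then show ?thesis using True tr by auto
    next
      case False
      then have "L (C' x) = C (f (- t))" using C(6)[of "- t"] t tr by simp
      moreover have "f (- t) \<in> ?B" using strands(2) tr False by (simp add: radial_strand_def)
      ultimately have "V x = f (- t)" using Ci nx by (simp add: V_def)
      then show ?thesis using False tr by auto
    qed
  qed
  have "L (\<alpha> *\<^sub>R w) = 0" by (simp add: L_def)
  moreover have "C 0 = 0" by (simp add: C_def ball_straightening_def)
  ultimately have 4: "V pt = 0"
    using pt(2) \<open>r > 0\<close> \<alpha> Ci[of 0] by (simp add: V_def)
  show ?thesis using that[OF 1 2 Vout VB _ 4] 3 by blast
qed

section \<open>Homeomorphisms that move points little\<close>

text \<open>The image is open by invariance of domain.  It is closed because preimages of a convergent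
  sequence stay bounded, so that a subsequence of them converges.\<close>

lemma bounded_displacement_homeomorphism:
  fixes f :: "'a::euclidean_space \<Rightarrow> 'a"
  assumes f: "continuous_on UNIV f" "inj f" and M: "\<And>x. norm (f x - x) \<le> M"
  obtains g where "homeomorphism UNIV UNIV f g"
proof -
  obtain g where g: "homeomorphism UNIV (range f) f g"
    using invariance_of_domain_homeomorphism[of UNIV f] f by auto
  have "open (range f)" using invariance_of_domain[OF f(1) open_UNIV f(2)] .
  moreover have "closed (range f)"
    unfolding closed_sequential_limits
  proof clarify
    fix y l assume y: "\<forall>n. y n \<in> range f" and l: "y \<longlonglongrightarrow> l"
    define x where "x n = inv f (y n)" for n
    have x: "y n = f (x n)" for n using y by (simp add: x_def f_inv_into_f)
    have "bounded (range y)" using l by (rule convergent_imp_bounded)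
    then obtain b where b: "\<And>n. norm (y n) \<le> b" by (auto simp: bounded_iff)
    have "norm (x n) \<le> b + M" for n
      using b[of n] M[of "x n"] x[of n] norm_triangle_ineq3[of "f (x n)" "x n"] by simp
    then have "bounded (range x)" by (auto simp: bounded_iff)
    then obtain z \<sigma> where z: "strict_mono \<sigma>" "(x \<circ> \<sigma>) \<longlonglongrightarrow> z"
      using bounded_imp_convergent_subsequence by blast
    have "(\<lambda>n. f ((x \<circ> \<sigma>) n)) \<longlonglongrightarrow> f z"
      using continuous_on_tendsto_compose[OF f(1) z(2)] by simp
    moreover have "(y \<circ> \<sigma>) \<longlonglongrightarrow> l" using l z(1) by (rule LIMSEQ_subseq_LIMSEQ)
    moreover have "y \<circ> \<sigma> = (\<lambda>n. f ((x \<circ> \<sigma>) n))" using x by auto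
    ultimately have "f z = l" using LIMSEQ_unique by metis
    then show "l \<in> range f" by auto
  qed
  ultimately have "range f = UNIV" using clopen[of "range f"] by auto
  then show ?thesis using that g by simp
qed

text \<open>The greatest extension with the given Lipschitz constant is the infimum of the cones above the
  given values; truncating it keeps both the constant and the bound.  The function to be
  extended is given by an indexed family, so that it need not be shown to be well defined on
  points that carry several indices.\<close>

lemma McShane_extension:
  fixes X :: "'i \<Rightarrow> 'a::metric_space" and Y :: "'i \<Rightarrow> real"
  assumes L: "L \<ge> 0" and M: "M \<ge> 0"
    and lip: "\<And>i j. i \<in> I \<Longrightarrow> j \<in> I \<Longrightarrow> \<bar>Y i - Y j\<bar> \<le> L * dist (X i) (X j)"
    and bd: "\<And>i. i \<in> I \<Longrightarrow> \<bar>Y i\<bar> \<le> M"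
  obtains F where "\<And>i. i \<in> I \<Longrightarrow> F (X i) = Y i" "\<And>x. \<bar>F x\<bar> \<le> M"
    "\<And>x y. \<bar>F x - F y\<bar> \<le> L * dist x y"
proof (cases "I = {}")
  case True then show ?thesis by (intro that[where F = "\<lambda>_. 0"]) (use L M in simp_all)
next
  case False
  define G where "G = (\<lambda>x. INF i\<in>I. Y i + L * dist x (X i))"
  have below: "bdd_below ((\<lambda>i. Y i + L * dist x (X i)) ` I)" for x
  proof (rule bdd_belowI2)
    fix i assume "i \<in> I"
    then show "- M \<le> Y i + L * dist x (X i)" using bd[of i] L by (smt (verit) mult_nonneg_nonneg zero_le_dist)
  qed
  have G1: "G x \<le> G y + L * dist x y" for x y
  proof -
    have "G x - L * dist x y \<le> Y i + L * dist y (X i)" if "i \<in> I" for i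
    proof -
      have "G x \<le> Y i + L * dist x (X i)" unfolding G_def by (rule cINF_lower[OF below that])
      also have "L * dist x (X i) \<le> L * (dist x y + dist y (X i))"
        using L dist_triangle by (intro mult_left_mono) auto
      finally show ?thesis by (simp add: algebra_simps)
    qed
    then have "G x - L * dist x y \<le> G y" unfolding G_def by (rule cINF_greatest[OF False])
    then show ?thesis by simp
  qed
  have G2: "G (X i) = Y i" if "i \<in> I" for i
  proof (rule antisym)
    show "G (X i) \<le> Y i" using cINF_lower[OF below[of "X i"] that] unfolding G_def by simp
    show "Y i \<le> G (X i)" unfolding G_def
    proof (rule cINF_greatest[OF False])
      fix j assume "j \<in> I"
      then show "Y i \<le> Y j + L * dist (X i) (X j)" using lip[OF that \<open>j \<in> I\<close>] by linarith
    qed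
  qed
  show ?thesis
  proof (rule that[where F = "\<lambda>x. max (- M) (min M (G x))"])
    fix i assume "i \<in> I" then show "max (- M) (min M (G (X i))) = Y i" using G2 bd[of i] by fastforce
  next
    fix x show "\<bar>max (- M) (min M (G x))\<bar> \<le> M" using M by linarith
  next
    fix x y show "\<bar>max (- M) (min M (G x)) - max (- M) (min M (G y))\<bar> \<le> L * dist x y"
      using G1[of x y] G1[of y x] by (simp add: dist_commute)
  qed
qed

lemma norm_le_sqrt3_bound:
  fixes x :: "real^3"
  assumes "\<And>i. \<bar>x $ i\<bar> \<le> b"
  shows "norm x \<le> 7/4 * b"
proof -
  have b: "b \<ge> 0" using assms[of 1] by linarith
  have "norm x ^ 2 = (\<Sum>i\<in>UNIV. (x $ i)^2)" by (simp add: norm_vec_def L2_set_def sum_nonneg)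
  also have "\<dots> \<le> (\<Sum>i\<in>(UNIV::3 set). b^2)"
    using assms by (intro sum_mono) (metis abs_ge_zero power2_abs power_mono)
  also have "\<dots> = 3 * b^2" by simp
  \<comment> \<open>7/4 is an upper bound for the square root of 3\<close>
  also have "\<dots> \<le> (7/4 * b)^2" by (simp add: power2_eq_square)
  finally show ?thesis using b by (simp add: power2_le_iff_abs_le)
qed

text \<open>A displacement of a subset of space with Lipschitz constant 1/2 extends, coordinate by
  coordinate, to all of space.  This costs a factor \<open>sqrt 3 \<le> 7/4\<close>, so the extension is still a
  contraction, and the identity plus a contraction is injective.\<close>

lemma contraction_perturbation:
  fixes X U :: "'i \<Rightarrow> real^3"
  assumes lip: "\<And>i j. i \<in> I \<Longrightarrow> j \<in> I \<Longrightarrow> norm (U i - U j) \<le> 1/2 * norm (X i - X j)"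
    and bd: "\<And>i. i \<in> I \<Longrightarrow> norm (U i) \<le> M" and "M \<ge> 0"
  obtains H where "continuous_on UNIV H" "inj H" "\<And>x. norm (H x - x) \<le> 2 * M"
    "\<And>i. i \<in> I \<Longrightarrow> H (X i) = X i + U i"
proof -
  have "\<exists>F. (\<forall>i\<in>I. F (X i) = U i $ k) \<and> (\<forall>x. \<bar>F x\<bar> \<le> M) \<and> (\<forall>x y. \<bar>F x - F y\<bar> \<le> 1/2 * dist x y)" for k
  proof -
    have "\<bar>U i $ k - U j $ k\<bar> \<le> 1/2 * dist (X i) (X j)" if "i \<in> I" "j \<in> I" for i j
      using lip[OF that] component_le_norm_cart[of "U i - U j" k] by (simp add: dist_norm)
    moreover have "\<bar>U i $ k\<bar> \<le> M" if "i \<in> I" for i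
      using bd[OF that] component_le_norm_cart[of "U i" k] by simp
    ultimately obtain F where "\<And>i. i \<in> I \<Longrightarrow> F (X i) = U i $ k" "\<And>x. \<bar>F x\<bar> \<le> M"
      "\<And>x y. \<bar>F x - F y\<bar> \<le> 1/2 * dist x y"
      by (rule McShane_extension[where L = "1/2" and M = M and I = I and Y = "\<lambda>i. U i $ k" and X = X, rotated 2])
         (use \<open>M \<ge> 0\<close> in auto)
    then show ?thesis by blast
  qed
  then obtain F where F: "\<And>k i. i \<in> I \<Longrightarrow> F k (X i) = U i $ k" "\<And>k x. \<bar>F k x\<bar> \<le> M"
    "\<And>k x y. \<bar>F k x - F k y\<bar> \<le> 1/2 * dist x y" by metis
  define u where "u = (\<lambda>x. \<chi> k. F k x)"
  have u1: "norm (u x) \<le> 7/4 * M" for x by (rule norm_le_sqrt3_bound) (simp add: u_def F)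
  have u2: "norm (u x - u y) \<le> 7/8 * norm (x - y)" for x y
    using norm_le_sqrt3_bound[of "u x - u y" "1/2 * norm (x - y)"] F(3) by (simp add: u_def dist_norm)
  have "(7/8)-lipschitz_on UNIV u" by (rule lipschitz_onI) (use u2 in \<open>simp_all add: dist_norm\<close>)
  then have "continuous_on UNIV u" by (rule lipschitz_on_continuous_on)
  moreover have "inj (\<lambda>x. x + u x)"
  proof (rule injI)
    fix x y assume "x + u x = y + u y"
    then have "x - y = - (u x - u y)" by (simp add: algebra_simps)
    then have "norm (x - y) \<le> 7/8 * norm (x - y)" using u2[of x y] by (simp add: norm_minus_commute)
    then show "x = y" by simp
  qed
  moreover have "norm ((x + u x) - x) \<le> 2 * M" for x using u1[of x] \<open>M \<ge> 0\<close> by simp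
  moreover have "X i + u (X i) = X i + U i" if "i \<in> I" for i
    using F(1)[OF that] by (simp add: u_def vec_eq_iff)
  ultimately show ?thesis by (intro that[of "\<lambda>x. x + u x"]) (auto intro: continuous_intros)
qed

section \<open>Nearly straight pieces of a knot of finite total curvature\<close>

definition chords_in_cone :: "(real \<Rightarrow> space) \<Rightarrow> real \<Rightarrow> space \<Rightarrow> real \<Rightarrow> real \<Rightarrow> bool" where
  "chords_in_cone g c v a b \<longleftrightarrow>
     (\<forall>s\<in>{a..b}. \<forall>t\<in>{a..b}. s < t \<longrightarrow> (g t - g s) \<bullet> v \<ge> c * norm (g t - g s))"

lemma cos_ge_parabola: "cos x \<ge> 1 - x\<^sup>2 / 2" for x :: real
proof -
  have "cos x = 1 - 2 * (sin (x/2))\<^sup>2" using cos_double_sin[of "x/2"] by simp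
  moreover have "(sin (x/2))\<^sup>2 \<le> (x/2)\<^sup>2"
    using abs_sin_x_le_abs_x[of "x/2"] by (metis abs_ge_zero power2_abs power_mono)
  ultimately show ?thesis by (simp add: power2_eq_square)
qed

lemma vec_angle_arg: "\<bar>(u \<bullet> v) / (norm u * norm v)\<bar> \<le> 1"
proof (cases "norm u * norm v = 0")
  case False
  then have "norm u * norm v > 0" by (simp add: less_le)
  then show ?thesis using Cauchy_Schwarz_ineq2[of u v] by (simp add: abs_mult)
qed auto

lemma vec_angle_nonneg: "vec_angle u v \<ge> 0"
  using vec_angle_arg[of u v] unfolding vec_angle_def by (intro arccos_lbound) (simp_all only: abs_le_iff, linarith+)

lemma norm_diff_square: "(norm (x - y))\<^sup>2 = (norm x)\<^sup>2 + (norm y)\<^sup>2 - 2 * (x \<bullet> y)"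
  for x y :: "'a::real_inner"
  by (simp add: power2_norm_eq_inner inner_diff inner_commute)

lemma norm_sgn_diff: "u \<noteq> 0 \<Longrightarrow> v \<noteq> 0 \<Longrightarrow> (norm (sgn u - sgn v))\<^sup>2 = 2 - 2 * cos (vec_angle u v)"
proof -
  assume "u \<noteq> 0" "v \<noteq> 0"
  have "cos (vec_angle u v) = (u \<bullet> v) / (norm u * norm v)"
    unfolding vec_angle_def using vec_angle_arg[of u v] by (intro cos_arccos) (simp_all only: abs_le_iff, linarith+)
  also have "\<dots> = sgn u \<bullet> sgn v" by (simp add: sgn_div_norm field_simps)
  finally have "cos (vec_angle u v) = sgn u \<bullet> sgn v" .
  then show ?thesis using \<open>u \<noteq> 0\<close> \<open>v \<noteq> 0\<close> norm_diff_square[of "sgn u" "sgn v"] by (simp add: norm_sgn)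
qed

lemma norm_sgn_diff_le_vec_angle:
  assumes "u \<noteq> 0" "v \<noteq> 0"
  shows "norm (sgn u - sgn v) \<le> vec_angle u v"
proof (rule power2_le_imp_le)
  show "(norm (sgn u - sgn v))\<^sup>2 \<le> (vec_angle u v)\<^sup>2"
    using norm_sgn_diff[OF assms] cos_ge_parabola[of "vec_angle u v"] by linarith
qed (rule vec_angle_nonneg)

lemma cone_of_sgn:
  fixes u v :: space
  assumes "norm v = 1" "norm (sgn u - v) \<le> \<eta>"
  shows "u \<bullet> v \<ge> (1 - \<eta>\<^sup>2 / 2) * norm u"
proof (cases "u = 0")
  case False
  have "(norm (sgn u - v))\<^sup>2 = 2 - 2 * (sgn u \<bullet> v)"
    using False assms(1) norm_diff_square[of "sgn u" v] by (simp add: norm_sgn)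
  moreover have "(norm (sgn u - v))\<^sup>2 \<le> \<eta>\<^sup>2" using assms(2) by (intro power_mono) auto
  ultimately have "sgn u \<bullet> v \<ge> 1 - \<eta>\<^sup>2 / 2" by simp
  moreover have "u \<bullet> v = norm u * (sgn u \<bullet> v)" using False by (simp add: sgn_div_norm)
  ultimately show ?thesis using False by (simp add: mult.commute)
qed auto

lemma sgn_of_cone:
  fixes u v :: space
  assumes "norm v = 1" "u \<bullet> v \<ge> c * norm u" "u \<noteq> 0"
  shows "(norm (sgn u - v))\<^sup>2 \<le> 2 - 2 * c"
proof -
  have "(norm (sgn u - v))\<^sup>2 = 2 - 2 * (sgn u \<bullet> v)"
    using assms norm_diff_square[of "sgn u" v] by (simp add: norm_sgn)
  moreover have "sgn u \<bullet> v = (u \<bullet> v) / norm u" by (simp add: sgn_div_norm field_simps)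
  moreover have "(u \<bullet> v) / norm u \<ge> c" using assms by (simp add: field_simps)
  ultimately show ?thesis by simp
qed

text \<open>The distance of two unit vectors is at most their angle.  So the direction of \<open>T\<close> is within \<open>pi / 10\<close>
  of that of \<open>T'\<close>, which is within \<open>sqrt (2 - 2 * 0.9999)\<close> of \<open>v\<close>, and the sum of the two bounds
  is small enough.  If \<open>T\<close> or \<open>T'\<close> were zero, \<^const>\<open>vec_angle\<close> would be \<open>arccos 0\<close>, a right angle.\<close>

lemma cone_transfer:
  fixes T T' v :: space
  assumes "norm v = 1" "T' \<bullet> v \<ge> (9999/10000) * norm T'" "vec_angle T T' \<le> pi / 10"
  shows "T \<bullet> v \<ge> (94/100) * norm T"
proof -
  have nz: "T \<noteq> 0" "T' \<noteq> 0"
    using assms(3) pi_gt_zero by (auto simp: vec_angle_def)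
  have pi32: "pi \<le> 32/10" using pi_approx by (simp add: abs_le_iff)
  have "norm (sgn T - sgn T') \<le> 32/100"
    using norm_sgn_diff_le_vec_angle[OF nz] assms(3) pi32 by simp
  moreover have "norm (sgn T' - v) \<le> 145/10000"
  proof -
    have "(2::real) - 2 * (9999/10000) \<le> (145/10000)\<^sup>2" by (simp add: power2_eq_square)
    then have "(norm (sgn T' - v))\<^sup>2 \<le> (145/10000)\<^sup>2"
      using sgn_of_cone[OF assms(1,2) nz(2)] by linarith
    then show ?thesis by (rule power2_le_imp_le) simp
  qed
  ultimately have "norm (sgn T - v) \<le> 3345/10000"
    using norm_triangle_ineq[of "sgn T - sgn T'" "sgn T' - v"] by simp
  from cone_of_sgn[OF assms(1) this] have "T \<bullet> v \<ge> (1 - (3345/10000)\<^sup>2 / 2) * norm T" .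
  moreover have "(1 - (3345/10000)\<^sup>2 / 2) * norm T \<ge> (94/100) * norm T"
    by (intro mult_right_mono) (auto simp: power2_eq_square)
  ultimately show ?thesis by linarith
qed

text \<open>The total turning of an open polygon: the closing edge and its two angles are left out, which
  makes the turning superadditive under concatenation.\<close>

fun turning :: "space list \<Rightarrow> real" where
  "turning (x # y # z # zs) = vec_angle (y - x) (z - y) + turning (y # z # zs)"
| "turning _ = 0"

lemma turning_Cons: "turning ys \<le> turning (w # ys)"
proof (cases ys)
  case (Cons y zs)
  then show ?thesis using vec_angle_nonneg by (cases zs) simp_all
qed simp

lemma turning_append: "turning (xs @ ys) \<ge> turning xs + turning ys"
proof (induction xs rule: turning.induct)
  case ("2_3" v w)
  show ?case using turning_Cons[of ys w] turning_Cons[of "w # ys" v] by simp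
qed (use turning_Cons in \<open>simp_all\<close>)

lemma turning_eq_sum:
  "turning vs = (\<Sum>i<length vs - 2. vec_angle (vs ! (i+1) - vs ! i) (vs ! (i+2) - vs ! (i+1)))"
proof (induction vs rule: turning.induct)
  case (1 x y z zs)
  have "(\<Sum>i<length (x # y # z # zs) - 2. vec_angle ((x#y#z#zs) ! (i+1) - (x#y#z#zs) ! i) ((x#y#z#zs) ! (i+2) - (x#y#z#zs) ! (i+1)))
    = (\<Sum>i<Suc (length zs). vec_angle ((x#y#z#zs) ! (i+1) - (x#y#z#zs) ! i) ((x#y#z#zs) ! (i+2) - (x#y#z#zs) ! (i+1)))"
    by simp
  also have "\<dots> = vec_angle (y - x) (z - y) + (\<Sum>i<length zs. vec_angle ((y#z#zs) ! (i+1) - (y#z#zs) ! i) ((y#z#zs) ! (i+2) - (y#z#zs) ! (i+1)))"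
    by (subst sum.lessThan_Suc_shift) simp
  also have "\<dots> = turning (x # y # z # zs)" using 1 by simp
  finally show ?case by simp
qed auto

lemma turning_le_polygon_curvature: "turning vs \<le> polygon_curvature vs"
proof -
  let ?n = "length vs"
  let ?f = "\<lambda>i. vec_angle (vs ! i - vs ! ((i + ?n - 1) mod ?n)) (vs ! ((i + 1) mod ?n) - vs ! i)"
  have "turning vs = (\<Sum>i<?n - 2. ?f (Suc i))"
    unfolding turning_eq_sum
  proof (rule sum.cong)
    fix i assume "i \<in> {..<?n - 2}"
    then have i: "i + 2 < ?n" by auto
    then have "(Suc i + ?n - 1) mod ?n = i" "(Suc i + 1) mod ?n = i + 2" by simp_all
    then show "vec_angle (vs ! (i + 1) - vs ! i) (vs ! (i + 2) - vs ! (i + 1)) = ?f (Suc i)"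
      by (simp only: Suc_eq_plus1)
  qed simp
  also have "\<dots> = sum ?f (Suc ` {..<?n - 2})" by (simp add: sum.reindex)
  also have "\<dots> \<le> sum ?f {..<?n}" by (rule sum_mono2) (auto simp: vec_angle_nonneg)
  finally show ?thesis by (simp add: polygon_curvature_def Let_def)
qed

lemma turning_quadruple:
  assumes "a \<noteq> b" "b \<noteq> c" "c \<noteq> e"
  shows "turning [a, b, c, e] \<ge> norm (sgn (b - a) - sgn (e - c))"
proof -
  have "norm (sgn (b - a) - sgn (c - b)) \<le> vec_angle (b - a) (c - b)"
     "norm (sgn (c - b) - sgn (e - c)) \<le> vec_angle (c - b) (e - c)"
    using assms by (intro norm_sgn_diff_le_vec_angle; simp)+
  then show ?thesis
    using norm_triangle_ineq[of "sgn (b - a) - sgn (c - b)" "sgn (c - b) - sgn (e - c)"] by simp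
qed

definition bent :: "(real \<Rightarrow> space) \<Rightarrow> real \<Rightarrow> real \<Rightarrow> real \<Rightarrow> bool" where
  "bent g \<eta> l u \<longleftrightarrow> (\<exists>a b c e. l < a \<and> a < b \<and> b < c \<and> c < e \<and> e < u \<and>
      norm (sgn (g b - g a) - sgn (g e - g c)) > \<eta>)"

lemma knot_inj:
  assumes "knot g" "s \<in> {0..1}" "t \<in> {0..1}" "g s = g t" 
  shows "s = t \<or> s = 0 \<and> t = 1 \<or> s = 1 \<and> t = 0"
  using assms unfolding knot_def simple_path_def loop_free_def by blast

text \<open>If the interval next to \<open>t\<close> were bent however short it is, one could choose bent quadruples one
  after the other, approaching \<open>t\<close>.  The polygon through \<open>n\<close> of them turns by at least \<open>n * \<eta>\<close>,
  which is unbounded.\<close>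

lemma finite_total_curvature_not_bent:
  assumes g: "knot g" "finite_total_curvature g" and "\<eta> > 0"
  shows "0 \<le> t \<Longrightarrow> t < 1 \<Longrightarrow> \<exists>u. t < u \<and> u < 1 \<and> \<not> bent g \<eta> t u"
    and "0 < t \<Longrightarrow> t \<le> 1 \<Longrightarrow> \<exists>l. 0 < l \<and> l < t \<and> \<not> bent g \<eta> l t"
proof -
  define S where "S = {polygon_curvature (map g ts) | ts.
      sorted_wrt (<) ts \<and> set ts \<subseteq> {0..<1} \<and> 3 \<le> length ts}"
  obtain C where "\<forall>x\<in>S. x \<le> C"
    using g(2) unfolding finite_total_curvature_def S_def[symmetric] bdd_above_def ..
  then have C: "polygon_curvature (map g ts) \<le> C"
    if "sorted_wrt (<) ts" "set ts \<subseteq> {0..<1}" "3 \<le> length ts" for ts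
    using that unfolding S_def by blast
  define W where "W = (\<lambda>n l u. \<exists>ts. sorted_wrt (<) ts \<and> set ts \<subseteq> {l<..<u} \<and> 4 * n \<le> length ts
      \<and> real n * \<eta> \<le> turning (map g ts))"
  have W: "False" if Wn: "\<And>n. W n l u" and lu: "0 \<le> l" "u \<le> 1" for l u
  proof -
    obtain n where n: "real n * \<eta> > C" using \<open>\<eta> > 0\<close> reals_Archimedean3 by blast
    have "real (Suc n) * \<eta> > C" using n \<open>\<eta> > 0\<close> by (simp add: algebra_simps)
    obtain ts where ts: "sorted_wrt (<) ts" "set ts \<subseteq> {l<..<u}" "4 * Suc n \<le> length ts"
      "real (Suc n) * \<eta> \<le> turning (map g ts)" using Wn[of "Suc n"] unfolding W_def by blast
    have "set ts \<subseteq> {0..<1}" "3 \<le> length ts" using ts(2,3) lu by auto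
    from C[OF ts(1) this] have "turning (map g ts) \<le> C"
      using turning_le_polygon_curvature[of "map g ts"] by linarith
    then show False using ts(4) \<open>real (Suc n) * \<eta> > C\<close> by linarith
  qed
  have quad: "\<eta> \<le> turning (map g [a, b, c, e])"
    if "0 \<le> a" "a < b" "b < c" "c < e" "e \<le> 1" "a \<noteq> 0 \<or> e \<noteq> 1" "norm (sgn (g b - g a) - sgn (g e - g c)) > \<eta>" for a b c e
  proof -
    have "g a \<noteq> g b" "g b \<noteq> g c" "g c \<noteq> g e"
      using knot_inj[OF g(1), of a b] knot_inj[OF g(1), of b c] knot_inj[OF g(1), of c e] that by auto
    then show ?thesis using turning_quadruple[of "g a" "g b" "g c" "g e"] that(7) by simp
  qed
  show "\<exists>u. t < u \<and> u < 1 \<and> \<not> bent g \<eta> t u" if t: "0 \<le> t" "t < 1"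
  proof (rule ccontr)
    assume "\<not> ?thesis"
    then have bad: "bent g \<eta> t u" if "t < u" "u < 1" for u using that by blast
    have "W n t u" if "t < u" "u < 1" for n u using that
    proof (induction n arbitrary: u)
      case 0 show ?case unfolding W_def by (rule exI[of _ "[]"]) simp
    next
      case (Suc n)
      obtain a b c e where q: "t < a" "a < b" "b < c" "c < e" "e < u"
        "norm (sgn (g b - g a) - sgn (g e - g c)) > \<eta>"
        using bad[OF Suc.prems] unfolding bent_def by blast
      obtain ts where ts: "sorted_wrt (<) ts" "set ts \<subseteq> {t<..<a}" "4 * n \<le> length ts"
        "real n * \<eta> \<le> turning (map g ts)" using Suc.IH[of a] q Suc.prems unfolding W_def by force
      have "\<eta> \<le> turning (map g [a, b, c, e])" using q t Suc.prems by (intro quad) auto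
      then have "real (Suc n) * \<eta> \<le> turning (map g (ts @ [a, b, c, e]))"
        using ts(4) turning_append[of "map g ts" "map g [a, b, c, e]"] by (simp add: algebra_simps)
      moreover have "sorted_wrt (<) (ts @ [a, b, c, e])" using ts q by (auto simp: sorted_wrt_append)
      moreover have "set (ts @ [a, b, c, e]) \<subseteq> {t<..<u}" using ts q by auto
      ultimately show ?case unfolding W_def using ts(3) by (intro exI[of _ "ts @ [a, b, c, e]"]) auto
    qed
    then show False using W[of t "(t + 1)/2"] t by auto
  qed
  show "\<exists>l. 0 < l \<and> l < t \<and> \<not> bent g \<eta> l t" if t: "0 < t" "t \<le> 1"
  proof (rule ccontr)
    assume "\<not> ?thesis"
    then have bad: "bent g \<eta> l t" if "0 < l" "l < t" for l using that by blast
    have "W n l t" if "0 < l" "l < t" for n l using that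
    proof (induction n arbitrary: l)
      case 0 show ?case unfolding W_def by (rule exI[of _ "[]"]) simp
    next
      case (Suc n)
      obtain a b c e where q: "l < a" "a < b" "b < c" "c < e" "e < t"
        "norm (sgn (g b - g a) - sgn (g e - g c)) > \<eta>"
        using bad[OF Suc.prems] unfolding bent_def by blast
      obtain ts where ts: "sorted_wrt (<) ts" "set ts \<subseteq> {e<..<t}" "4 * n \<le> length ts"
        "real n * \<eta> \<le> turning (map g ts)" using Suc.IH[of e] q Suc.prems unfolding W_def by force
      have "\<eta> \<le> turning (map g [a, b, c, e])" using q t Suc.prems by (intro quad) auto
      then have "real (Suc n) * \<eta> \<le> turning (map g ([a, b, c, e] @ ts))"
        using ts(4) turning_append[of "map g [a, b, c, e]" "map g ts"] by (simp add: algebra_simps)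
      moreover have "sorted_wrt (<) ([a, b, c, e] @ ts)" using ts q by force
      moreover have "set ([a, b, c, e] @ ts) \<subseteq> {l<..<t}" using ts q by auto
      ultimately show ?case unfolding W_def using ts(3) by (intro exI[of _ "[a, b, c, e] @ ts"]) auto
    qed
    then show False using W[of "t/2" t] t by auto
  qed
qed

lemma chords_in_cone_subset: "chords_in_cone g c v a b \<Longrightarrow> a \<le> a' \<Longrightarrow> b' \<le> b \<Longrightarrow> chords_in_cone g c v a' b'"
  unfolding chords_in_cone_def by auto

lemma chords_in_cone_closure:
  assumes cont: "continuous_on {a..b} g"
    and cone: "\<And>s t. a < s \<Longrightarrow> s < t \<Longrightarrow> t < b \<Longrightarrow> (g t - g s) \<bullet> v \<ge> c * norm (g t - g s)"
  shows "chords_in_cone g c v a b"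
  unfolding chords_in_cone_def
proof (intro ballI impI)
  fix s t assume st: "s \<in> {a..b}" "t \<in> {a..b}" "s < t"
  define m where "m = (s + t) / 2"
  define x where "x = (\<lambda>n. s + (m - s) / real (n + 2))"
  define y where "y = (\<lambda>n. t - (t - m) / real (n + 2))"
  have m: "s < m" "m < t" using st by (auto simp: m_def)
  have f: "0 < z / real (n + 2)" "z / real (n + 2) < z" if "z > 0" for z :: real and n
    using that by (auto simp: field_simps add_pos_nonneg)
  have xy: "s < x n" "x n < m" "m < y n" "y n < t" for n
    using f[of "m - s" n] f[of "t - m" n] m by (auto simp: x_def y_def)
  have z: "(\<lambda>n. z / real (n + 2)) \<longlonglongrightarrow> 0" for z :: real
    by (rule LIMSEQ_ignore_initial_segment[of "\<lambda>n. z / real n" 0 2]) (rule lim_const_over_n)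
  have x: "x \<longlonglongrightarrow> s" unfolding x_def using tendsto_add[OF tendsto_const z, of s] by simp
  have y: "y \<longlonglongrightarrow> t" unfolding y_def using tendsto_diff[OF tendsto_const z, of t] by simp
  have gx: "(\<lambda>n. g (x n)) \<longlonglongrightarrow> g s"
  proof (rule continuous_on_tendsto_compose[OF cont x st(1)])
    show "\<forall>\<^sub>F n in sequentially. x n \<in> {a..b}"
    proof (intro always_eventually allI)
      fix n show "x n \<in> {a..b}" using xy[of n] st by auto
    qed
  qed
  have gy: "(\<lambda>n. g (y n)) \<longlonglongrightarrow> g t"
  proof (rule continuous_on_tendsto_compose[OF cont y st(2)])
    show "\<forall>\<^sub>F n in sequentially. y n \<in> {a..b}"
    proof (intro always_eventually allI)
      fix n show "y n \<in> {a..b}" using xy[of n] st by auto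
    qed
  qed
  have "(\<lambda>n. (g (y n) - g (x n)) \<bullet> v) \<longlonglongrightarrow> (g t - g s) \<bullet> v"
     "(\<lambda>n. c * norm (g (y n) - g (x n))) \<longlonglongrightarrow> c * norm (g t - g s)"
    by (intro tendsto_intros gx gy)+
  moreover have "c * norm (g (y n) - g (x n)) \<le> (g (y n) - g (x n)) \<bullet> v" for n
  proof (rule cone)
    show "a < x n" "x n < y n" "y n < b" using xy[of n] st by auto
  qed
  ultimately show "(g t - g s) \<bullet> v \<ge> c * norm (g t - g s)"
    using LIMSEQ_le by blast
qed

text \<open>Fix one chord in the part of the interval away from the given end.  Every chord on the other side
  of it has almost the same direction.\<close>

lemma not_bent_imp_chords_in_cone:
  assumes g: "knot g" and "0 \<le> l" "l < u" "u \<le> 1" "\<not> bent g (14/1000) l u" "l \<noteq> 0 \<or> u \<noteq> 1"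
  shows "\<exists>m v. l < m \<and> m < u \<and> norm v = 1 \<and> chords_in_cone g (9999/10000) v l m"
    and "\<exists>m v. l < m \<and> m < u \<and> norm v = 1 \<and> chords_in_cone g (9999/10000) v m u"
proof -
  have cont: "continuous_on {0..1} g" using g by (simp add: knot_def simple_path_def path_def)
  have ne: "g s \<noteq> g t" if "l < s" "s < t" "t < u" for s t
    using knot_inj[OF g, of s t] that assms(2-4) by fastforce
  have *: "\<exists>v. norm v = 1 \<and> chords_in_cone g (9999/10000) v a b"
    if ab: "l \<le> a" "a < b" "b \<le> u" and ce: "l < c" "c < e" "e < u" "b < c \<or> e < a" for a b c e
  proof (intro exI conjI)
    let ?v = "sgn (g e - g c)"
    show v: "norm ?v = 1" using ne[OF ce(1-3)] by (simp add: norm_sgn)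
    show "chords_in_cone g (9999/10000) ?v a b"
    proof (rule chords_in_cone_closure)
      show "continuous_on {a..b} g" using cont by (rule continuous_on_subset) (use ab assms in auto)
    next
      fix s t assume st: "a < s" "s < t" "t < b"
      have "\<not> norm (sgn (g t - g s) - ?v) > 14/1000"
      proof (cases "b < c")
        case True
        then have "l < s" "t < c" using st ab by auto
        then show ?thesis using assms(5) st ce unfolding bent_def by blast
      next
        case False
        then have "e < s" "t < u" using st ab ce by auto
        then show ?thesis using assms(5) st ce norm_minus_commute[of ?v "sgn (g t - g s)"]
          unfolding bent_def by metis
      qed
      then have "(g t - g s) \<bullet> ?v \<ge> (1 - (14/1000)\<^sup>2 / 2) * norm (g t - g s)"
        by (intro cone_of_sgn[OF v]) simp
      moreover have "(1 - (14/1000)\<^sup>2 / 2) * norm (g t - g s) \<ge> (9999/10000) * norm (g t - g s)"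
        by (intro mult_right_mono) (auto simp: power2_eq_square)
      ultimately show "(g t - g s) \<bullet> ?v \<ge> (9999/10000) * norm (g t - g s)" by linarith
    qed
  qed
  \<comment> \<open>the fixed chord is that from m2 to m3 in one case, and that from m1 to m2 in the other\<close>
  obtain m2 where m2: "l < m2" "m2 < u" using dense[OF \<open>l < u\<close>] by blast
  obtain m1 where m1: "l < m1" "m1 < m2" using dense[OF m2(1)] by blast
  obtain m3 where m3: "m2 < m3" "m3 < u" using dense[OF m2(2)] by blast
  show "\<exists>m v. l < m \<and> m < u \<and> norm v = 1 \<and> chords_in_cone g (9999/10000) v l m"
    using *[of l m1 m2 m3] m1 m2 m3 by (intro exI[of _ m1]) simp
  show "\<exists>m v. l < m \<and> m < u \<and> norm v = 1 \<and> chords_in_cone g (9999/10000) v m u"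
    using *[of m3 u m1 m2] m1 m2 m3 by (intro exI[of _ m3]) simp
qed

text \<open>Every point has a one-sided neighbourhood on either side in which the chords have almost constant
  direction; compactness of the parameter interval does the rest.\<close>

lemma nearly_straight_pieces:
  assumes g: "knot g" "finite_total_curvature g"
  obtains D where "finite D"
    "\<And>a b. 0 \<le> a \<Longrightarrow> a < b \<Longrightarrow> b \<le> 1 \<Longrightarrow> {a<..<b} \<inter> D = {} \<Longrightarrow>
        \<exists>v. norm v = 1 \<and> chords_in_cone g (9999/10000) v a b"
proof -
  define P where "P = (\<lambda>x y. \<exists>D. finite D \<and> (\<forall>a b. 0 \<le> a \<and> x \<le> a \<and> a < b \<and> b \<le> y \<and> b \<le> 1 \<and> {a<..<b} \<inter> D = {} \<longrightarrow>
     (\<exists>v. norm v = 1 \<and> chords_in_cone g (9999/10000) v a b)))"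
  have "P 0 1"
  proof (rule Bolzano)
    show "(0::real) \<le> 1" by simp
  next
    fix x y z assume "P x y" "P y z" "x \<le> y" "y \<le> z"
    then obtain D1 D2 where D1: "finite D1" "\<forall>a b. 0 \<le> a \<and> x \<le> a \<and> a < b \<and> b \<le> y \<and> b \<le> 1 \<and> {a<..<b} \<inter> D1 = {} \<longrightarrow>
        (\<exists>v. norm v = 1 \<and> chords_in_cone g (9999/10000) v a b)"
      and D2: "finite D2" "\<forall>a b. 0 \<le> a \<and> y \<le> a \<and> a < b \<and> b \<le> z \<and> b \<le> 1 \<and> {a<..<b} \<inter> D2 = {} \<longrightarrow>
        (\<exists>v. norm v = 1 \<and> chords_in_cone g (9999/10000) v a b)" unfolding P_def by blast
    show "P x z" unfolding P_def
    proof (intro exI[of _ "insert y (D1 \<union> D2)"] conjI allI impI)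
      fix a b assume ab: "0 \<le> a \<and> x \<le> a \<and> a < b \<and> b \<le> z \<and> b \<le> 1 \<and> {a<..<b} \<inter> insert y (D1 \<union> D2) = {}"
      then have e: "{a<..<b} \<inter> D1 = {}" "{a<..<b} \<inter> D2 = {}" and "y \<notin> {a<..<b}" by auto
      then consider "b \<le> y" | "y \<le> a" by fastforce
      then show "\<exists>v. norm v = 1 \<and> chords_in_cone g (9999/10000) v a b"
        by cases (use D1(2) D2(2) ab e in \<open>simp_all\<close>)
    qed (use D1 D2 in simp)
  next
    fix x :: real assume x: "0 \<le> x" "x \<le> 1"
    have L: "\<exists>d>0. \<exists>v. norm v = 1 \<and> chords_in_cone g (9999/10000) v (x - d) x" if "0 < x"
    proof -
      obtain l where "0 < l" "l < x" "\<not> bent g (14/1000) l x"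
        using finite_total_curvature_not_bent(2)[OF g, of "14/1000" x] x \<open>0 < x\<close> by auto
      then obtain m v where "l < m" "m < x" "norm v = 1" "chords_in_cone g (9999/10000) v m x"
        using not_bent_imp_chords_in_cone(2)[OF g(1), of l x] x by auto
      then show ?thesis by (intro exI[of _ "x - m"]) auto
    qed
    obtain d2 where d2: "d2 > 0" "0 < x \<Longrightarrow> \<exists>v. norm v = 1 \<and> chords_in_cone g (9999/10000) v (x - d2) x"
      using L by (cases "0 < x") (auto intro: that[of 1])
    obtain d1' where d1': "d1' > 0" "x < 1 \<Longrightarrow> \<exists>v. norm v = 1 \<and> chords_in_cone g (9999/10000) v x (x + d1')"
    proof (cases "x < 1")
      case True
      obtain u where "x < u" "u < 1" "\<not> bent g (14/1000) x u"
        using finite_total_curvature_not_bent(1)[OF g, of "14/1000" x] x True by auto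
      then obtain m v where "x < m" "m < u" "norm v = 1" "chords_in_cone g (9999/10000) v x m"
        using not_bent_imp_chords_in_cone(1)[OF g(1), of x u] x by auto
      then show ?thesis by (intro that[of "m - x"]) auto
    qed (auto intro: that[of 1])
    show "\<exists>d>0. \<forall>a b. a \<le> x \<and> x \<le> b \<and> b - a < d \<longrightarrow> P a b"
    proof (intro exI[of _ "min d1' d2"] conjI allI impI)
      fix a b assume ab: "a \<le> x \<and> x \<le> b \<and> b - a < min d1' d2"
      show "P a b" unfolding P_def
      proof (intro exI[of _ "{x}"] conjI allI impI)
        fix a' b' assume a'b': "0 \<le> a' \<and> a \<le> a' \<and> a' < b' \<and> b' \<le> b \<and> b' \<le> 1 \<and> {a'<..<b'} \<inter> {x} = {}"
        then consider "b' \<le> x" | "x \<le> a'" by fastforce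
        then show "\<exists>v. norm v = 1 \<and> chords_in_cone g (9999/10000) v a' b'"
        proof cases
          case 1
          then obtain v where "norm v = 1" "chords_in_cone g (9999/10000) v (x - d2) x" using d2(2) a'b' by force
          then show ?thesis using 1 a'b' ab by (intro exI[of _ v] conjI) (auto elim!: chords_in_cone_subset)
        next
          case 2
          then obtain v where "norm v = 1" "chords_in_cone g (9999/10000) v x (x + d1')" using d1'(2) a'b' by force
          then show ?thesis using 2 a'b' ab by (intro exI[of _ v] conjI) (auto elim!: chords_in_cone_subset)
        qed
      qed simp
    qed (use d1' d2 in simp)
  qed
  then show ?thesis using that unfolding P_def by (metis (no_types, lifting))
qed

section \<open>Arclength and tangent vectors\<close>

lemma polyline_length_snoc: "polyline_length (xs @ [a, b]) = polyline_length (xs @ [a]) + dist a b"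
  by (induction xs rule: polyline_length.induct) auto

lemma polyline_length_append: "polyline_length (xs @ [a] @ ys) = polyline_length (xs @ [a]) + polyline_length (a # ys)"
proof (induction xs rule: polyline_length.induct)
  case ("2_2" v)
  then show ?case by (cases ys) auto
qed auto

lemma polyline_length_Cons: "polyline_length xs \<le> polyline_length (x # xs)"
  by (cases xs) auto

lemma polyline_length_snoc_ge: "polyline_length xs \<le> polyline_length (xs @ [a])"
  by (induction xs rule: polyline_length.induct) auto

lemma polyline_length_insert: "polyline_length (xs @ ys) \<le> polyline_length (xs @ [a] @ ys)"
proof (induction xs rule: polyline_length.induct)
  case ("2_1")
  then show ?case using polyline_length_Cons[of ys a] by simp
next
  case ("2_2" v)
  show ?case
  proof (cases ys)
    case (Cons y zs)
    then show ?thesis using dist_triangle[of v y a] by simp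
  qed simp
qed auto

context
  fixes g :: "real \<Rightarrow> space"
  assumes rect: "rectifiable g" and simple: "simple_path g"
begin

lemma bdd_inscribed_lengths: "t \<le> 1 \<Longrightarrow> bdd_above (inscribed_lengths g t)"
proof -
  assume "t \<le> 1"
  then have "inscribed_lengths g t \<subseteq> inscribed_lengths g 1"
    unfolding inscribed_lengths_def by force
  then show ?thesis using rect unfolding rectifiable_def by (rule bdd_above_mono[rotated])
qed

lemma inscribed_nonempty: "inscribed_lengths g t \<noteq> {}"
proof -
  have "polyline_length (map g []) \<in> inscribed_lengths g t"
    unfolding inscribed_lengths_def by (intro CollectI exI[of _ "[]"]) auto
  then show ?thesis by blast
qed

lemma arclength_upper:
  assumes "sorted ts" "set ts \<subseteq> {0..t}" "t \<le> 1"
  shows "polyline_length (map g ts) \<le> arclength g t"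
  unfolding arclength_def
  by (rule cSup_upper[OF _ bdd_inscribed_lengths[OF assms(3)]])
     (use assms in \<open>auto simp: inscribed_lengths_def\<close>)

text \<open>A polygon inscribed up to \<open>s\<close> can be continued through \<open>s\<close> by the points \<open>us\<close>.\<close>

lemma arclength_superadditive:
  assumes st: "0 \<le> s" "s \<le> t" "t \<le> 1" and us: "sorted us" "set us \<subseteq> {s..t}"
  shows "arclength g s + polyline_length (map g (s # us)) \<le> arclength g t"
proof -
  have "arclength g s \<le> arclength g t - polyline_length (map g (s # us))"
    unfolding arclength_def[of g s]
  proof (rule cSup_least[OF inscribed_nonempty])
    fix x assume "x \<in> inscribed_lengths g s"
    then obtain ts where ts: "x = polyline_length (map g ts)" "sorted ts" "set ts \<subseteq> {0..s}"
      unfolding inscribed_lengths_def by blast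
    have "sorted (ts @ [s] @ us)" using ts us by (fastforce simp: sorted_append)
    moreover have "set (ts @ [s] @ us) \<subseteq> {0..t}" using ts us st by force
    ultimately have "polyline_length (map g (ts @ [s] @ us)) \<le> arclength g t"
      using st(3) by (rule arclength_upper)
    moreover have "polyline_length (map g (ts @ [s] @ us)) = polyline_length (map g ts @ [g s]) + polyline_length (map g (s # us))"
      using polyline_length_append[of "map g ts" "g s" "map g us"] by simp
    moreover have "x \<le> polyline_length (map g ts @ [g s])"
      unfolding ts(1) by (rule polyline_length_snoc_ge)
    ultimately show "x \<le> arclength g t - polyline_length (map g (s # us))" by linarith
  qed
  then show ?thesis by linarith
qed

lemma dist_le_arclength:
  assumes "0 \<le> s" "s \<le> t" "t \<le> 1"
  shows "dist (g s) (g t) \<le> arclength g t - arclength g s"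
  using arclength_superadditive[OF assms, of "[t]"] assms by simp

lemma strict_mono_arclength:
  assumes "0 \<le> s" "s < t" "t \<le> 1"
  shows "arclength g s < arclength g t"
proof (rule ccontr)
  assume "\<not> ?thesis"
  then have le: "arclength g t \<le> arclength g s" by simp
  obtain m where m: "s < m" "m < t" using dense assms(2) by blast
  have "dist (g s) (g m) \<le> arclength g m - arclength g s" "dist (g m) (g t) \<le> arclength g t - arclength g m"
    using assms m by (intro dist_le_arclength; simp)+
  then have "dist (g s) (g m) \<le> 0" using le zero_le_dist[of "g m" "g t"] by linarith
  then have "g s = g m" by simp
  moreover have "s \<in> {0..1}" "m \<in> {0..1}" "s \<noteq> m" "m \<noteq> 1" "m \<noteq> 0" using assms m by auto
  ultimately show False using simple unfolding simple_path_def loop_free_def by blast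
qed

text \<open>Take for \<open>F\<close> the vertices of an inscribed polygon whose length is within \<open>e\<close> of the total length.  If
  \<open>F\<close> has no point between \<open>s\<close> and \<open>t\<close>, inserting \<open>s\<close> and \<open>t\<close> splits the polygon into a part before
  \<open>s\<close>, a single edge, and a part after \<open>t\<close>; so at most \<open>e\<close> of the length between \<open>s\<close> and \<open>t\<close> is not
  accounted for by that edge.\<close>

lemma arclength_increment:
  assumes "e > 0"
  obtains F where "finite F"
    "\<And>s t. 0 \<le> s \<Longrightarrow> s < t \<Longrightarrow> t \<le> 1 \<Longrightarrow> {s<..<t} \<inter> F = {} \<Longrightarrow> arclength g t - arclength g s \<le> e + dist (g s) (g t)"
proof -
  have "arclength g 1 - e < Sup (inscribed_lengths g 1)" using assms by (simp add: arclength_def)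
  then obtain x where "x \<in> inscribed_lengths g 1" "arclength g 1 - e < x"
    using less_cSup_iff[OF inscribed_nonempty bdd_inscribed_lengths[OF order_refl]] by blast
  then obtain ts where ts: "sorted ts" "set ts \<subseteq> {0..1}" "arclength g 1 - e < polyline_length (map g ts)"
    unfolding inscribed_lengths_def by blast
  show ?thesis
  proof (rule that[of "set ts"])
    fix s t :: real assume st: "0 \<le> s" "s < t" "t \<le> 1" "{s<..<t} \<inter> set ts = {}"
    define U where "U = filter (\<lambda>x. x \<le> s) ts"
    define V where "V = filter (\<lambda>x. \<not> x \<le> s) ts"
    have sUV: "sorted U" "sorted V" using ts(1) by (simp_all add: U_def V_def sorted_filter[of id, simplified])
    have UV: "ts = U @ V"
      using ts(1) unfolding U_def V_def
    proof (induction ts)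
      case (Cons a ts)
      show ?case
      proof (cases "a \<le> s")
        case False
        then have "filter (\<lambda>x. x \<le> s) ts = []" "filter (\<lambda>x. \<not> x \<le> s) ts = ts"
          using Cons.prems by (force simp: filter_empty_conv filter_id_conv)+
        then show ?thesis using False by simp
      qed (use Cons in simp)
    qed simp
    have U: "set U \<subseteq> {0..s}" using ts(2) by (auto simp: U_def)
    have V: "set V \<subseteq> {t..1}"
    proof
      fix x assume "x \<in> set V"
      then have "x \<in> set ts" "x > s" by (auto simp: V_def)
      then show "x \<in> {t..1}" using st(4) ts(2) by fastforce
    qed
    have "polyline_length (map g ts) \<le> polyline_length (map g U @ [g s] @ map g V)"
      unfolding UV map_append by (rule polyline_length_insert)
    also have "\<dots> \<le> polyline_length ((map g U @ [g s]) @ [g t] @ map g V)"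
      using polyline_length_insert[of "map g U @ [g s]" "map g V" "g t"] by simp
    also have "\<dots> = polyline_length ((map g U @ [g s]) @ [g t]) + polyline_length (map g (t # V))"
      using polyline_length_append[of "map g U @ [g s]" "g t" "map g V"] by simp
    also have "polyline_length ((map g U @ [g s]) @ [g t]) = polyline_length (map g (U @ [s])) + dist (g s) (g t)"
      using polyline_length_snoc[of "map g U" "g s" "g t"] by simp
    also have "polyline_length (map g (U @ [s])) \<le> arclength g s"
    proof (rule arclength_upper)
      show "sorted (U @ [s])" using sUV U by (auto simp: sorted_append)
      show "set (U @ [s]) \<subseteq> {0..s}" using U st by auto
      show "s \<le> 1" using st by simp
    qed
    also have "polyline_length (map g (t # V)) \<le> arclength g 1 - arclength g t"
      using arclength_superadditive[of t 1 V] st sUV V by simp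
    finally show "arclength g t - arclength g s \<le> e + dist (g s) (g t)" using ts(3) by linarith
  qed simp
qed

lemma continuous_on_arclength: "continuous_on {0..1} (arclength g)"
  unfolding continuous_on_iff
proof (intro ballI allI impI)
  fix t e :: real assume t: "t \<in> {0..1}" and "e > 0"
  obtain F where F: "finite F"
    "\<And>s t. 0 \<le> s \<Longrightarrow> s < t \<Longrightarrow> t \<le> 1 \<Longrightarrow> {s<..<t} \<inter> F = {} \<Longrightarrow> arclength g t - arclength g s \<le> e/2 + dist (g s) (g t)"
    using arclength_increment[of "e/2"] \<open>e > 0\<close> by (metis half_gt_zero)
  have "continuous_on {0..1} g" using simple by (simp add: simple_path_def path_def)
  then obtain d1 where d1: "d1 > 0" "\<And>s. s \<in> {0..1} \<Longrightarrow> dist s t < d1 \<Longrightarrow> dist (g s) (g t) < e/2"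
    using t \<open>e > 0\<close> unfolding continuous_on_iff by (metis half_gt_zero)
  obtain d2 where d2: "d2 > 0" "\<forall>x\<in>F. x \<noteq> t \<longrightarrow> d2 \<le> dist t x"
    using finite_set_avoid[OF F(1), of t] by blast
  show "\<exists>d>0. \<forall>s\<in>{0..1}. dist s t < d \<longrightarrow> dist (arclength g s) (arclength g t) < e"
  proof (intro exI[of _ "min d1 d2"] conjI ballI impI)
    fix s assume s: "s \<in> {0..1}" "dist s t < min d1 d2"
    have gs: "dist (g s) (g t) < e/2" using d1 s by simp
    have out: "x \<notin> F" if "\<bar>x - t\<bar> < d2" "x \<noteq> t" for x
      using d2(2) that by (auto simp: dist_real_def abs_minus_commute)
    consider "s < t" | "s = t" | "t < s" by linarith
    then show "dist (arclength g s) (arclength g t) < e"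
    proof cases
      case 1
      have "{s<..<t} \<inter> F = {}" using out s 1 by (force simp: dist_real_def)
      then have "arclength g t - arclength g s \<le> e/2 + dist (g s) (g t)" using s t 1 by (intro F(2)) auto
      moreover have "arclength g s < arclength g t" using s t 1 by (intro strict_mono_arclength) auto
      ultimately show ?thesis using gs by (simp add: dist_real_def)
    next
      case 3
      have "{t<..<s} \<inter> F = {}" using out s 3 by (force simp: dist_real_def)
      then have "arclength g s - arclength g t \<le> e/2 + dist (g t) (g s)" using s t 3 by (intro F(2)) auto
      moreover have "arclength g t < arclength g s" using s t 3 by (intro strict_mono_arclength) auto
      ultimately show ?thesis using gs by (simp add: dist_real_def dist_commute)
    qed (use \<open>e > 0\<close> in simp)
  qed (use d1 d2 in simp)
qed

lemma inj_on_arclength: "inj_on (arclength g) {0..1}"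
  by (rule linorder_inj_onI) (use strict_mono_arclength in force)+

lemma arclength_param_arclength: "t \<in> {0..1} \<Longrightarrow> arclength_param g (arclength g t) = g t"
  by (simp add: arclength_param_def inv_into_f_f[OF inj_on_arclength])

lemma arclength_IVT:
  assumes "0 \<le> a" "a < b" "b \<le> 1" "arclength g a < \<sigma>" "\<sigma> < arclength g b"
  obtains t where "a < t" "t < b" "arclength g t = \<sigma>"
proof -
  have "continuous_on {a..b} (arclength g)"
    using continuous_on_arclength by (rule continuous_on_subset) (use assms in auto)
  then obtain t where "a \<le> t" "t \<le> b" "arclength g t = \<sigma>"
    using IVT'[of "arclength g" a \<sigma> b] assms by auto
  moreover from this have "t \<noteq> a" "t \<noteq> b" using assms by auto
  ultimately show ?thesis by (intro that[of t]) simp_all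
qed

lemma arclength_param_lipschitz:
  assumes "x \<in> {arclength g a..arclength g b}" "y \<in> {arclength g a..arclength g b}" "0 \<le> a" "a < b" "b \<le> 1"
  shows "norm (arclength_param g x - arclength_param g y) \<le> \<bar>x - y\<bar>"
proof -
  have *: "\<exists>t\<in>{0..1}. x = arclength g t" if x: "x \<in> {arclength g a..arclength g b}" for x
  proof -
    consider "x = arclength g a" | "x = arclength g b" | "arclength g a < x" "x < arclength g b"
      using x unfolding atLeastAtMost_iff by linarith
    then show ?thesis
    proof cases
      case 3
      obtain t where "a < t" "t < b" "arclength g t = x"
        by (rule arclength_IVT[OF assms(3-5) 3])
      then show ?thesis using assms by (intro bexI[of _ t]) auto
    qed (use assms in auto)
  qed
  obtain s t where st: "s \<in> {0..1}" "t \<in> {0..1}" "x = arclength g s" "y = arclength g t"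
    using * assms by metis
  have "norm (g s - g t) \<le> \<bar>arclength g s - arclength g t\<bar>"
  proof (cases "s \<le> t")
    case True
    then show ?thesis using dist_le_arclength[of s t] st by (simp add: dist_norm)
  next
    case False
    then show ?thesis using dist_le_arclength[of t s] st by (simp add: dist_norm norm_minus_commute)
  qed
  then show ?thesis using st by (simp add: arclength_param_arclength)
qed

lemma tangent_in_cone:
  assumes st: "0 \<le> s" "s < u" "u < t" "t \<le> 1" and cone: "chords_in_cone g c v s t" and "c \<ge> 0"
    and T: "(arclength_param g has_vector_derivative T) (at (arclength g u))"
  shows "T \<bullet> v \<ge> c * norm T"
proof -
  let ?K = "c + norm v"
  have *: "c * norm T - T \<bullet> v \<le> e * ?K" if "e > 0" for e
  proof -
    obtain d where d: "d > 0" "\<And>y. norm (y - arclength g u) < d \<Longrightarrow>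
        norm (arclength_param g y - arclength_param g (arclength g u) - (y - arclength g u) *\<^sub>R T)
          \<le> e * norm (y - arclength g u)"
      using T \<open>e > 0\<close> unfolding has_vector_derivative_def has_derivative_at_alt by blast
    have "arclength g u < min (arclength g t) (arclength g u + d)"
      using strict_mono_arclength[of u t] st d by simp
    then obtain \<sigma> where \<sigma>: "arclength g u < \<sigma>" "\<sigma> < arclength g t" "\<sigma> < arclength g u + d"
      using dense by (metis min_less_iff_conj)
    have u0: "0 \<le> u" using st by simp
    obtain w where w: "u < w" "w < t" "arclength g w = \<sigma>"
      by (rule arclength_IVT[OF u0 st(3,4) \<sigma>(1,2)])
    define h where "h = \<sigma> - arclength g u"
    define \<Delta> where "\<Delta> = g w - g u"
    have h: "h > 0" using \<sigma> by (simp add: h_def)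
    have "norm (\<sigma> - arclength g u) < d" using \<sigma> by simp
    from d(2)[OF this] have "norm (arclength_param g \<sigma> - arclength_param g (arclength g u) - h *\<^sub>R T) \<le> e * h"
      using h by (simp add: h_def)
    moreover have "arclength_param g \<sigma> = g w"
      using arclength_param_arclength[of w] unfolding w(3) using w st by simp
    moreover have "arclength_param g (arclength g u) = g u"
      using st by (intro arclength_param_arclength) simp
    ultimately have app: "norm (\<Delta> - h *\<^sub>R T) \<le> e * h" by (simp add: \<Delta>_def)
    have \<Delta>: "\<Delta> \<bullet> v \<ge> c * norm \<Delta>"
      using cone w st unfolding chords_in_cone_def \<Delta>_def by simp
    have 1: "norm (h *\<^sub>R T) \<le> norm \<Delta> + e * h"
      using app norm_triangle_ineq2[of "h *\<^sub>R T" "\<Delta>"] by (simp add: norm_minus_commute)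
    have "(\<Delta> - h *\<^sub>R T) \<bullet> v \<le> norm (\<Delta> - h *\<^sub>R T) * norm v" by (rule norm_cauchy_schwarz)
    also have "\<dots> \<le> e * h * norm v" using app by (rule mult_right_mono) simp
    finally have 2: "\<Delta> \<bullet> v - h * (T \<bullet> v) \<le> e * h * norm v" by (simp add: inner_diff)
    have "c * (h * norm T) \<le> c * (norm \<Delta> + e * h)"
      using 1 h \<open>c \<ge> 0\<close> by (intro mult_left_mono) auto
    then have "h * (c * norm T - T \<bullet> v) \<le> h * (e * ?K)"
      using 2 \<Delta> by (simp add: algebra_simps)
    then show ?thesis using h by simp
  qed
  have "c * norm T - T \<bullet> v \<le> 0 + e" if "e > 0" for e
  proof -
    have K: "?K + 1 > 0" using \<open>c \<ge> 0\<close> by (simp add: add_nonneg_pos)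
    have "c * norm T - T \<bullet> v \<le> e / (?K + 1) * ?K" by (rule *) (use \<open>e > 0\<close> K in simp)
    also have "\<dots> \<le> e" using K \<open>e > 0\<close> by (simp add: field_simps)
    finally show ?thesis by simp
  qed
  then have "c * norm T - T \<bullet> v \<le> 0" by (rule field_le_epsilon)
  then show ?thesis by simp
qed

end

text \<open>The increment of \<open>f\<close> is summed over a fine tagged division.  An interval tagged outside \<open>N\<close>
  contributes almost no decrease, by the sign of the derivative; the intervals tagged in \<open>N\<close> have
  small total length, because a Riemann sum of the indicator function of \<open>N\<close> approximates its
  integral 0, and there the Lipschitz condition bounds the decrease.\<close>

lemma lipschitz_ae_nonneg_derivative_imp_le:
  fixes f :: "real \<Rightarrow> real"
  assumes "a \<le> b" and lip: "\<And>x y. x \<in> {a..b} \<Longrightarrow> y \<in> {a..b} \<Longrightarrow> \<bar>f x - f y\<bar> \<le> M * \<bar>x - y\<bar>"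
    and "negligible N"
    and der: "\<And>x. x \<in> {a<..<b} - N \<Longrightarrow> \<exists>D\<ge>0. (f has_real_derivative D) (at x)"
  shows "f a \<le> f b"
proof (rule field_le_epsilon)
  fix \<epsilon> :: real assume "\<epsilon> > 0"
  define M' where "M' = \<bar>M\<bar> + 1"
  have M': "M' > 0" "M \<le> M'" by (auto simp: M'_def)
  define N' where "N' = N \<union> {a, b}"
  have "negligible N'" using \<open>negligible N\<close> by (simp add: N'_def)
  then have N0: "(indicator N' has_integral (0::real)) (cbox a b)" by (simp only: negligible_def)
  define e where "e = \<epsilon> / (2 * (b - a + 1))"
  have e: "e > 0" "e * (b - a) \<le> \<epsilon> / 2" using \<open>\<epsilon> > 0\<close> \<open>a \<le> b\<close> by (auto simp: e_def field_simps)
  have "\<epsilon> / (2 * M') > 0" using \<open>\<epsilon> > 0\<close> M' by simp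
  then obtain \<gamma> where \<gamma>: "gauge \<gamma>" "\<And>p. p tagged_division_of cbox a b \<Longrightarrow> \<gamma> fine p \<Longrightarrow>
      norm ((\<Sum>(x,k)\<in>p. measure lborel k *\<^sub>R (indicator N' x :: real)) - 0) < \<epsilon> / (2 * M')"
    using N0 unfolding has_integral by metis
  have "\<exists>d>0. x \<in> {a<..<b} - N \<longrightarrow> (\<forall>u v. u \<le> x \<and> x \<le> v \<and> x - u < d \<and> v - x < d \<longrightarrow> f v - f u \<ge> - e * (v - u))" for x
  proof (cases "x \<in> {a<..<b} - N")
    case True
    then obtain D where D: "D \<ge> 0" "(f has_real_derivative D) (at x)" using der by blast
    then obtain d where d: "d > 0" "\<And>y. norm (y - x) < d \<Longrightarrow> norm (f y - f x - D * (y - x)) \<le> e * norm (y - x)"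
      using e(1) unfolding has_field_derivative_def has_derivative_at_alt by blast
    show ?thesis
    proof (intro exI[of _ d] conjI impI allI)
      fix u v assume uv: "u \<le> x \<and> x \<le> v \<and> x - u < d \<and> v - x < d"
      have "\<bar>f u - f x - D * (u - x)\<bar> \<le> e * (x - u)" using d(2)[of u] uv by simp
      moreover have "\<bar>f v - f x - D * (v - x)\<bar> \<le> e * (v - x)" using d(2)[of v] uv by simp
      ultimately have "f v - f u \<ge> D * (v - x) - D * (u - x) - e * (v - x) - e * (x - u)" by linarith
      moreover have "D * (v - x) \<ge> 0" "D * (x - u) \<ge> 0" using D uv by simp_all
      ultimately show "f v - f u \<ge> - e * (v - u)" by (simp add: algebra_simps)
    qed (rule d(1))
  qed (auto intro: exI[of _ 1])
  then obtain d where d: "\<And>x. d x > 0" "\<And>x u v. x \<in> {a<..<b} - N \<Longrightarrow> u \<le> x \<Longrightarrow> x \<le> v \<Longrightarrow> x - u < d x \<Longrightarrow> v - x < d x \<Longrightarrow> f v - f u \<ge> - e * (v - u)"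
    by metis
  define \<gamma>' where "\<gamma>' = (\<lambda>x. \<gamma> x \<inter> ball x (d x))"
  have "gauge \<gamma>'" unfolding \<gamma>'_def using \<gamma>(1) d(1) by (intro gauge_Int gauge_ball_dependent) auto
  then obtain p where p: "p tagged_division_of {a..b}" "\<gamma>' fine p" using fine_division_exists_real by blast
  have fine: "\<gamma> fine p" "(\<lambda>x. ball x (d x)) fine p"
    using p(2) unfolding \<gamma>'_def by (auto simp: fine_Int)
  have 1: "f b - f a = (\<Sum>(x,k)\<in>p. f (Sup k) - f (Inf k))"
    using additive_tagged_division_1[OF \<open>a \<le> b\<close> p(1), of f] by simp
  have 2: "b - a = (\<Sum>(x,k)\<in>p. measure lborel k)"
    using additive_content_tagged_division[of p a b] p(1) \<open>a \<le> b\<close> by simp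
  have "(\<Sum>(x,k)\<in>p. - e * measure lborel k - M' * (measure lborel k *\<^sub>R (indicator N' x :: real))) \<le> (\<Sum>(x,k)\<in>p. f (Sup k) - f (Inf k))"
  proof (rule sum_mono, clarify)
    fix x k assume xk: "(x, k) \<in> p"
    obtain u v where k: "k = {u..v}" "x \<in> {u..v}" "{u..v} \<subseteq> {a..b}"
      using tagged_division_ofD(2,3,4)[OF p(1) xk] by (metis box_real(2))
    then have uv: "u \<le> x" "x \<le> v" "a \<le> u" "v \<le> b" by auto
    have [simp]: "Sup k = v" "Inf k = u" "measure lborel k = v - u" using k(1) uv by simp_all
    show "- e * measure lborel k - M' * (measure lborel k *\<^sub>R (indicator N' x :: real)) \<le> f (Sup k) - f (Inf k)"
    proof (cases "x \<in> N'")
      case True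
      have "\<bar>f v - f u\<bar> \<le> M * \<bar>v - u\<bar>" using uv by (intro lip) auto
      also have "\<dots> \<le> M' * (v - u)" using M' uv by (simp add: mult_right_mono)
      finally have "f v - f u \<ge> - (M' * (v - u))" by linarith
      moreover have "e * (v - u) \<ge> 0" using e uv by simp
      ultimately show ?thesis using True by simp
    next
      case False
      then have x: "x \<in> {a<..<b} - N" using uv by (auto simp: N'_def)
      have "{u..v} \<subseteq> ball x (d x)" using fine(2) xk k(1) unfolding fine_def by blast
      moreover have "u \<in> {u..v}" "v \<in> {u..v}" using uv by auto
      ultimately have "u \<in> ball x (d x)" "v \<in> ball x (d x)" by blast+
      then have "x - u < d x" "v - x < d x" by (auto simp: dist_real_def)
      then show ?thesis using d(2)[OF x uv(1,2)] False by simp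
    qed
  qed
  moreover have "(\<Sum>(x,k)\<in>p. - e * measure lborel k - M' * (measure lborel k *\<^sub>R (indicator N' x :: real)))
      = - e * (\<Sum>(x,k)\<in>p. measure lborel k) - M' * (\<Sum>(x,k)\<in>p. measure lborel k *\<^sub>R (indicator N' x :: real))"
    by (simp add: sum_subtractf sum_distrib_left case_prod_unfold)
  moreover have "M' * (\<Sum>(x,k)\<in>p. measure lborel k *\<^sub>R (indicator N' x :: real)) \<le> \<epsilon> / 2"
  proof -
    have "(\<Sum>(x,k)\<in>p. measure lborel k *\<^sub>R (indicator N' x :: real)) \<le> \<epsilon> / (2 * M')"
      using \<gamma>(2)[of p] p(1) fine(1) by simp
    then show ?thesis using M' by (simp add: field_simps)
  qed
  ultimately have "f b - f a \<ge> - e * (b - a) - \<epsilon> / 2" using 1 unfolding 2 by linarith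
  then show "f a \<le> f b + \<epsilon>" using e(2) by linarith
qed

text \<open>The cone is an intersection of half-spaces, and the component of \<open>P\<close> along a fixed
  vector is monotone if its derivative is nonnegative almost everywhere.  It suffices to use the
  half-space that touches the cone in the direction of the chord.\<close>

lemma chord_in_cone_of_ae_tangents:
  fixes P :: "real \<Rightarrow> 'a::real_inner"
  assumes "a \<le> b" and lip: "\<And>x y. x \<in> {a..b} \<Longrightarrow> y \<in> {a..b} \<Longrightarrow> norm (P x - P y) \<le> \<bar>x - y\<bar>"
    and "negligible N" and "c \<ge> 0"
    and der: "\<And>x. x \<in> {a<..<b} - N \<Longrightarrow> \<exists>T. (P has_vector_derivative T) (at x) \<and> T \<bullet> v \<ge> c * norm T"
  shows "(P b - P a) \<bullet> v \<ge> c * norm (P b - P a)"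
proof -
  define z where "z = P b - P a"
  define n where "n = v - c *\<^sub>R sgn z"
  have "P a \<bullet> n \<le> P b \<bullet> n"
  proof (rule lipschitz_ae_nonneg_derivative_imp_le[OF \<open>a \<le> b\<close> _ \<open>negligible N\<close>])
    fix x y assume xy: "x \<in> {a..b}" "y \<in> {a..b}"
    have "\<bar>P x \<bullet> n - P y \<bullet> n\<bar> \<le> norm (P x - P y) * norm n"
      unfolding inner_diff_left[symmetric] by (rule Cauchy_Schwarz_ineq2)
    also have "\<dots> \<le> \<bar>x - y\<bar> * norm n" using lip[OF xy] by (rule mult_right_mono) simp
    finally show "\<bar>P x \<bullet> n - P y \<bullet> n\<bar> \<le> norm n * \<bar>x - y\<bar>" by (simp add: mult.commute)
  next
    fix x assume "x \<in> {a<..<b} - N"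
    then obtain T where T: "(P has_vector_derivative T) (at x)" "T \<bullet> v \<ge> c * norm T" using der by blast
    have "((\<lambda>x. P x \<bullet> n) has_real_derivative T \<bullet> n) (at x)"
      using T(1) unfolding has_vector_derivative_def has_field_derivative_def
      by (auto intro!: derivative_eq_intros simp: fun_eq_iff)
    moreover have "T \<bullet> n \<ge> 0"
    proof -
      have "T \<bullet> sgn z \<le> norm T * norm (sgn z)" by (rule norm_cauchy_schwarz)
      also have "\<dots> \<le> norm T" by (simp add: norm_sgn)
      finally have "c * (T \<bullet> sgn z) \<le> c * norm T" using \<open>c \<ge> 0\<close> by (rule mult_left_mono)
      then show ?thesis using T(2) by (simp add: n_def inner_diff)
    qed
    ultimately show "\<exists>D\<ge>0. ((\<lambda>x. P x \<bullet> n) has_real_derivative D) (at x)" by blast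
  qed
  then have "z \<bullet> n \<ge> 0" by (simp add: z_def inner_diff)
  moreover have "z \<bullet> sgn z = norm z"
    by (cases "z = 0") (simp_all add: sgn_div_norm power2_norm_eq_inner[symmetric] power2_eq_square)
  ultimately show ?thesis by (simp add: z_def[symmetric] n_def inner_diff)
qed

text \<open>Almost every tangent of the arc of \<open>G\<close> is within the given angle of a tangent of \<open>K\<close>, which lies in
  the closed cone that contains all chords of that part of \<open>K\<close>.  So the tangent of \<open>G\<close> lies in a wider cone,
  and the chord of \<open>G\<close>, being the integral of the tangents by arclength, does so too.\<close>

lemma chord_of_corresponding_arcs:
  assumes G: "knot G" "rectifiable G" and K: "knot K" "rectifiable K"
    and N: "arclength_null G N" "\<And>x. x \<in> path_image G - N \<Longrightarrow>
      \<exists>T T'. has_tangent G x T \<and> has_tangent K (h x) T' \<and> vec_angle T T' \<le> pi / 10"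
    and st: "0 \<le> s" "t \<le> 1" and cone: "norm v = 1" "chords_in_cone K (9999/10000) v s t"
    and \<alpha>\<beta>: "0 \<le> \<alpha>" "\<alpha> < \<beta>" "\<beta> \<le> 1"
    and corr: "\<And>\<tau>. \<alpha> < \<tau> \<Longrightarrow> \<tau> < \<beta> \<Longrightarrow> \<exists>u. s < u \<and> u < t \<and> h (G \<tau>) = K u"
  shows "(G \<beta> - G \<alpha>) \<bullet> v \<ge> 94/100 * norm (G \<beta> - G \<alpha>)"
proof -
  have sG: "simple_path G" and sK: "simple_path K" using G K by (simp_all add: knot_def)
  let ?L = "arclength G" and ?P = "arclength_param G"
  have ends: "?P (?L \<alpha>) = G \<alpha>" "?P (?L \<beta>) = G \<beta>"
    using arclength_param_arclength[OF G(2) sG] \<alpha>\<beta> by simp_all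
  have "(?P (?L \<beta>) - ?P (?L \<alpha>)) \<bullet> v \<ge> 94/100 * norm (?P (?L \<beta>) - ?P (?L \<alpha>))"
  proof (rule chord_in_cone_of_ae_tangents)
    show "?L \<alpha> \<le> ?L \<beta>" using strict_mono_arclength[OF G(2) sG \<alpha>\<beta>] by simp
    show "norm (?P x - ?P y) \<le> \<bar>x - y\<bar>" if "x \<in> {?L \<alpha>..?L \<beta>}" "y \<in> {?L \<alpha>..?L \<beta>}" for x y
      using arclength_param_lipschitz[OF G(2) sG that \<alpha>\<beta>] .
    show "negligible (?L ` {t \<in> {0..1}. G t \<in> N})" using N(1) by (simp add: arclength_null_def)
    fix \<sigma> assume \<sigma>: "\<sigma> \<in> {?L \<alpha><..<?L \<beta>} - ?L ` {t \<in> {0..1}. G t \<in> N}"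
    then have "?L \<alpha> < \<sigma>" "\<sigma> < ?L \<beta>" by auto
    then obtain \<tau> where \<tau>: "\<alpha> < \<tau>" "\<tau> < \<beta>" "?L \<tau> = \<sigma>"
      by (rule arclength_IVT[OF G(2) sG \<alpha>\<beta>])
    have \<tau>01: "\<tau> \<in> {0..1}" "0 < \<tau>" "\<tau> < 1" using \<tau> \<alpha>\<beta> by auto
    have "G \<tau> \<notin> N" using \<sigma> \<tau>(3) \<tau>01(1) by blast
    moreover have "G \<tau> \<in> path_image G" using \<tau>01(1) by (simp add: path_image_def)
    ultimately obtain T T' where T: "has_tangent G (G \<tau>) T" "has_tangent K (h (G \<tau>)) T'" "vec_angle T T' \<le> pi / 10"
      using N(2)[of "G \<tau>"] by blast
    obtain \<tau>' where \<tau>': "\<tau>' \<in> {0<..<1}" "G \<tau>' = G \<tau>" "(?P has_vector_derivative T) (at (?L \<tau>'))"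
      using T(1) unfolding has_tangent_def by blast
    have "\<tau>' = \<tau>" using knot_inj[OF G(1), of \<tau>' \<tau>] \<tau>' \<tau>01 by auto
    then have PT: "(?P has_vector_derivative T) (at \<sigma>)" using \<tau>'(3) \<tau>(3) by simp
    obtain u where u: "s < u" "u < t" "h (G \<tau>) = K u" using corr[OF \<tau>(1,2)] by blast
    obtain u' where u': "u' \<in> {0<..<1}" "K u' = K u" "(arclength_param K has_vector_derivative T') (at (arclength K u'))"
      using T(2) u(3) unfolding has_tangent_def by auto
    have "u' = u" using knot_inj[OF K(1), of u' u] u' u st by auto
    then have "T' \<bullet> v \<ge> 9999/10000 * norm T'"
      using tangent_in_cone[OF K(2) sK st(1) u(1,2) st(2) cone(2) _] u'(3) by simp
    then have "T \<bullet> v \<ge> 94/100 * norm T" using cone_transfer[OF cone(1) _ T(3)] by simp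
    then show "\<exists>T. (?P has_vector_derivative T) (at \<sigma>) \<and> T \<bullet> v \<ge> 94/100 * norm T" using PT by blast
  qed simp
  then show ?thesis by (simp only: ends)
qed

lemma cone_add:
  fixes x y v :: "'a::real_inner"
  assumes "c \<ge> 0" "x \<bullet> v \<ge> c * norm x" "y \<bullet> v \<ge> c * norm y"
  shows "(x + y) \<bullet> v \<ge> c * norm (x + y)"
proof -
  have "c * norm (x + y) \<le> c * (norm x + norm y)" using assms(1) norm_triangle_ineq by (intro mult_left_mono)
  then show ?thesis using assms(2,3) by (simp add: inner_add algebra_simps)
qed

lemma chords_of_corresponding_arcs:
  assumes G: "knot G" "rectifiable G" and K: "knot K" "rectifiable K"
    and hk: "homeomorphism (path_image G) (path_image K) h k" and ori: "orientation_preserving G K h"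
    and N: "arclength_null G N" "\<And>x. x \<in> path_image G - N \<Longrightarrow>
      \<exists>T T'. has_tangent G x T \<and> has_tangent K (h x) T' \<and> vec_angle T T' \<le> pi / 10"
    and ab: "0 \<le> a" "b \<le> 1" and cone: "norm v = 1" "chords_in_cone K (9999/10000) v a b"
  shows "chords_in_cone (k \<circ> K) (94/100) v a b"
proof -
  obtain a0 \<phi> where a0: "0 \<le> a0" "a0 \<le> 1" and \<phi>: "strict_mono_on {0..1} \<phi>" "\<phi> ` {0..1} = {0..1}"
    and h: "\<And>t. t \<in> {0..1} \<Longrightarrow> h (G t) = shiftpath a0 K (\<phi> t)"
    using ori unfolding orientation_preserving_def by auto
  have K01: "K 1 = K 0" using K(1) by (simp add: knot_def pathfinish_def pathstart_def)
  have kh: "k (h (G t)) = G t" if "t \<in> {0..1}" for t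
    using hk that by (auto simp: homeomorphism_def path_image_def)
  \<comment> \<open>an arc of K whose interior avoids the point K a0, which corresponds to the base point of G,
    corresponds to a parameter interval of G; any other arc is cut at K a0\<close>
  have *: "(k (K t) - k (K s)) \<bullet> v \<ge> 94/100 * norm (k (K t) - k (K s))"
    if st: "a \<le> s" "s < t" "t \<le> b" "a0 \<le> s \<or> t \<le> a0" for s t
  proof -
    define c where "c = (if a0 \<le> s then - a0 else 1 - a0)"
    have c: "0 \<le> s + c" "t + c \<le> 1" "s + c < t + c" using st ab a0 by (auto simp: c_def)
    obtain \<alpha> \<beta> where \<alpha>: "\<alpha> \<in> {0..1}" "\<phi> \<alpha> = s + c" and \<beta>: "\<beta> \<in> {0..1}" "\<phi> \<beta> = t + c"
    proof -
      have "s + c \<in> \<phi> ` {0..1}" "t + c \<in> \<phi> ` {0..1}" using c \<phi>(2) by auto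
      then show ?thesis using that by (metis imageE)
    qed
    have \<alpha>\<beta>: "\<alpha> < \<beta>"
    proof (rule ccontr)
      assume "\<not> \<alpha> < \<beta>"
      then have "\<beta> = \<alpha> \<or> \<beta> < \<alpha>" by auto
      then have "\<phi> \<beta> \<le> \<phi> \<alpha>" using strict_mono_onD[OF \<phi>(1) \<beta>(1) \<alpha>(1)] by auto
      then show False using \<alpha> \<beta> c by simp
    qed
    have sh: "shiftpath a0 K (u + c) = K u" if "s \<le> u" "u \<le> t" for u
    proof (cases "a0 \<le> s")
      case True
      then show ?thesis using that st ab by (simp add: shiftpath_def c_def)
    next
      case False
      then show ?thesis using that st ab K01
        by (cases "u = 0") (auto simp: shiftpath_def c_def)
    qed
    have ends: "k (K s) = G \<alpha>" "k (K t) = G \<beta>"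
      using kh[OF \<alpha>(1)] kh[OF \<beta>(1)] h[OF \<alpha>(1)] h[OF \<beta>(1)] \<alpha>(2) \<beta>(2) sh[of s] sh[of t] st by simp_all
    have "(G \<beta> - G \<alpha>) \<bullet> v \<ge> 94/100 * norm (G \<beta> - G \<alpha>)"
    proof (rule chord_of_corresponding_arcs[OF G K N _ _ cone(1)])
      show "chords_in_cone K (9999/10000) v s t" using cone(2) st by (auto elim: chords_in_cone_subset)
      show "0 \<le> s" "t \<le> 1" "0 \<le> \<alpha>" "\<alpha> < \<beta>" "\<beta> \<le> 1" using st ab \<alpha> \<beta> \<alpha>\<beta> by auto
      fix \<tau> assume \<tau>: "\<alpha> < \<tau>" "\<tau> < \<beta>"
      then have \<tau>01: "\<tau> \<in> {0..1}" using \<alpha> \<beta> by auto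
      have lt: "s + c < \<phi> \<tau>" "\<phi> \<tau> < t + c"
        using strict_mono_onD[OF \<phi>(1) \<alpha>(1) \<tau>01 \<tau>(1)] strict_mono_onD[OF \<phi>(1) \<tau>01 \<beta>(1) \<tau>(2)] \<alpha> \<beta> by auto
      show "\<exists>u. s < u \<and> u < t \<and> h (G \<tau>) = K u"
        using lt h[OF \<tau>01] sh[of "\<phi> \<tau> - c"] by (intro exI[of _ "\<phi> \<tau> - c"]) auto
    qed auto
    then show ?thesis by (simp only: ends)
  qed
  show ?thesis
    unfolding chords_in_cone_def o_def
  proof (intro ballI impI)
    fix s t assume st: "s \<in> {a..b}" "t \<in> {a..b}" "s < t"
    show "(k (K t) - k (K s)) \<bullet> v \<ge> 94/100 * norm (k (K t) - k (K s))"
    proof (cases "s < a0 \<and> a0 < t")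
      case True
      have "(k (K a0) - k (K s)) \<bullet> v \<ge> 94/100 * norm (k (K a0) - k (K s))"
         "(k (K t) - k (K a0)) \<bullet> v \<ge> 94/100 * norm (k (K t) - k (K a0))"
        using True st by (intro *; simp)+
      from cone_add[OF _ this] show ?thesis by simp
    next
      case False
      then show ?thesis using st by (intro *) auto
    qed
  qed
qed

section \<open>Subdivided knots\<close>

lemma finite_uniform_bound:
  fixes P :: "'i \<Rightarrow> real \<Rightarrow> bool"
  assumes "finite A" "\<And>a. a \<in> A \<Longrightarrow> \<exists>d>0. P a d"
    and mono: "\<And>a d d'. P a d \<Longrightarrow> 0 < d' \<Longrightarrow> d' \<le> d \<Longrightarrow> P a d'"
  shows "\<exists>d>0. \<forall>a\<in>A. P a d"
  using assms(1,2)
proof (induction A rule: finite_induct)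
  case empty
  show ?case by (rule exI[of _ 1]) simp
next
  case (insert a A)
  then obtain d1 where d1: "d1 > 0" "\<forall>a\<in>A. P a d1" by auto
  obtain d2 where d2: "d2 > 0" "P a d2" using insert.prems[of a] by auto
  show ?case
  proof (intro exI[of _ "min d1 d2"] conjI ballI)
    fix b assume b: "b \<in> insert a A"
    show "P b (min d1 d2)"
    proof (cases "b = a")
      case True
      then show ?thesis using mono[of a d2 "min d1 d2"] d1 d2 by simp
    next
      case False
      then have "P b d1" using b d1 by auto
      then show ?thesis using mono[of b d1 "min d1 d2"] d1 d2 by simp
    qed
  qed (use d1 d2 in simp)
qed

text \<open>The number \<open>c\<close> bounds the cosine of the angle between \<open>z\<close> and the line along \<open>w\<close> from below, so \<open>d\<close> bounds
  its sine from above.\<close>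

lemma perp_component_bound:
  fixes z w :: "'a::real_inner"
  assumes w: "norm w = 1" and c: "\<bar>z \<bullet> w\<bar> \<ge> c * norm z" "c \<ge> 0" "d \<ge> 0" "c * c + d * d \<ge> 1"
  shows "norm (z - (z \<bullet> w) *\<^sub>R w) \<le> d * norm z"
proof (rule power2_le_imp_le)
  have "(norm (z - (z \<bullet> w) *\<^sub>R w))\<^sup>2 = (norm z)\<^sup>2 - (z \<bullet> w)\<^sup>2"
    unfolding power2_norm_eq_inner using w
    by (simp add: inner_diff inner_commute norm_eq_1 power2_eq_square)
  moreover have "(c * norm z)\<^sup>2 \<le> (z \<bullet> w)\<^sup>2"
    using power_mono[OF c(1), of 2] c(2) by simp
  moreover have "(norm z)\<^sup>2 * 1 \<le> (norm z)\<^sup>2 * (c * c + d * d)"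
    using c(4) by (intro mult_left_mono) auto
  ultimately show "(norm (z - (z \<bullet> w) *\<^sub>R w))\<^sup>2 \<le> (d * norm z)\<^sup>2"
    by (simp add: power2_eq_square algebra_simps)
qed (use c in simp)

lemma perp_decomposition:
  fixes z w :: "'a::real_inner"
  assumes "norm w = 1"
  shows "(norm z)\<^sup>2 = (z \<bullet> w)\<^sup>2 + (norm (z - (z \<bullet> w) *\<^sub>R w))\<^sup>2"
  unfolding power2_norm_eq_inner using assms
  by (simp add: inner_diff inner_commute norm_eq_1 power2_eq_square)

text \<open>The angle between \<open>z\<close> and \<open>w\<close> is less than \<open>pi / 4\<close>.\<close>

definition steep :: "'a::real_inner \<Rightarrow> 'a \<Rightarrow> bool" where
  "steep w z \<longleftrightarrow> 0 < z \<bullet> w \<and> (norm z)\<^sup>2 < 2 * (z \<bullet> w)\<^sup>2"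

lemma knot_image:
  assumes "knot g" "continuous_on UNIV H" "inj H"
  shows "knot (H \<circ> g)"
proof -
  have "continuous_on (g ` {0..1}) H" using assms(2) continuous_on_subset by blast
  then have "path (H \<circ> g)"
    using assms(1) unfolding knot_def simple_path_def path_def by (intro continuous_on_compose) auto
  moreover have "loop_free (H \<circ> g)"
    using assms(1,3) unfolding knot_def simple_path_def loop_free_def by (auto simp: inj_eq)
  ultimately show ?thesis
    using assms(1) unfolding knot_def simple_path_def by (simp add: pathfinish_def pathstart_def)
qed

text \<open>A knot with a subdivision into pieces as provided by \<open>nearly_straight_pieces\<close>.  The vertex
  \<open>K (t k)\<close>, for \<open>k < n\<close>, is the beginning of piece \<open>k\<close> and the end of the piece before it in cyclic order.
  Pieces may meet in a vertex at any angle.\<close>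

locale subdivided_knot =
  fixes K :: "real \<Rightarrow> space" and n :: nat and t :: "nat \<Rightarrow> real" and v :: "nat \<Rightarrow> space"
  assumes knot: "knot K" and n: "n \<ge> 2" and t0: "t 0 = 0" and tn: "t n = 1"
    and t_less: "\<And>j. j < n \<Longrightarrow> t j < t (Suc j)"
    and v: "\<And>j. j < n \<Longrightarrow> norm (v j) = 1"
    and straight: "\<And>j. j < n \<Longrightarrow> chords_in_cone K (9999/10000) (v j) (t j) (t (Suc j))"
begin

abbreviation piece :: "nat \<Rightarrow> real set" where "piece j \<equiv> {t j..t (Suc j)}"

definition pred :: "nat \<Rightarrow> nat" where "pred k = (if k = 0 then n - 1 else k - 1)"

lemma pred: "k < n \<Longrightarrow> pred k < n" "k < n \<Longrightarrow> pred k \<noteq> k"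
  using n by (auto simp: pred_def)

lemma t_strict: "i < j \<Longrightarrow> j \<le> n \<Longrightarrow> t i < t j"
proof (induction j)
  case (Suc j)
  then show ?case using t_less[of j] by (cases "i = j") force+
qed simp

lemma t_le: "i \<le> j \<Longrightarrow> j \<le> n \<Longrightarrow> t i \<le> t j"
  using t_strict[of i j] by (cases "i = j") auto

lemma t01: "i \<le> n \<Longrightarrow> t i \<in> {0..1}"
  using t_le[of 0 i] t_le[of i n] t0 tn by auto

lemma piece01: "j < n \<Longrightarrow> s \<in> piece j \<Longrightarrow> s \<in> {0..1}"
  using t01[of j] t01[of "Suc j"] by auto

lemma piece_cover:
  assumes "s \<in> {0..1}"
  obtains j where "j < n" "s \<in> piece j"
proof -
  have "\<exists>j<m. s \<in> piece j" if "m \<le> n" "s \<le> t m" "m > 0" for m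
    using that
  proof (induction m)
    case (Suc m)
    show ?case
    proof (cases "t m \<le> s")
      case True
      then show ?thesis using Suc.prems by auto
    next
      case False
      then have "m > 0" using t0 assms by (cases m) auto
      then show ?thesis using Suc False by (metis Suc_leD less_SucI linorder_le_less_linear order_less_imp_le)
    qed
  qed simp
  from this[of n] show ?thesis using that assms tn n by auto
qed

lemma K01: "K 1 = K 0"
  using knot by (simp add: knot_def pathfinish_def pathstart_def)

lemma contK: "continuous_on {0..1} K"
  using knot by (simp add: knot_def simple_path_def path_def)

lemma vertex_index: "m \<le> n \<Longrightarrow> \<exists>k<n. K (t m) = K (t k)"
  using K01 t0 tn n by (cases "m = n") (auto intro: exI[of _ 0] exI[of _ m])

lemma meeting_point_is_vertex:
  assumes c: "knot c" and "i < n" "j < n" "i \<noteq> j" "s \<in> piece i" "s' \<in> piece j" "c s = c s'"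
  shows "\<exists>m\<le>n. s = t m"
proof -
  have *: "\<exists>m\<le>n. s = t m" if "i < j" "j < n" "s \<in> piece i" "s \<in> piece j" for i j
    using that t_le[of "Suc i" j] by (intro exI[of _ j]) auto
  have "s \<in> {0..1}" "s' \<in> {0..1}" using piece01 assms by blast+
  then have "s = s' \<or> s = 0 \<or> s = 1" using knot_inj[OF c, of s s'] assms(7) by auto
  then show ?thesis
  proof (elim disjE)
    assume "s = s'"
    then show ?thesis using *[of i j] *[of j i] assms by (cases "i < j") auto
  qed (use t0 tn in auto)
qed

text \<open>The balls of radius \<open>r\<close> about the vertices are far apart, and each of them is disjoint from all pieces
  other than the two that meet in its centre, with room to spare for a small perturbation.\<close>

definition good_radius :: "real \<Rightarrow> bool" where
  "good_radius r \<longleftrightarrow> 0 < r \<and>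
     (\<forall>i<n. \<forall>j<n. i \<noteq> j \<longrightarrow> 4 * r < norm (K (t i) - K (t j))) \<and>
     (\<forall>j<n. \<forall>k<n. j \<noteq> k \<and> j \<noteq> pred k \<longrightarrow> (\<forall>s\<in>piece j. 2 * r < norm (K s - K (t k))))"

lemma good_radius_mono: "good_radius r \<Longrightarrow> 0 < r' \<Longrightarrow> r' \<le> r \<Longrightarrow> good_radius r'"
  unfolding good_radius_def by (auto simp: Ball_def) (smt (verit, best))+

lemma closed_piece: "j < n \<Longrightarrow> compact (K ` piece j)"
proof -
  assume "j < n"
  then have "piece j \<subseteq> {0..1}" using piece01 by blast
  then show ?thesis using contK by (intro compact_continuous_image continuous_on_subset[OF contK]) auto
qed

lemma good_radius_exists: "\<exists>r. good_radius r"
proof -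
  define P where "P = (\<lambda>(j, k) d. (j \<noteq> k \<longrightarrow> 4 * d < norm (K (t j) - K (t k))) \<and>
     (j \<noteq> k \<and> j \<noteq> pred k \<longrightarrow> (\<forall>s\<in>piece j. 2 * d < norm (K s - K (t k)))))"
  have "\<exists>d>0. \<forall>p\<in>{..<n}\<times>{..<n}. P p d"
  proof (rule finite_uniform_bound)
    fix p assume "p \<in> {..<n} \<times> {..<n}"
    then obtain j k where jk: "p = (j, k)" "j < n" "k < n" by auto
    have tk1: "t i < 1" if "i < n" for i using t_strict[of i n] tn that by auto
    show "\<exists>d>0. P p d"
    proof (cases "j = k")
      case False
      have "K (t j) \<noteq> K (t k)"
      proof
        assume eq: "K (t j) = K (t k)"
        have "t j = t k" using knot_inj[OF knot _ _ eq] t01 tk1[of j] tk1[of k] jk by auto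
        then show False using False t_strict[of j k] t_strict[of k j] jk by (cases "j < k") auto
      qed
      then have ne: "norm (K (t j) - K (t k)) > 0" by simp
      show ?thesis
      proof (cases "j = pred k")
        case True
        then show ?thesis using ne jk
          by (intro exI[of _ "norm (K (t j) - K (t k)) / 5"]) (auto simp: P_def)
      next
        case jpred: False
        have "K (t k) \<notin> K ` piece j"
        proof
          assume "K (t k) \<in> K ` piece j"
          then obtain s where s: "s \<in> piece j" "K s = K (t k)" by auto
          consider "s = t k" | "s = 1" "t k = 0"
            using knot_inj[OF knot piece01[OF jk(2) s(1)] _ s(2)] t01[of k] tk1[of k] jk by auto
          then show False
          proof cases
            case 1
            consider "k < j" | "k > Suc j" | "k = Suc j" using False by linarith
            then show False
              using t_strict[of k j] t_strict[of "Suc j" k] jk s(1) \<open>s = t k\<close> jpred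
              by cases (auto simp: pred_def)
          next
            case 2
            then have "k = 0" using t_strict[of 0 k] t0 jk by (cases "k = 0") auto
            then have "Suc j < n" using jpred jk by (auto simp: pred_def)
            then show False using tk1[of "Suc j"] s(1) 2 by auto
          qed
        qed
        then obtain d where d: "d > 0" "\<forall>y\<in>K ` piece j. d \<le> dist (K (t k)) y"
          using separate_point_closed[OF compact_imp_closed[OF closed_piece[OF jk(2)]]] by blast
        have "2 * (d / 4) < norm (K s - K (t k))" if "s \<in> piece j" for s
          using d that by (force simp: dist_norm norm_minus_commute)
        moreover have "4 * (norm (K (t j) - K (t k)) / 5) < norm (K (t j) - K (t k))" using ne by simp
        moreover define e where "e = min (norm (K (t j) - K (t k)) / 5) (d / 4)"
        have "4 * e \<le> 4 * (norm (K (t j) - K (t k)) / 5)" "2 * e \<le> 2 * (d / 4)" "e > 0"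
          using ne d(1) by (simp_all add: e_def)
        ultimately show ?thesis
          unfolding P_def jk(1) prod.case by (meson le_less_trans)
      qed
    qed (auto simp: P_def jk intro: exI[of _ 1])
  next
    fix p d and d' :: real assume "P p d" "d' \<le> d"
    then have le: "4 * d' \<le> 4 * d" "2 * d' \<le> 2 * d" by auto
    show "P p d'" using \<open>P p d\<close>
      by (cases p) (auto simp: P_def intro: le_less_trans[OF le(1)] le_less_trans[OF le(2)])
  qed simp
  then obtain d where "d > 0" "\<forall>p\<in>{..<n}\<times>{..<n}. P p d" by blast
  then have "good_radius d" unfolding good_radius_def P_def by auto
  then show ?thesis by blast
qed

text \<open>Away from the vertices, a piece has a positive distance from all other pieces by compactness.\<close>

lemma piece_separation:
  assumes "r > 0"
  shows "\<exists>d>0. \<forall>i<n. \<forall>j<n. \<forall>s\<in>piece i. \<forall>s'\<in>piece j. i \<noteq> j \<longrightarrow> (\<forall>k<n. r \<le> norm (K s - K (t k))) \<longrightarrow>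
     d \<le> norm (K s - K s')"
proof -
  define P where "P = (\<lambda>(i, j) d. i \<noteq> j \<longrightarrow>
     (\<forall>s\<in>piece i. \<forall>s'\<in>piece j. (\<forall>k<n. r \<le> norm (K s - K (t k))) \<longrightarrow> d \<le> norm (K s - K s')))"
  have "\<exists>d>0. \<forall>p\<in>{..<n}\<times>{..<n}. P p d"
  proof (rule finite_uniform_bound)
    fix p assume "p \<in> {..<n} \<times> {..<n}"
    then obtain i j where ij: "p = (i, j)" "i < n" "j < n" by auto
    show "\<exists>d>0. P p d"
    proof (cases "i = j")
      case False
      define A where "A = K ` piece i \<inter> (\<Inter>k<n. {x. r \<le> norm (x - K (t k))})"
      have "compact A" unfolding A_def
        by (intro compact_Int_closed closed_piece ij closed_INT ballI closed_Collect_le continuous_intros)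
      moreover have "A \<inter> K ` piece j = {}"
      proof (rule ccontr)
        assume "A \<inter> K ` piece j \<noteq> {}"
        then obtain y where y: "y \<in> K ` piece i" "y \<in> K ` piece j" "\<forall>k<n. r \<le> norm (y - K (t k))"
          unfolding A_def by auto
        then obtain s s' where s: "s \<in> piece i" "s' \<in> piece j" "y = K s" "y = K s'" by (elim imageE)
        obtain m where "m \<le> n" "s = t m"
          using meeting_point_is_vertex[OF knot ij(2,3) False s(1,2)] s(3,4) by auto
        then obtain k where "k < n" "y = K (t k)" using vertex_index s(3) by blast
        then show False using y(3) \<open>r > 0\<close> by force
      qed
      ultimately obtain d where "d > 0" "\<forall>x\<in>A. \<forall>y\<in>K ` piece j. d \<le> dist x y"
        using separate_compact_closed[OF _ compact_imp_closed[OF closed_piece[OF ij(3)]]] by blast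
      then show ?thesis using ij
        by (intro exI[of _ d]) (auto simp: A_def P_def dist_norm)
    qed (auto simp: P_def ij intro: exI[of _ 1])
  next
    fix p d and d' :: real assume "P p d" "d' \<le> d"
    then show "P p d'" by (cases p) (auto simp: P_def intro: order_trans[OF \<open>d' \<le> d\<close>])
  qed simp
  then show ?thesis unfolding P_def by auto
qed

text \<open>What is used of a knot close to \<open>K\<close>: points with the same parameter are close, and the chords of
  corresponding pieces point roughly in the same direction.\<close>

definition follows :: "real \<Rightarrow> (real \<Rightarrow> space) \<Rightarrow> bool" where
  "follows \<delta> g \<longleftrightarrow> knot g \<and> (\<forall>s\<in>{0..1}. norm (g s - K s) \<le> \<delta>) \<and>
     (\<forall>j<n. chords_in_cone g (94/100) (v j) (t j) (t (Suc j)))"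

text \<open>Two vectors that are steep with respect to the same vector make an acute angle, so the distance from a
  vertex increases along both pieces that meet there.\<close>

definition transversal :: "(real \<Rightarrow> space) \<Rightarrow> bool" where
  "transversal c \<longleftrightarrow> knot c \<and> (\<forall>k\<le>n. c (t k) = K (t k)) \<and>
     (\<forall>j<n. \<forall>s\<in>piece j. \<forall>s'\<in>piece j. s < s' \<longrightarrow>
        steep (v j) (c s' - c s))"

definition bump :: "real \<Rightarrow> nat \<Rightarrow> space \<Rightarrow> real" where
  "bump r k x = max 0 (min 1 (2 - norm (x - K (t k)) / r))"

lemma bump: 
  assumes "r > 0"
  shows "0 \<le> bump r k x" "bump r k x \<le> 1" "norm (x - K (t k)) \<le> r \<Longrightarrow> bump r k x = 1"
    "2 * r \<le> norm (x - K (t k)) \<Longrightarrow> bump r k x = 0"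
    "\<bar>bump r k x - bump r k y\<bar> \<le> norm (x - y) / r"
proof -
  have "\<bar>bump r k x - bump r k y\<bar> \<le> \<bar>norm (x - K (t k)) / r - norm (y - K (t k)) / r\<bar>"
    unfolding bump_def by linarith
  also have "\<dots> = \<bar>norm (x - K (t k)) - norm (y - K (t k))\<bar> / r"
    using assms by (simp add: diff_divide_distrib[symmetric])
  also have "\<dots> \<le> norm (x - y) / r"
    using assms norm_triangle_ineq3[of "x - K (t k)" "y - K (t k)"] by (simp add: divide_right_mono)
  finally show "\<bar>bump r k x - bump r k y\<bar> \<le> norm (x - y) / r" .
qed (use assms in \<open>auto simp: bump_def field_simps\<close>)

text \<open>The supports of the bump functions of different vertices are disjoint.\<close>

lemma bump_sum:
  fixes z :: "nat \<Rightarrow> space"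
  assumes r: "r > 0" "good_radius r"
  shows "0 \<le> (\<Sum>k<n. bump r k x)" "(\<Sum>k<n. bump r k x) \<le> 1"
    "m < n \<Longrightarrow> norm (x - K (t m)) \<le> r \<Longrightarrow> (\<Sum>k<n. bump r k x *\<^sub>R z k) = z m"
    "m < n \<Longrightarrow> norm (x - K (t m)) \<le> r \<Longrightarrow> (\<Sum>k<n. bump r k x) = 1"
proof -
  show "0 \<le> (\<Sum>k<n. bump r k x)" using bump(1)[OF r(1)] by (intro sum_nonneg)
  have other: "bump r k x = 0" if "m < n" "k < n" "k \<noteq> m" "norm (x - K (t m)) < 2 * r" for k m
  proof -
    have "4 * r < norm (K (t k) - K (t m))" using r(2) that unfolding good_radius_def by blast
    also have "\<dots> \<le> norm (x - K (t k)) + norm (x - K (t m))"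
      using norm_triangle_ineq4[of "x - K (t m)" "x - K (t k)"] by simp
    finally show ?thesis using that(4) r(1) by (intro bump(4)) auto
  qed
  have single: "(\<Sum>k<n. bump r k x) = bump r m x" "(\<Sum>k<n. bump r k x *\<^sub>R z k) = bump r m x *\<^sub>R z m"
    if "m < n" "norm (x - K (t m)) < 2 * r" for m
  proof -
    have "(\<Sum>k\<in>{..<n}. bump r k x) = (\<Sum>k\<in>{m}. bump r k x)"
      by (rule sum.mono_neutral_right) (use that other in auto)
    then show "(\<Sum>k<n. bump r k x) = bump r m x" by simp
    have "(\<Sum>k\<in>{..<n}. bump r k x *\<^sub>R z k) = (\<Sum>k\<in>{m}. bump r k x *\<^sub>R z k)"
      by (rule sum.mono_neutral_right) (use that in \<open>auto simp: other[OF that(1) _ _ that(2)]\<close>)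
    then show "(\<Sum>k<n. bump r k x *\<^sub>R z k) = bump r m x *\<^sub>R z m" by simp
  qed
  show "(\<Sum>k<n. bump r k x) \<le> 1"
  proof (cases "\<exists>m<n. norm (x - K (t m)) < 2 * r")
    case True
    then show ?thesis using single(1) bump(2)[OF r(1)] by metis
  next
    case False
    then have "(\<Sum>k<n. bump r k x) = 0" using bump(4)[OF r(1)] by (intro sum.neutral) force
    then show ?thesis by simp
  qed
  show "(\<Sum>k<n. bump r k x *\<^sub>R z k) = z m" "(\<Sum>k<n. bump r k x) = 1"
    if "m < n" "norm (x - K (t m)) \<le> r" for m
    using single[of m] bump(3)[OF r(1) that(2)] that r(1) by simp_all
qed

lemma K_chord:
  assumes "j < n" "s \<in> piece j" "s' \<in> piece j"
  shows "\<bar>(K s - K s') \<bullet> v j\<bar> \<ge> 9999/10000 * norm (K s - K s')"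
proof -
  have *: "(K s - K s') \<bullet> v j \<ge> 9999/10000 * norm (K s - K s')" if "s' < s" "s \<in> piece j" "s' \<in> piece j" for s s'
    using straight[OF assms(1)] that unfolding chords_in_cone_def by blast
  show ?thesis
  proof (cases s s' rule: linorder_cases)
    case less
    then have "(K s' - K s) \<bullet> v j \<ge> 9999/10000 * norm (K s' - K s)" using * assms by blast
    moreover have "(K s' - K s) \<bullet> v j = - ((K s - K s') \<bullet> v j)" by (simp add: inner_diff)
    ultimately show ?thesis using norm_minus_commute[of "K s'" "K s"] by linarith
  next
    case greater
    then have "(K s - K s') \<bullet> v j \<ge> 9999/10000 * norm (K s - K s')" using * assms by blast
    then show ?thesis by linarith
  qed simp
qed

text \<open>A point of \<open>K\<close> that is not too close to the ends of its piece can be moved along the piece to change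
  its height, the coordinate in the direction of the piece, by a small given amount.\<close>

lemma height_match:
  assumes "j < n" "s \<in> piece j" "\<bar>h - K s \<bullet> v j\<bar> \<le> \<delta>" "\<delta> \<ge> 0"
    and far: "\<And>k. k < n \<Longrightarrow> 2 * \<delta> \<le> norm (K s - K (t k))"
  obtains y where "y \<in> K ` piece j" "y \<bullet> v j = h" "norm (y - K s) \<le> 2 * \<delta>"
proof -
  have pj: "t j \<in> piece j" "t (Suc j) \<in> piece j" using t_less[OF assms(1)] by auto
  have far': "2 * \<delta> \<le> norm (K s - K (t m))" if "m \<le> n" for m
    using vertex_index[OF that] far by metis
  have st: "chords_in_cone K (9999/10000) (v j) (t j) (t (Suc j))" using straight[OF assms(1)] .
  have "K (t j) \<bullet> v j \<le> h"
  proof (cases "s = t j")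
    case True
    then show ?thesis using far'[of j] assms by auto
  next
    case False
    then have "(K s - K (t j)) \<bullet> v j \<ge> 9999/10000 * norm (K s - K (t j))"
      using st pj assms(2) unfolding chords_in_cone_def by auto
    moreover have "2 * \<delta> \<le> norm (K s - K (t j))" using far'[of j] assms(1) by simp
    ultimately have "(K s - K (t j)) \<bullet> v j \<ge> \<delta>" using assms(4) by linarith
    then show ?thesis using assms(3) by (simp add: inner_diff)
  qed
  moreover have "h \<le> K (t (Suc j)) \<bullet> v j"
  proof (cases "s = t (Suc j)")
    case True
    then show ?thesis using far'[of "Suc j"] assms by auto
  next
    case False
    then have "(K (t (Suc j)) - K s) \<bullet> v j \<ge> 9999/10000 * norm (K (t (Suc j)) - K s)"
      using st pj assms(2) unfolding chords_in_cone_def by auto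
    moreover have "2 * \<delta> \<le> norm (K (t (Suc j)) - K s)"
      using far'[of "Suc j"] assms(1) by (simp add: norm_minus_commute)
    ultimately have "(K (t (Suc j)) - K s) \<bullet> v j \<ge> \<delta>" using assms(4) by linarith
    then show ?thesis using assms(3) by (simp add: inner_diff)
  qed
  moreover have "continuous_on (piece j) (\<lambda>s. K s \<bullet> v j)"
  proof -
    have "piece j \<subseteq> {0..1}" using piece01[OF assms(1)] by blast
    from continuous_on_subset[OF contK this] show ?thesis by (intro continuous_intros)
  qed
  ultimately obtain s' where s': "s' \<in> piece j" "K s' \<bullet> v j = h"
    using IVT'[of "\<lambda>s. K s \<bullet> v j" "t j" h "t (Suc j)"] t_less[OF assms(1)] by auto
  have "9999/10000 * norm (K s' - K s) \<le> \<bar>(K s' - K s) \<bullet> v j\<bar>" using K_chord[OF assms(1) s'(1) assms(2)] .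
  also have "\<dots> \<le> \<delta>" using assms(3) s'(2) by (simp add: inner_diff)
  finally have "norm (K s' - K s) \<le> 2 * \<delta>" using norm_ge_zero[of "K s' - K s"] by linarith
  then show ?thesis using that[of "K s'"] s' by blast
qed

text \<open>Over the line in direction \<open>v j\<close>, the piece of \<open>K\<close> is a graph with slope less than 143/10000, and the chord
  \<open>x - x'\<close> has a component orthogonal to the line of less than 342/1000 of its length.  Since \<open>y - x\<close> joins
  points of equal height, its variation involves the orthogonal components only.\<close>

lemma height_graph_slope:
  assumes j: "j < n" and y: "y \<in> K ` piece j" "y' \<in> K ` piece j" "y \<bullet> v j = x \<bullet> v j" "y' \<bullet> v j = x' \<bullet> v j"
    and x: "\<bar>(x - x') \<bullet> v j\<bar> \<ge> 94/100 * norm (x - x')"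
  shows "norm ((y - x) - (y' - x')) \<le> 36/100 * norm (x - x')"
proof -
  define h where "h = (x - x') \<bullet> v j"
  have hy: "(y - y') \<bullet> v j = h" using y(3,4) by (simp add: h_def inner_diff)
  have ky: "\<bar>(y - y') \<bullet> v j\<bar> \<ge> 9999/10000 * norm (y - y')" using K_chord[OF j] y(1,2) by auto
  have "\<bar>h\<bar> \<le> norm (x - x') * norm (v j)" unfolding h_def by (rule Cauchy_Schwarz_ineq2)
  then have hx: "\<bar>h\<bar> \<le> norm (x - x')" using v[OF j] by simp
  have "norm ((y - y') - h *\<^sub>R v j) \<le> 143/10000 * norm (y - y')"
    using perp_component_bound[OF v[OF j] ky, of "143/10000"] hy by simp
  moreover have "norm ((x - x') - h *\<^sub>R v j) \<le> 342/1000 * norm (x - x')"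
    using perp_component_bound[OF v[OF j] x, of "342/1000"] h_def by simp
  moreover have "norm ((y - x) - (y' - x')) \<le> norm ((y - y') - h *\<^sub>R v j) + norm ((x - x') - h *\<^sub>R v j)"
    using norm_triangle_ineq4[of "(y - y') - h *\<^sub>R v j" "(x - x') - h *\<^sub>R v j"] by (simp add: algebra_simps)
  moreover have "norm (y - y') \<le> 10000/9999 * norm (x - x')" using ky hy hx by linarith
  ultimately show ?thesis using norm_ge_zero[of "x - x'"] by linarith
qed

end

context subdivided_knot
begin

section \<open>Making a nearby knot agree with the given one away from the vertices\<close>

definition straightens :: "real \<Rightarrow> real \<Rightarrow> (real \<Rightarrow> space) \<Rightarrow> (space \<Rightarrow> space) \<Rightarrow> bool" where
  "straightens r \<eta> g H \<longleftrightarrow> continuous_on UNIV H \<and> inj H \<and> (\<forall>x. norm (H x - x) \<le> \<eta>) \<and>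
     transversal (H \<circ> g) \<and>
     (\<forall>j<n. \<forall>s\<in>piece j. (\<forall>k<n. r \<le> norm (H (g s) - K (t k))) \<longrightarrow> H (g s) \<in> K ` piece j)"

text \<open>The displacement to be extended is defined on \<open>g\<close>: outside the balls about the vertices, a point of \<open>g\<close> moves
  to the point of equal height on the corresponding piece of \<open>K\<close>; near a vertex, \<open>g\<close> is translated so as to match the vertex;
  in between, the two rules are interpolated.  Along a piece, its variation is little more than 36/100 of the distance,
  by \<open>height_graph_slope\<close>; it is zero between points near the same vertex, also if they lie
  on different pieces; and all other pairs of points on different pieces are so far apart that the
  smallness of the displacement is enough.  Thus it extends to a contraction.  Matching the two knots near a
  vertex in the same way would fail at a cusp, where nearby points of \<open>g\<close> on different strands may have to
  move in opposite directions.\<close>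

lemma transversal_approximation:
  assumes r: "good_radius r" and "\<eta> > 0"
  obtains \<delta> where "\<delta> > 0" "\<And>g. follows \<delta> g \<Longrightarrow> \<exists>H. straightens r \<eta> g H"
proof -
  have r0: "r > 0" using r by (simp add: good_radius_def)
  \<comment> \<open>bump functions for this radius vanish at distance 2 * r / 3 from the vertices,
    and points move by at most r / 3\<close>
  define \<rho> where "\<rho> = r / 3"
  have \<rho>: "\<rho> > 0" "good_radius \<rho>" using r0 r good_radius_mono[of r "r/3"] by (auto simp: \<rho>_def)
  obtain d where d: "d > 0" "\<And>i j s s'. i < n \<Longrightarrow> j < n \<Longrightarrow> i \<noteq> j \<Longrightarrow> s \<in> piece i \<Longrightarrow> s' \<in> piece j \<Longrightarrow>
     (\<And>k. k < n \<Longrightarrow> \<rho> / 2 \<le> norm (K s - K (t k))) \<Longrightarrow> d \<le> norm (K s - K s')"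
    using piece_separation[of "\<rho> / 2"] \<rho> by auto
  have n0: "real n \<ge> 2" using n by simp
  define \<delta> where "\<delta> = min (\<rho> / (300 * real n)) (min (d / 40) (\<eta> / (2 * (real n + 3))))"
  have \<delta>: "\<delta> > 0" using \<rho> n0 d \<open>\<eta> > 0\<close> by (simp add: \<delta>_def)
  have \<delta>1: "300 * (real n * \<delta>) \<le> \<rho>"
  proof -
    have "\<delta> \<le> \<rho> / (300 * real n)" by (simp add: \<delta>_def)
    then show ?thesis using n0 by (simp add: field_simps)
  qed
  have \<delta>2: "40 * \<delta> \<le> d" by (simp add: \<delta>_def)
  have \<delta>3: "2 * ((real n + 3) * \<delta>) \<le> \<eta>"
  proof -
    have "\<delta> \<le> \<eta> / (2 * (real n + 3))" by (simp add: \<delta>_def)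
    then show ?thesis using n0 by (simp add: field_simps)
  qed
  have \<delta>4: "\<delta> \<le> real n * \<delta>" using n0 \<delta> mult_right_mono[of 1 "real n" \<delta>] by simp
  show ?thesis
  proof (rule that[of \<delta>])
    show "\<delta> > 0" by (rule \<delta>)
    fix g assume "follows \<delta> g"
    then have g: "knot g" "\<And>s. s \<in> {0..1} \<Longrightarrow> norm (g s - K s) \<le> \<delta>"
       "\<And>j. j < n \<Longrightarrow> chords_in_cone g (94/100) (v j) (t j) (t (Suc j))"
      unfolding follows_def by auto
    \<comment> \<open>W is the translation near the vertices, D the displacement to the point of equal height,
      and U the interpolation between them\<close>
    define B where "B = (\<lambda>x. \<Sum>k<n. bump \<rho> k x)"
    define W where "W = (\<lambda>x. \<Sum>k<n. bump \<rho> k x *\<^sub>R (K (t k) - g (t k)))"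
    define F where "F = (\<lambda>j h. SOME y. y \<in> K ` piece j \<and> y \<bullet> v j = h)"
    define D where "D = (\<lambda>(j, s). F j (g s \<bullet> v j) - g s)"
    define Z where "Z = (\<lambda>(j, s). (1 - B (g s)) *\<^sub>R D (j, s))"
    define U where "U = (\<lambda>(j, s). W (g s) + Z (j, s))"
    define X where "X = (\<lambda>(j::nat, s). g s)"
    define I where "I = {(j, s). j < n \<and> s \<in> piece j}"
    have B01: "0 \<le> B x" "B x \<le> 1" for x
      using bump_sum(1,2)[OF \<rho>] by (auto simp: B_def)
    have Blip: "\<bar>B x - B y\<bar> \<le> real n * (norm (x - y) / \<rho>)" for x y
    proof -
      have "\<bar>B x - B y\<bar> = \<bar>\<Sum>k<n. bump \<rho> k x - bump \<rho> k y\<bar>" by (simp add: B_def sum_subtractf)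
      also have "\<dots> \<le> (\<Sum>k<n. \<bar>bump \<rho> k x - bump \<rho> k y\<bar>)" by (rule sum_abs)
      also have "\<dots> \<le> (\<Sum>k<n. norm (x - y) / \<rho>)" using bump(5)[OF \<rho>(1)] by (rule sum_mono)
      finally show ?thesis by simp
    qed
    have vert: "norm (K (t k) - g (t k)) \<le> \<delta>" if "k < n" for k
      using g(2)[OF t01[of k]] that by (simp add: norm_minus_commute)
    have Wlip: "norm (W x - W y) \<le> 1/100 * norm (x - y)" for x y
    proof -
      have "norm (W x - W y) = norm (\<Sum>k<n. (bump \<rho> k x - bump \<rho> k y) *\<^sub>R (K (t k) - g (t k)))"
        by (simp add: W_def sum_subtractf scaleR_left_diff_distrib)
      also have "\<dots> \<le> (\<Sum>k<n. norm ((bump \<rho> k x - bump \<rho> k y) *\<^sub>R (K (t k) - g (t k))))" by (rule norm_sum)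
      also have "\<dots> \<le> (\<Sum>k<n. norm (x - y) / \<rho> * \<delta>)"
        unfolding norm_scaleR using bump(5)[OF \<rho>(1)] vert \<rho>(1)
        by (intro sum_mono mult_mono) auto
      also have "\<dots> = norm (x - y) * (real n * \<delta>) / \<rho>" by simp
      also have "\<dots> \<le> norm (x - y) * (\<rho> / 100) / \<rho>"
        using \<delta>1 \<rho>(1) \<delta> n0 by (intro divide_right_mono mult_left_mono) auto
      also have "\<dots> = 1/100 * norm (x - y)" using \<rho>(1) by simp
      finally show ?thesis .
    qed
    have Wbd: "norm (W x) \<le> real n * \<delta>" for x
    proof -
      have "norm (W x) \<le> (\<Sum>k<n. norm (bump \<rho> k x *\<^sub>R (K (t k) - g (t k))))" unfolding W_def by (rule norm_sum)
      also have "\<dots> \<le> (\<Sum>k<n. 1 * \<delta>)"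
        unfolding norm_scaleR using bump(1,2)[OF \<rho>(1)] vert by (intro sum_mono mult_mono) auto
      finally show ?thesis by simp
    qed
    have far: "\<rho> / 2 \<le> norm (K s - K (t k))" if "B (g s) \<noteq> 1" "k < n" "j < n" "s \<in> piece j" for s k j
    proof -
      have "\<not> norm (g s - K (t k)) \<le> \<rho>" using bump_sum(4)[OF \<rho> that(2)] that(1) by (auto simp: B_def)
      moreover have "norm (g s - K s) \<le> \<delta>" using g(2) piece01 that by blast
      ultimately show ?thesis
        using norm_triangle_ineq[of "g s - K s" "K s - K (t k)"] \<delta>1 \<delta>4 \<rho>(1) by simp
    qed
    have F: "F j (g s \<bullet> v j) \<in> K ` piece j \<and> F j (g s \<bullet> v j) \<bullet> v j = g s \<bullet> v j \<and> norm (D (j, s)) \<le> 3 * \<delta>"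
      if js: "B (g s) \<noteq> 1" "j < n" "s \<in> piece j" for j s
    proof -
      have gs: "norm (g s - K s) \<le> \<delta>" using g(2) piece01 that by blast
      have "\<bar>(g s - K s) \<bullet> v j\<bar> \<le> norm (g s - K s) * norm (v j)" by (rule Cauchy_Schwarz_ineq2)
      then have h: "\<bar>g s \<bullet> v j - K s \<bullet> v j\<bar> \<le> \<delta>" using gs v[OF that(2)] by (simp add: inner_diff)
      have ff: "2 * \<delta> \<le> norm (K s - K (t k))" if "k < n" for k
        using far[OF \<open>B (g s) \<noteq> 1\<close> that \<open>j < n\<close> \<open>s \<in> piece j\<close>] \<delta>1 \<delta>4 \<delta> by linarith
      obtain y where y: "y \<in> K ` piece j" "y \<bullet> v j = g s \<bullet> v j" "norm (y - K s) \<le> 2 * \<delta>"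
        by (rule height_match[OF js(2,3) h _ ff]) (use \<delta> in auto)
      have F1: "F j (g s \<bullet> v j) \<in> K ` piece j \<and> F j (g s \<bullet> v j) \<bullet> v j = g s \<bullet> v j"
        unfolding F_def using y(1,2) by (rule_tac someI2[of _ y]) auto
      then obtain s1 s2 where "s1 \<in> piece j" "F j (g s \<bullet> v j) = K s1" "s2 \<in> piece j" "y = K s2"
        using y(1) by blast
      then have "F j (g s \<bullet> v j) = y"
        using K_chord[OF that(2), of s1 s2] F1 y(2) by (simp add: inner_diff)
      then have "norm (D (j, s)) \<le> 3 * \<delta>"
        using y(3) gs norm_triangle_ineq4[of "y - K s" "g s - K s"] by (simp add: D_def)
      then show ?thesis using F1 by blast
    qed
    have Zv: "Z (j, s) \<bullet> v j = 0" if "j < n" "s \<in> piece j" for j s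
      using F[OF _ that] by (cases "B (g s) = 1") (auto simp: Z_def D_def inner_diff)
    have Zbd: "norm (Z (j, s)) \<le> 3 * \<delta>" if "j < n" "s \<in> piece j" for j s
    proof (cases "B (g s) = 1")
      case False
      have "norm (Z (j, s)) = (1 - B (g s)) * norm (D (j, s))" using B01 by (simp add: Z_def)
      also have "\<dots> \<le> 1 * (3 * \<delta>)" using B01 F[OF False that] \<delta> by (intro mult_mono) auto
      finally show ?thesis by simp
    qed (use \<delta> in \<open>simp add: Z_def\<close>)
    have gchord: "\<bar>(g s - g s') \<bullet> v j\<bar> \<ge> 94/100 * norm (g s - g s')" if "j < n" "s \<in> piece j" "s' \<in> piece j" for j s s'
    proof -
      have *: "(g s - g s') \<bullet> v j \<ge> 94/100 * norm (g s - g s')" if "s' < s" "s \<in> piece j" "s' \<in> piece j" for s s'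
        using g(3)[OF \<open>j < n\<close>] that unfolding chords_in_cone_def by blast
      show ?thesis
      proof (cases s s' rule: linorder_cases)
        case less
        then have "(g s' - g s) \<bullet> v j \<ge> 94/100 * norm (g s' - g s)" using * that by blast
        moreover have "(g s' - g s) \<bullet> v j = - ((g s - g s') \<bullet> v j)" by (simp add: inner_diff)
    ultimately show ?thesis using norm_minus_commute[of "g s'" "g s"] by linarith
      next
        case greater
        then have "(g s - g s') \<bullet> v j \<ge> 94/100 * norm (g s - g s')" using * that by blast
        then show ?thesis by linarith
      qed simp
    qed
    \<comment> \<open>the bound for D, multiplied by the variation of the interpolating function\<close>
    have Bsmall: "\<bar>B x - B y\<bar> * (3 * \<delta>) \<le> 1/100 * norm (x - y)" for x y
    proof -
      have "\<bar>B x - B y\<bar> * (3 * \<delta>) \<le> real n * (norm (x - y) / \<rho>) * (3 * \<delta>)"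
        using Blip \<delta> by (intro mult_right_mono) auto
      also have "\<dots> = norm (x - y) * (3 * (real n * \<delta>)) / \<rho>" by simp
      also have "\<dots> \<le> norm (x - y) * (\<rho> / 100) / \<rho>"
        using \<delta>1 \<rho>(1) by (intro divide_right_mono mult_left_mono) auto
      also have "\<dots> = 1/100 * norm (x - y)" using \<rho>(1) by simp
      finally show ?thesis .
    qed
    have Zsame: "norm (Z (j, s) - Z (j, s')) \<le> 37/100 * norm (g s - g s')"
      if "j < n" "s \<in> piece j" "s' \<in> piece j" for j s s'
    proof -
      have half: "norm (Z (j, s)) \<le> 1/100 * norm (g s - g s')"
        if "B (g s') = 1" "s \<in> piece j" for s s'
      proof (cases "B (g s) = 1")
        case False
        have "norm (Z (j, s)) = \<bar>B (g s) - B (g s')\<bar> * norm (D (j, s))" using that(1) B01 by (simp add: Z_def)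
        also have "\<dots> \<le> \<bar>B (g s) - B (g s')\<bar> * (3 * \<delta>)"
          using F[OF False \<open>j < n\<close> that(2)] by (intro mult_left_mono) auto
        finally show ?thesis using Bsmall[of "g s" "g s'"] by linarith
      qed (simp add: Z_def)
      consider "B (g s') = 1" | "B (g s) = 1" | "B (g s) \<noteq> 1" "B (g s') \<noteq> 1" by blast
      then show ?thesis
      proof cases
        case 1
        then have "norm (Z (j, s) - Z (j, s')) = norm (Z (j, s))" by (simp add: Z_def)
        then show ?thesis using half[OF 1 that(2)] norm_ge_zero[of "g s - g s'"] by linarith
      next
        case 2
        then have "norm (Z (j, s) - Z (j, s')) = norm (Z (j, s'))" by (simp add: Z_def)
        then show ?thesis
          using half[OF 2 that(3)] norm_ge_zero[of "g s - g s'"] norm_minus_commute[of "g s" "g s'"] by linarith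
      next
        case 3
        note Fs = F[OF 3(1) that(1,2)] and Fs' = F[OF 3(2) that(1,3)]
        have "norm (D (j, s) - D (j, s')) \<le> 36/100 * norm (g s - g s')"
          unfolding D_def prod.case
          by (rule height_graph_slope[OF that(1)]) (use Fs Fs' gchord[OF that] in auto)
        then have "(1 - B (g s)) * norm (D (j, s) - D (j, s')) \<le> 1 * (36/100 * norm (g s - g s'))"
          using B01 by (intro mult_mono) auto
        moreover have "\<bar>B (g s') - B (g s)\<bar> * norm (D (j, s')) \<le> \<bar>B (g s') - B (g s)\<bar> * (3 * \<delta>)"
          using Fs' by (intro mult_left_mono) auto
        moreover have "Z (j, s) - Z (j, s') = (1 - B (g s)) *\<^sub>R (D (j, s) - D (j, s')) + (B (g s') - B (g s)) *\<^sub>R D (j, s')"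
          by (simp add: Z_def algebra_simps)
        then have "norm (Z (j, s) - Z (j, s')) \<le> norm ((1 - B (g s)) *\<^sub>R (D (j, s) - D (j, s'))) + norm ((B (g s') - B (g s)) *\<^sub>R D (j, s'))"
          using norm_triangle_ineq by metis
        moreover have "\<bar>1 - B (g s)\<bar> = 1 - B (g s)"
          using B01[of "g s"] by simp
        ultimately show ?thesis
          using Bsmall[of "g s'" "g s"] norm_minus_commute[of "g s" "g s'"]
          by (simp only: norm_scaleR)
      qed
    qed
    have Zdiff: "norm (Z (j, s) - Z (j', s')) \<le> 37/100 * norm (g s - g s')"
      if j: "j < n" "s \<in> piece j" "j' < n" "s' \<in> piece j'" "j \<noteq> j'" for j s j' s'
    proof (cases "B (g s) = 1 \<and> B (g s') = 1")
      case False
      have "d \<le> norm (K s - K s')"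
      proof (cases "B (g s) = 1")
        case True
        then have "B (g s') \<noteq> 1" using False by simp
        then have "d \<le> norm (K s' - K s)" using d(2)[OF j(3,1) _ j(4,2)] far[OF _ _ j(3,4)] j(5) by simp
        then show ?thesis by (simp add: norm_minus_commute)
      next
        case False
        then show ?thesis using d(2)[OF j(1,3,5,2,4)] far[OF _ _ j(1,2)] by simp
      qed
      moreover have "norm (g s - K s) \<le> \<delta>" "norm (g s' - K s') \<le> \<delta>" using g(2) piece01 j by blast+
      moreover have "norm (K s - K s') \<le> norm (g s - g s') + norm (g s - K s) + norm (g s' - K s')"
        using norm_triangle_ineq4[of "g s - g s'" "(g s - K s) - (g s' - K s')"]
          norm_triangle_ineq4[of "g s - K s" "g s' - K s'"] by simp
      moreover have "norm (Z (j, s) - Z (j', s')) \<le> 6 * \<delta>"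
        using norm_triangle_ineq4[of "Z (j, s)" "Z (j', s')"] Zbd[OF j(1,2)] Zbd[OF j(3,4)] by simp
      ultimately show ?thesis using \<delta>2 \<delta> by linarith
    qed (simp add: Z_def)
    have Zlip: "norm (Z (j, s) - Z (j', s')) \<le> 37/100 * norm (g s - g s')"
      if "j < n" "s \<in> piece j" "j' < n" "s' \<in> piece j'" for j s j' s'
      using Zsame[of j s s'] Zdiff[OF that] that by (cases "j = j'") auto
    have Ulip: "norm (U i - U i') \<le> 1/2 * norm (X i - X i')" if "i \<in> I" "i' \<in> I" for i i'
    proof -
      obtain j s j' s' where i: "i = (j, s)" "i' = (j', s')" "j < n" "s \<in> piece j" "j' < n" "s' \<in> piece j'"
        using \<open>i \<in> I\<close> \<open>i' \<in> I\<close> unfolding I_def by blast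
      have "U i - U i' = (W (g s) - W (g s')) + (Z (j, s) - Z (j', s'))" by (simp add: U_def i)
      then have "norm (U i - U i') \<le> norm (W (g s) - W (g s')) + norm (Z (j, s) - Z (j', s'))"
        using norm_triangle_ineq by metis
      then show ?thesis using Wlip[of "g s" "g s'"] Zlip[OF i(3-6)] norm_ge_zero[of "g s - g s'"]
        unfolding X_def i(1,2) prod.case by linarith
    qed
    have Ubd: "norm (U i) \<le> (real n + 3) * \<delta>" if "i \<in> I" for i
    proof -
      obtain j s where i: "i = (j, s)" "j < n" "s \<in> piece j" using \<open>i \<in> I\<close> unfolding I_def by blast
      show ?thesis using norm_triangle_ineq[of "W (g s)" "Z (j, s)"] Wbd[of "g s"] Zbd[OF i(2,3)]
        by (simp add: U_def i algebra_simps)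
    qed
    have "(real n + 3) * \<delta> \<ge> 0" using \<delta> by simp
    from contraction_perturbation[of I U X, OF Ulip Ubd this]
    obtain H where H: "continuous_on UNIV H" "inj H" "\<And>x. norm (H x - x) \<le> 2 * ((real n + 3) * \<delta>)"
      "\<And>i. i \<in> I \<Longrightarrow> H (X i) = X i + U i" by blast
    have Hg: "H (g s) = g s + (W (g s) + Z (j, s))" if "j < n" "s \<in> piece j" for j s
      using H(4)[of "(j, s)"] that by (simp add: I_def X_def U_def)
    have 1: "H (g (t k)) = K (t k)" if "k < n" for k
    proof -
      have "norm (g (t k) - K (t k)) \<le> \<rho>" using vert[OF that] \<delta>1 \<delta>4 \<delta> norm_minus_commute[of "g (t k)" "K (t k)"] by linarith
      then have "B (g (t k)) = 1" "W (g (t k)) = K (t k) - g (t k)"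
        using bump_sum(3,4)[OF \<rho> that] by (auto simp: B_def W_def)
      moreover have "t k \<in> piece k" using t_less[OF that] by simp
      ultimately show ?thesis using Hg[OF that] by (simp add: Z_def)
    qed
    have 2: "H (g (t k)) = K (t k)" if "k \<le> n" for k
    proof (cases "k = n")
      case True
      have "g 1 = g 0" using g(1) by (simp add: knot_def pathfinish_def pathstart_def)
      then show ?thesis using 1[of 0] True n K01 t0 tn by simp
    qed (use 1 that in simp)
    have 3: "steep (v j) (H (g s') - H (g s))"
      if j: "j < n" "s \<in> piece j" "s' \<in> piece j" "s < s'" for j s s'
    proof -
      define x where "x = g s' - g s"
      define w where "w = W (g s') - W (g s)"
      define z where "z = Z (j, s') - Z (j, s)"
      define y where "y = H (g s') - H (g s)"
      have y: "y = x + w + z" using Hg[OF j(1,2)] Hg[OF j(1,3)] by (simp add: y_def x_def w_def z_def)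
      have "g s' \<noteq> g s"
      proof
        assume "g s' = g s"
        then have "s = 0 \<and> s' = 1" using knot_inj[OF g(1), of s' s] piece01[OF j(1)] j by auto
        then have "j = 0" "Suc j = n"
          using j t_strict[of 0 j] t_strict[of "Suc j" n] t0 tn by (cases "j = 0"; cases "Suc j = n"; auto)+
        then show False using n by simp
      qed
      then have x: "norm x > 0" by (simp add: x_def)
      have xv: "x \<bullet> v j \<ge> 94/100 * norm x"
        using g(3)[OF j(1)] j unfolding chords_in_cone_def x_def by blast
      have w: "norm w \<le> 1/100 * norm x" unfolding w_def x_def by (rule Wlip)
      have z: "norm z \<le> 37/100 * norm x" "z \<bullet> v j = 0"
        unfolding z_def x_def using Zlip[OF j(1,3,1,2)] Zv[OF j(1,2)] Zv[OF j(1,3)] by (auto simp: inner_diff)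
      have "\<bar>w \<bullet> v j\<bar> \<le> norm w * norm (v j)" by (rule Cauchy_Schwarz_ineq2)
      then have wv: "\<bar>w \<bullet> v j\<bar> \<le> 1/100 * norm x" using w v[OF j(1)] by simp
      \<comment> \<open>the displacement to equal height is orthogonal to the direction of the piece,
        so the component along the piece hardly changes\<close>
      have yv: "y \<bullet> v j \<ge> 93/100 * norm x" using xv wv z(2) by (simp add: y inner_add)
      have xp: "norm (x - (x \<bullet> v j) *\<^sub>R v j) \<le> 342/1000 * norm x"
        by (rule perp_component_bound[OF v[OF j(1)], of "94/100"]) (use xv in auto)
      have wp: "norm (w - (w \<bullet> v j) *\<^sub>R v j) \<le> 2/100 * norm x"
        using norm_triangle_ineq4[of w "(w \<bullet> v j) *\<^sub>R v j"] w wv v[OF j(1)] by simp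
      have "y - (y \<bullet> v j) *\<^sub>R v j = (x - (x \<bullet> v j) *\<^sub>R v j) + (w - (w \<bullet> v j) *\<^sub>R v j) + z"
        using z(2) by (simp add: y inner_add algebra_simps)
      then have "norm (y - (y \<bullet> v j) *\<^sub>R v j) \<le> norm (x - (x \<bullet> v j) *\<^sub>R v j) + norm (w - (w \<bullet> v j) *\<^sub>R v j) + norm z"
        using norm_triangle_ineq[of "(x - (x \<bullet> v j) *\<^sub>R v j) + (w - (w \<bullet> v j) *\<^sub>R v j)" z]
          norm_triangle_ineq[of "x - (x \<bullet> v j) *\<^sub>R v j" "w - (w \<bullet> v j) *\<^sub>R v j"] by simp
      then have yp: "norm (y - (y \<bullet> v j) *\<^sub>R v j) < y \<bullet> v j" using xp wp z(1) yv x by linarith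
      have "(norm (y - (y \<bullet> v j) *\<^sub>R v j))\<^sup>2 < (y \<bullet> v j)\<^sup>2"
        using yp by (intro power_strict_mono) auto
      then have "(norm y)\<^sup>2 < 2 * (y \<bullet> v j)\<^sup>2" using perp_decomposition[OF v[OF j(1)], of y] by simp
      moreover have "0 < y \<bullet> v j" using yv x by linarith
      ultimately show ?thesis by (simp add: steep_def y_def)
    qed
    have 4: "H (g s) \<in> K ` piece j"
      if j: "j < n" "s \<in> piece j" and out: "\<And>k. k < n \<Longrightarrow> r \<le> norm (H (g s) - K (t k))" for j s
    proof -
      have "norm (H (g s) - g s) \<le> (real n + 3) * \<delta>"
        using Ubd[of "(j, s)"] H(4)[of "(j, s)"] j by (simp add: I_def X_def)
      moreover have "(real n + 3) * \<delta> \<le> 4 * (real n * \<delta>)" using \<delta>4 by (simp add: algebra_simps)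
      ultimately have "norm (H (g s) - g s) \<le> \<rho>" using \<delta>1 \<rho>(1) by linarith
      then have "2 * \<rho> \<le> norm (g s - K (t k))" if "k < n" for k
        using out[OF that] norm_triangle_ineq[of "H (g s) - g s" "g s - K (t k)"] by (simp add: \<rho>_def)
      then have b: "bump \<rho> k (g s) = 0" if "k < n" for k using bump(4)[OF \<rho>(1)] that by blast
      then have "B (g s) = 0" "W (g s) = 0" by (simp_all add: B_def W_def)
      then have "H (g s) = F j (g s \<bullet> v j)" using Hg[OF j] by (simp add: Z_def D_def)
      then show ?thesis using F[OF _ j] \<open>B (g s) = 0\<close> by simp
    qed
    have "norm (H x - x) \<le> \<eta>" for x using H(3)[of x] \<delta>3 by linarith
    moreover have "transversal (H \<circ> g)"
      unfolding transversal_def using knot_image[OF g(1) H(1,2)] 2 3 by auto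
    ultimately show "\<exists>H. straightens r \<eta> g H"
      using H(1,2) 4 unfolding straightens_def by blast
  qed
qed

end

section \<open>Straightening at the vertices\<close>

lemma radial_strand_of_path:
  fixes \<sigma> :: "real \<Rightarrow> 'a::real_inner"
  assumes "a \<le> b" and cont: "continuous_on {a..b} \<sigma>" and "\<sigma> a = 0"
    and mono: "\<And>s s'. a \<le> s \<Longrightarrow> s < s' \<Longrightarrow> s' \<le> b \<Longrightarrow> norm (\<sigma> s) < norm (\<sigma> s')"
    and r: "r \<le> norm (\<sigma> b)"
  obtains e where "radial_strand r e"
    "\<And>s. s \<in> {a..b} \<Longrightarrow> norm (\<sigma> s) \<le> r \<Longrightarrow> \<sigma> s = e (norm (\<sigma> s))"
    "\<And>\<rho>. \<rho> \<in> {0..r} \<Longrightarrow> e \<rho> \<in> \<sigma> ` {a..b}"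
proof -
  define m where "m = (\<lambda>s. norm (\<sigma> s))"
  have contm: "continuous_on {a..b} m" unfolding m_def using cont by (intro continuous_intros)
  have inj: "inj_on m {a..b}"
    by (rule linorder_inj_onI) (use mono in \<open>force simp: m_def\<close>)+
  define q where "q = inv_into {a..b} m"
  have q: "q (m s) = s" if "s \<in> {a..b}" for s using inv_into_f_f[OF inj that] by (simp add: q_def)
  have onto: "\<rho> \<in> m ` {a..b}" if "\<rho> \<in> {0..r}" for \<rho>
  proof -
    have "m a \<le> \<rho>" "\<rho> \<le> m b" using that r \<open>\<sigma> a = 0\<close> by (auto simp: m_def)
    then obtain s where "s \<in> {a..b}" "m s = \<rho>" using IVT'[of m a \<rho> b] \<open>a \<le> b\<close> contm by auto
    then show ?thesis by blast
  qed
  then have sub: "{0..r} \<subseteq> m ` {a..b}" by blast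
  have contq: "continuous_on (m ` {a..b}) q"
    using q by (intro continuous_on_inv[OF contm compact_Icc]) auto
  have qin: "q \<rho> \<in> {a..b}" "m (q \<rho>) = \<rho>" if "\<rho> \<in> {0..r}" for \<rho>
    using onto[OF that] q by auto
  show ?thesis
  proof (rule that[of "\<lambda>\<rho>. \<sigma> (q \<rho>)"])
    have "continuous_on {0..r} (\<lambda>\<rho>. \<sigma> (q \<rho>))"
      by (rule continuous_on_compose2[OF cont continuous_on_subset[OF contq sub]]) (use qin in auto)
    then show "radial_strand r (\<lambda>\<rho>. \<sigma> (q \<rho>))"
      unfolding radial_strand_def using qin by (auto simp: m_def)
    show "\<sigma> s = \<sigma> (q (norm (\<sigma> s)))" if "s \<in> {a..b}" for s using q[OF that] by (simp add: m_def)
    show "\<sigma> (q \<rho>) \<in> \<sigma> ` {a..b}" if "\<rho> \<in> {0..r}" for \<rho> using qin[OF that] by blast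
  qed
qed

lemma steep_minus: "steep (- w) (- z) \<longleftrightarrow> steep w z"
  by (simp add: steep_def)

lemma steep_sum_longer:
  fixes w :: "'a::real_inner"
  assumes w: "norm w = 1" and a: "steep w a \<or> a = 0" and b: "steep w b"
  shows "norm a < norm (a + b)"
proof (cases "a = 0")
  case True
  then show ?thesis using b by (auto simp: steep_def)
next
  case False
  define a' where "a' = a - (a \<bullet> w) *\<^sub>R w"
  define b' where "b' = b - (b \<bullet> w) *\<^sub>R w"
  have *: "norm (z - (z \<bullet> w) *\<^sub>R w) < z \<bullet> w" if "steep w z" for z
  proof (rule power_less_imp_less_base)
    show "(norm (z - (z \<bullet> w) *\<^sub>R w))\<^sup>2 < (z \<bullet> w)\<^sup>2"
      using perp_decomposition[OF w, of z] that by (simp add: steep_def)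
    show "0 \<le> z \<bullet> w" using that by (simp add: steep_def)
  qed
  have n: "norm a' < a \<bullet> w" "norm b' < b \<bullet> w" using * a b False by (auto simp: a'_def b'_def)
  have "w \<bullet> w = 1" using w by (simp add: norm_eq_1)
  then have "a \<bullet> b = (a \<bullet> w) * (b \<bullet> w) + a' \<bullet> b'"
    by (simp add: a'_def b'_def inner_diff inner_commute)
  moreover have "\<bar>a' \<bullet> b'\<bar> \<le> norm a' * norm b'" by (rule Cauchy_Schwarz_ineq2)
  moreover have "norm a' * norm b' < (a \<bullet> w) * (b \<bullet> w)"
    using n by (intro mult_strict_mono) (auto intro: le_less_trans[OF norm_ge_zero])
  ultimately have ab: "a \<bullet> b > 0" by linarith
  have "(norm a)\<^sup>2 < (norm (a + b))\<^sup>2"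
  proof -
    have "(norm (a + b))\<^sup>2 = (norm a)\<^sup>2 + 2 * (a \<bullet> b) + (norm b)\<^sup>2"
      by (simp add: power2_norm_eq_inner inner_add inner_commute)
    then show ?thesis using ab zero_le_power2[of "norm b"] by linarith
  qed
  then show ?thesis by (rule power_less_imp_less_base) simp
qed

lemma disjoint_support_composition:
  fixes V :: "nat \<Rightarrow> 'a::real_normed_vector \<Rightarrow> 'a"
  assumes V: "\<And>k. k < n \<Longrightarrow> continuous_on UNIV (V k)" "\<And>k. k < n \<Longrightarrow> inj (V k)"
      "\<And>k y. k < n \<Longrightarrow> r \<le> norm (y - x k) \<Longrightarrow> V k y = y"
      "\<And>k y. k < n \<Longrightarrow> norm (y - x k) \<le> r \<Longrightarrow> norm (V k y - x k) \<le> r"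
    and disj: "\<And>i j. i < n \<Longrightarrow> j < n \<Longrightarrow> i \<noteq> j \<Longrightarrow> 2 * r < norm (x i - x j)"
  obtains W where "continuous_on UNIV W" "inj W"
    "\<And>k y. k < n \<Longrightarrow> norm (y - x k) \<le> r \<Longrightarrow> W y = V k y"
    "\<And>y. (\<And>k. k < n \<Longrightarrow> r \<le> norm (y - x k)) \<Longrightarrow> W y = y"
proof -
  have "\<exists>W. continuous_on UNIV W \<and> inj W \<and> (\<forall>k<m. \<forall>y. norm (y - x k) \<le> r \<longrightarrow> W y = V k y) \<and>
     (\<forall>y. (\<forall>k<m. r \<le> norm (y - x k)) \<longrightarrow> W y = y)" if "m \<le> n" for m
    using that
  proof (induction m)
    case 0
    show ?case by (rule exI[of _ id]) (simp add: continuous_on_id)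
  next
    case (Suc m)
    then obtain W where W: "continuous_on UNIV W" "inj W" "\<forall>k<m. \<forall>y. norm (y - x k) \<le> r \<longrightarrow> W y = V k y"
      "\<forall>y. (\<forall>k<m. r \<le> norm (y - x k)) \<longrightarrow> W y = y" by auto
    have m: "m < n" using Suc.prems by simp
    have away: "r \<le> norm (y - x j)" if "i < n" "j < n" "i \<noteq> j" "norm (y - x i) \<le> r" for i j y
    proof -
      have "norm (x i - x j) \<le> norm (y - x i) + norm (y - x j)"
        using norm_triangle_ineq4[of "y - x j" "y - x i"] by simp
      then show ?thesis using disj[OF that(1-3)] that(4) by linarith
    qed
    show ?case
    proof (intro exI[of _ "V m \<circ> W"] conjI allI impI)
      show "continuous_on UNIV (V m \<circ> W)"
        by (rule continuous_on_compose[OF W(1)]) (rule continuous_on_subset[OF V(1)[OF m]], simp)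
      show "inj (V m \<circ> W)" using V(2)[OF m] W(2) by (rule inj_compose)
      fix k y assume k: "k < Suc m" and y: "norm (y - x k) \<le> r"
      show "(V m \<circ> W) y = V k y"
      proof (cases "k = m")
        case True
        have "\<forall>j<m. r \<le> norm (y - x j)" using away[of m _ y] m y True by auto
        then show ?thesis using W(4) True by simp
      next
        case False
        then have km: "k < m" "k < n" using k m by auto
        then have "W y = V k y" using W(3) y by blast
        moreover have "norm (V k y - x k) \<le> r" using V(4)[OF km(2) y] .
        then have "r \<le> norm (V k y - x m)" using away[of k m] km m by auto
        ultimately show ?thesis using V(3)[OF m] by simp
      qed
    next
      fix y assume y: "\<forall>k<Suc m. r \<le> norm (y - x k)"
      then have "W y = y" using W(4) by auto
      then show "(V m \<circ> W) y = y" using V(3)[OF m] y by simp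
    qed
  qed
  from this[of n] show ?thesis using that by auto
qed

context subdivided_knot
begin

lemma transversal_steep:
  assumes "transversal c" "j < n" "s \<in> piece j" "s' \<in> piece j" "s < s'"
  shows "steep (v j) (c s' - c s)"
  using assms unfolding transversal_def by blast

lemma transversal_self: "transversal K"
  unfolding transversal_def
proof (intro conjI allI impI ballI)
  fix j s s' assume j: "j < n" "s \<in> piece j" "s' \<in> piece j" "s < s'"
  have "K s' \<noteq> K s"
  proof
    assume "K s' = K s"
    then have "s = 0 \<and> s' = 1" using knot_inj[OF knot, of s' s] piece01[OF j(1)] j by auto
    then have "j = 0" "Suc j = n"
      using j t_strict[of 0 j] t_strict[of "Suc j" n] t0 tn by (cases "j = 0"; cases "Suc j = n"; auto)+
    then show False using n by simp
  qed
  then have pos: "norm (K s' - K s) > 0" by simp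
  have le: "9999/10000 * norm (K s' - K s) \<le> (K s' - K s) \<bullet> v j"
    using straight[OF j(1)] j unfolding chords_in_cone_def by blast
  then have "0 < (K s' - K s) \<bullet> v j" using pos by linarith
  have "(9999/10000 * norm (K s' - K s))\<^sup>2 \<le> ((K s' - K s) \<bullet> v j)\<^sup>2"
    using le by (intro power_mono) auto
  moreover have "(norm (K s' - K s))\<^sup>2 > 0" using pos by simp
  ultimately have "(norm (K s' - K s))\<^sup>2 < 2 * ((K s' - K s) \<bullet> v j)\<^sup>2"
    unfolding power_mult_distrib by (simp add: power2_eq_square)
  with \<open>0 < (K s' - K s) \<bullet> v j\<close> show "steep (v j) (K s' - K s)" by (simp add: steep_def)
qed (rule knot, simp)

lemma end_of_piece: "k < n \<Longrightarrow> \<exists>m<n. m \<noteq> k \<and> K (t (Suc k)) = K (t m)"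
  using n K01 t0 tn by (cases "Suc k = n") (auto intro: exI[of _ 0] exI[of _ "Suc k"])

lemma Suc_pred_vertex: "k < n \<Longrightarrow> K (t (Suc (pred k))) = K (t k)"
  using n K01 t0 tn by (auto simp: pred_def)

text \<open>The parts of a knot in the ball of radius \<open>r\<close> about vertex \<open>k\<close>: \<open>e\<close> follows the outgoing piece, and \<open>f\<close> the
  incoming piece backwards, both seen from the vertex.\<close>

definition strands :: "real \<Rightarrow> (real \<Rightarrow> space) \<Rightarrow> nat \<Rightarrow> (real \<Rightarrow> space) \<Rightarrow> (real \<Rightarrow> space) \<Rightarrow> bool" where
  "strands r c k e f \<longleftrightarrow> radial_strand r e \<and> radial_strand r f \<and>
     (\<forall>s\<in>piece k. norm (c s - K (t k)) \<le> r \<longrightarrow> c s - K (t k) = e (norm (c s - K (t k)))) \<and>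
     (\<forall>s\<in>piece (pred k). norm (c s - K (t k)) \<le> r \<longrightarrow> c s - K (t k) = f (norm (c s - K (t k)))) \<and>
     (\<forall>\<rho>\<in>{0..r}. \<exists>s\<in>piece k. c s - K (t k) = e \<rho>) \<and>
     (\<forall>\<rho>\<in>{0..r}. \<exists>s\<in>piece (pred k). c s - K (t k) = f \<rho>) \<and>
     (\<forall>\<rho>\<in>{0<..r}. e \<rho> \<noteq> f \<rho> \<and> e \<rho> \<bullet> v k > 0)"

lemma strandsD:
  assumes "strands r c k e f"
  shows "radial_strand r e" "radial_strand r f"
    "s \<in> piece k \<Longrightarrow> norm (c s - K (t k)) \<le> r \<Longrightarrow> c s - K (t k) = e (norm (c s - K (t k)))"
    "s \<in> piece (pred k) \<Longrightarrow> norm (c s - K (t k)) \<le> r \<Longrightarrow> c s - K (t k) = f (norm (c s - K (t k)))"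
    "\<rho> \<in> {0..r} \<Longrightarrow> \<exists>s\<in>piece k. c s - K (t k) = e \<rho>"
    "\<rho> \<in> {0..r} \<Longrightarrow> \<exists>s\<in>piece (pred k). c s - K (t k) = f \<rho>"
    "\<forall>\<rho>\<in>{0<..r}. e \<rho> \<noteq> f \<rho> \<and> e \<rho> \<bullet> v k > 0"
  using assms unfolding strands_def by blast+

lemma strands_at_vertex:
  assumes r: "good_radius r" and c: "transversal c" and k: "k < n"
  obtains e f where "strands r c k e f"
proof -
  have r0: "r > 0" using r by (simp add: good_radius_def)
  have kc: "knot c" and cv: "\<And>m. m \<le> n \<Longrightarrow> c (t m) = K (t m)" using c by (auto simp: transversal_def)
  have contc: "continuous_on {0..1} c" using kc by (simp add: knot_def simple_path_def path_def)
  have sep: "r \<le> norm (K (t m) - K (t k))" if "m < n" "m \<noteq> k" for m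
    using r that k r0 unfolding good_radius_def by (smt (verit))
  define j where "j = pred k"
  have j: "j < n" "j \<noteq> k" using pred k by (auto simp: j_def)
  have tk: "t k < t (Suc k)" "t j < t (Suc j)" using t_less k j by auto
  obtain e where e: "radial_strand r e"
    "\<And>s. s \<in> piece k \<Longrightarrow> norm (c s - K (t k)) \<le> r \<Longrightarrow> c s - K (t k) = e (norm (c s - K (t k)))"
    "\<And>\<rho>. \<rho> \<in> {0..r} \<Longrightarrow> e \<rho> \<in> (\<lambda>s. c s - K (t k)) ` piece k"
  proof (rule radial_strand_of_path[of "t k" "t (Suc k)" "\<lambda>s. c s - K (t k)" r])
    show "t k \<le> t (Suc k)" using tk by simp
    have "piece k \<subseteq> {0..1}" using piece01[OF k] by blast
    from continuous_on_subset[OF contc this] show "continuous_on (piece k) (\<lambda>s. c s - K (t k))"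
      by (intro continuous_intros)
    show "c (t k) - K (t k) = 0" using cv[of k] k by simp
    obtain m where "m < n" "m \<noteq> k" "K (t (Suc k)) = K (t m)" using end_of_piece[OF k] by blast
    then show "r \<le> norm (c (t (Suc k)) - K (t k))" using sep[of m] cv[of "Suc k"] k by simp
    fix s s' assume s: "t k \<le> s" "s < s'" "s' \<le> t (Suc k)"
    have "steep (v k) (c s - K (t k)) \<or> c s - K (t k) = 0"
      using transversal_steep[OF c k, of "t k" s] s tk cv[of k] k by (cases "s = t k") auto
    moreover have "steep (v k) (c s' - c s)" using transversal_steep[OF c k, of s s'] s by simp
    ultimately show "norm (c s - K (t k)) < norm (c s' - K (t k))"
      using steep_sum_longer[OF v[OF k], of "c s - K (t k)" "c s' - c s"] by simp
  qed blast
  \<comment> \<open>run backwards from its end, the incoming piece is steep in the direction opposite to its own\<close>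
  define \<tau> where "\<tau> = t (Suc j)"
  have \<tau>: "c \<tau> = K (t k)" using Suc_pred_vertex[OF k] cv[of "Suc j"] j by (simp add: \<tau>_def j_def)
  obtain f where f: "radial_strand r f"
    "\<And>s. s \<in> {0..\<tau> - t j} \<Longrightarrow> norm (c (\<tau> - s) - K (t k)) \<le> r \<Longrightarrow> c (\<tau> - s) - K (t k) = f (norm (c (\<tau> - s) - K (t k)))"
    "\<And>\<rho>. \<rho> \<in> {0..r} \<Longrightarrow> f \<rho> \<in> (\<lambda>s. c (\<tau> - s) - K (t k)) ` {0..\<tau> - t j}"
  proof (rule radial_strand_of_path[of 0 "\<tau> - t j" "\<lambda>s. c (\<tau> - s) - K (t k)" r])
    show "0 \<le> \<tau> - t j" using tk by (simp add: \<tau>_def)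
    have "(\<lambda>s. \<tau> - s) ` {0..\<tau> - t j} \<subseteq> {0..1}" using piece01[OF j(1)] by (fastforce simp: \<tau>_def)
    then have "continuous_on {0..\<tau> - t j} (\<lambda>s. c (\<tau> - s))"
      by (intro continuous_on_compose2[OF contc]) (auto intro: continuous_intros)
    then show "continuous_on {0..\<tau> - t j} (\<lambda>s. c (\<tau> - s) - K (t k))" by (intro continuous_intros)
    show "c (\<tau> - 0) - K (t k) = 0" using \<tau> by simp
    show "r \<le> norm (c (\<tau> - (\<tau> - t j)) - K (t k))" using sep[OF j] cv[of j] j by simp
    fix s s' assume s: "0 \<le> s" "s < s'" "s' \<le> \<tau> - t j"
    have "steep (- v j) (c (\<tau> - s) - K (t k)) \<or> c (\<tau> - s) - K (t k) = 0"
    proof (cases "s = 0")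
      case False
      then have "steep (v j) (c \<tau> - c (\<tau> - s))"
        using transversal_steep[OF c j(1), of "\<tau> - s" \<tau>] s tk by (simp add: \<tau>_def)
      then have "steep (- v j) (- (c \<tau> - c (\<tau> - s)))" by (simp only: steep_minus)
      then show ?thesis using \<tau> by simp
    qed (use \<tau> in simp)
    moreover have "steep (v j) (c (\<tau> - s) - c (\<tau> - s'))"
      using transversal_steep[OF c j(1), of "\<tau> - s'" "\<tau> - s"] s by (simp add: \<tau>_def)
    then have "steep (- v j) (- (c (\<tau> - s) - c (\<tau> - s')))" by (simp only: steep_minus)
    then have "steep (- v j) (c (\<tau> - s') - c (\<tau> - s))" by simp
    ultimately show "norm (c (\<tau> - s) - K (t k)) < norm (c (\<tau> - s') - K (t k))"
      using steep_sum_longer[of "- v j" "c (\<tau> - s) - K (t k)" "c (\<tau> - s') - c (\<tau> - s)"] v[OF j(1)] by simp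
  qed blast
  have f2: "c s - K (t k) = f (norm (c s - K (t k)))" if "s \<in> piece j" "norm (c s - K (t k)) \<le> r" for s
    using f(2)[of "\<tau> - s"] that by (simp add: \<tau>_def)
  have e3: "\<exists>s\<in>piece k. c s - K (t k) = e \<rho>" if "\<rho> \<in> {0..r}" for \<rho>
    using e(3)[OF that] by force
  have f3: "\<exists>s\<in>piece j. c s - K (t k) = f \<rho>" if \<rho>: "\<rho> \<in> {0..r}" for \<rho>
  proof -
    obtain s where "s \<in> {0..\<tau> - t j}" "f \<rho> = c (\<tau> - s) - K (t k)" using f(3)[OF \<rho>] by blast
    then show ?thesis by (intro bexI[of _ "\<tau> - s"]) (auto simp: \<tau>_def)
  qed
  have ef: "e \<rho> \<noteq> f \<rho> \<and> e \<rho> \<bullet> v k > 0" if \<rho>: "\<rho> \<in> {0<..r}" for \<rho>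
  proof
    have \<rho>0: "\<rho> \<in> {0..r}" using \<rho> by simp
    obtain s where s: "s \<in> piece k" "c s - K (t k) = e \<rho>" using e3[OF \<rho>0] by blast
    obtain s' where s': "s' \<in> piece j" "c s' - K (t k) = f \<rho>" using f3[OF \<rho>0] by blast
    have ne: "norm (c s - K (t k)) = \<rho>" using s(2) e(1) \<rho>0 by (simp add: radial_strand_def)
    show "e \<rho> \<noteq> f \<rho>"
    proof
      assume "e \<rho> = f \<rho>"
      then have "c s - K (t k) = c s' - K (t k)" using s(2) s'(2) by (simp only:)
      then have "c s = c s'" by simp
      then obtain m where m: "m \<le> n" "s = t m"
        using meeting_point_is_vertex[OF kc k j(1) _ s(1) s'(1)] j by auto
      then obtain l where l: "l < n" "c s = K (t l)" using vertex_index cv by metis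
      show False
      proof (cases "l = k")
        case False
        then have "4 * r < norm (K (t l) - K (t k))" using r l k unfolding good_radius_def by blast
        then show ?thesis using ne l \<rho> r0 by simp
      qed (use ne l \<rho> in simp)
    qed
    have "s \<noteq> t k" using ne \<rho> cv[of k] k by auto
    then have "steep (v k) (c s - c (t k))" using transversal_steep[OF c k, of "t k" s] s(1) tk by simp
    then show "e \<rho> \<bullet> v k > 0" using s(2) cv[of k] k by (simp add: steep_def)
  qed
  have "strands r c k e f"
    unfolding strands_def using e(1,2) f(1) f2 e3 f3 ef by (simp add: j_def)
  then show ?thesis by (rule that)
qed

text \<open>Inside the ball the two knots are pairs of radial strands, to which \<open>straightening_vertex\<close> applies.  On the
  boundary sphere the strands agree because there \<open>c\<close> already lies in \<open>K\<close>, and a piece of \<open>K\<close> meets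
  the sphere only once.\<close>

lemma vertex_ball_homeo:
  assumes r: "good_radius r" and c: "transversal c" and k: "k < n"
    and near: "\<And>s. s \<in> {0..1} \<Longrightarrow> norm (c s - K s) \<le> r"
    and onK: "\<And>j s. j < n \<Longrightarrow> s \<in> piece j \<Longrightarrow> (\<And>m. m < n \<Longrightarrow> r \<le> norm (c s - K (t m))) \<Longrightarrow> c s \<in> K ` piece j"
    and pt: "pt \<in> c ` {0..1}" "norm (pt - K (t k)) < r / 2"
  shows "\<exists>V. continuous_on UNIV V \<and> inj V \<and> (\<forall>x. r \<le> norm (x - K (t k)) \<longrightarrow> V x = x) \<and>
    (\<forall>x. norm (x - K (t k)) \<le> r \<longrightarrow> norm (V x - K (t k)) \<le> r) \<and>
    (\<forall>s\<in>{0..1}. norm (c s - K (t k)) \<le> r \<longrightarrow> V (c s) \<in> K ` {0..1}) \<and> V pt = K (t k)"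
proof -
  have r0: "r > 0" using r by (simp add: good_radius_def)
  define j where "j = pred k"
  have j: "j < n" using pred k by (auto simp: j_def)
  obtain e f where "strands r K k e f" by (rule strands_at_vertex[OF r transversal_self k])
  note e = strandsD[OF this, folded j_def]
  obtain e' f' where "strands r c k e' f'" by (rule strands_at_vertex[OF r c k])
  note e' = strandsD[OF this, folded j_def]
  have boundary: "\<exists>s'\<in>piece i. K s' - K (t k) = c s - K (t k)"
    if "i < n" "s \<in> piece i" "norm (c s - K (t k)) = r" for i s
  proof -
    have "r \<le> norm (c s - K (t m))" if "m < n" for m
    proof (cases "m = k")
      case False
      then have "4 * r < norm (K (t k) - K (t m))" using r k that unfolding good_radius_def by blast
      also have "\<dots> \<le> norm (c s - K (t m)) + norm (c s - K (t k))"
        using norm_triangle_ineq4[of "c s - K (t m)" "c s - K (t k)"] by simp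
      finally show ?thesis using \<open>norm (c s - K (t k)) = r\<close> r0 by linarith
    qed (use \<open>norm (c s - K (t k)) = r\<close> in simp)
    then have "c s \<in> K ` piece i" using onK that by blast
    then show ?thesis by force
  qed
  have rr: "r \<in> {0..r}" using r0 by simp
  have eer: "e' r = e r"
  proof -
    obtain s where s: "s \<in> piece k" "c s - K (t k) = e' r" using e'(5)[OF rr] by blast
    then have ns: "norm (c s - K (t k)) = r" using e'(1) rr by (simp add: radial_strand_def)
    then obtain s' where "s' \<in> piece k" "K s' - K (t k) = c s - K (t k)" using boundary[OF k s(1)] by blast
    then show ?thesis using e(3)[of s'] ns s(2) by simp
  qed
  have ffr: "f' r = f r"
  proof -
    obtain s where s: "s \<in> piece j" "c s - K (t k) = f' r" using e'(6)[OF rr] by blast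
    then have ns: "norm (c s - K (t k)) = r" using e'(2) rr by (simp add: radial_strand_def)
    then obtain s' where "s' \<in> piece j" "K s' - K (t k) = c s - K (t k)" using boundary[OF j s(1)] by blast
    then show ?thesis using e(4)[of s'] ns s(2) by simp
  qed
  have inball: "c s - K (t k) \<in> e' ` {0..r} \<union> f' ` {0..r}" if s: "s \<in> {0..1}" "norm (c s - K (t k)) \<le> r" for s
  proof -
    obtain i where i: "i < n" "s \<in> piece i" using piece_cover[OF s(1)] by blast
    have "i = k \<or> i = j"
    proof (rule ccontr)
      assume "\<not> (i = k \<or> i = j)"
      then have "2 * r < norm (K s - K (t k))" using r i k unfolding good_radius_def j_def by blast
      moreover have "norm (K s - K (t k)) \<le> norm (c s - K s) + norm (c s - K (t k))"
        using norm_triangle_ineq4[of "c s - K (t k)" "c s - K s"] by simp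
      ultimately show False using near[OF s(1)] s(2) by linarith
    qed
    then show ?thesis
    proof
      assume "i = k"
      then have "c s - K (t k) = e' (norm (c s - K (t k)))" using e'(3) i s by blast
      then show ?thesis using s(2) by (intro UnI1 image_eqI) auto
    next
      assume "i = j"
      then have "c s - K (t k) = f' (norm (c s - K (t k)))" using e'(4) i s by blast
      then show ?thesis using s(2) by (intro UnI2 image_eqI) auto
    qed
  qed
  have pt': "pt - K (t k) \<in> e' ` {0..r} \<union> f' ` {0..r}"
  proof -
    obtain s where s: "s \<in> {0..1}" "pt = c s" using pt(1) by blast
    show ?thesis unfolding s(2) by (rule inball[OF s(1)]) (use pt(2) s r0 in simp)
  qed
  obtain V where V: "continuous_on UNIV V" "inj V" "\<And>x. norm x \<ge> r \<Longrightarrow> V x = x"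
    "\<And>x. norm x \<le> r \<Longrightarrow> norm (V x) \<le> r"
    "V ` (e' ` {0..r} \<union> f' ` {0..r}) \<subseteq> e ` {0..r} \<union> f ` {0..r}" "V (pt - K (t k)) = 0"
    by (rule straightening_vertex[OF v[OF k] r0 e(1,2) e'(1,2) e(7) e'(7) eer ffr pt' pt(2)]) blast
  have onto: "y + K (t k) \<in> K ` {0..1}" if "y \<in> e ` {0..r} \<union> f ` {0..r}" for y
  proof -
    have "\<exists>i<n. \<exists>s\<in>piece i. K s - K (t k) = y" using that e(5,6) k j by blast
    then obtain i s where "i < n" "s \<in> piece i" "K s = y + K (t k)" by (auto simp: algebra_simps)
    then show ?thesis using piece01 by (metis image_eqI)
  qed
  show ?thesis
  proof (intro exI[of _ "\<lambda>x. V (x - K (t k)) + K (t k)"] conjI allI impI ballI)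
    show "continuous_on UNIV (\<lambda>x. V (x - K (t k)) + K (t k))"
      by (intro continuous_intros continuous_on_compose2[OF V(1)]) auto
    show "inj (\<lambda>x. V (x - K (t k)) + K (t k))"
      by (rule injI) (simp add: inj_eq[OF V(2)])
    show "V (x - K (t k)) + K (t k) = x" if "r \<le> norm (x - K (t k))" for x using V(3)[OF that] by simp
    show "norm (V (x - K (t k)) + K (t k) - K (t k)) \<le> r" if "norm (x - K (t k)) \<le> r" for x
      using V(4)[OF that] by simp
    show "V (c s - K (t k)) + K (t k) \<in> K ` {0..1}" if "s \<in> {0..1}" "norm (c s - K (t k)) \<le> r" for s
      using inball[OF that] V(5) by (intro onto) blast
    show "V (pt - K (t k)) + K (t k) = K (t k)" using V(6) by simp
  qed
qed

text \<open>The knot is first moved into \<open>K\<close> outside the balls about the vertices, and then straightened in each of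
  the balls, whose size bounds the displacement.  The two given points are near vertices, so they
  can be slid to these vertices at the same time.\<close>

lemma ambient_straightening:
  assumes "\<epsilon> > 0" and ab: "a < n" "b < n" "a \<noteq> b"
  shows "\<exists>\<delta>>0. \<forall>g p' q'. follows \<delta> g \<and> p' \<in> g ` {0..1} \<and> q' \<in> g ` {0..1} \<and>
      norm (p' - K (t a)) \<le> \<delta> \<and> norm (q' - K (t b)) \<le> \<delta> \<longrightarrow>
      (\<exists>H H'. homeomorphism UNIV UNIV H H' \<and> (\<forall>x. norm (H x - x) \<le> \<epsilon>) \<and>
         H ` g ` {0..1} \<subseteq> K ` {0..1} \<and> H p' = K (t a) \<and> H q' = K (t b))"
proof -
  obtain R where R: "good_radius R" using good_radius_exists by blast
  define r where "r = min R (\<epsilon> / 4)"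
  have r0: "r > 0" using R \<open>\<epsilon> > 0\<close> by (simp add: r_def good_radius_def)
  have r: "good_radius r" using good_radius_mono[OF R r0] by (simp add: r_def)
  have re: "4 * r \<le> \<epsilon>" by (simp add: r_def)
  have r8: "r / 8 > 0" using r0 by simp
  obtain \<delta>0 where \<delta>0: "\<delta>0 > 0" "\<And>g. follows \<delta>0 g \<Longrightarrow> \<exists>H. straightens r (r / 8) g H"
    by (rule transversal_approximation[OF r r8]) blast
  show ?thesis
  proof (intro exI[of _ "min \<delta>0 (r / 8)"] conjI allI impI)
    show "min \<delta>0 (r / 8) > 0" using \<delta>0 r0 by simp
    fix g p' q' assume A: "follows (min \<delta>0 (r / 8)) g \<and> p' \<in> g ` {0..1} \<and> q' \<in> g ` {0..1} \<and>
      norm (p' - K (t a)) \<le> min \<delta>0 (r / 8) \<and> norm (q' - K (t b)) \<le> min \<delta>0 (r / 8)"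
    then have "follows \<delta>0 g" and gK: "\<And>s. s \<in> {0..1} \<Longrightarrow> norm (g s - K s) \<le> r / 8"
      by (auto simp: follows_def)
    then obtain H where H: "continuous_on UNIV H" "inj H" "\<And>x. norm (H x - x) \<le> r / 8" "transversal (H \<circ> g)"
      "\<And>j s. j < n \<Longrightarrow> s \<in> piece j \<Longrightarrow> (\<And>k. k < n \<Longrightarrow> r \<le> norm (H (g s) - K (t k))) \<Longrightarrow> H (g s) \<in> K ` piece j"
      using \<delta>0(2) unfolding straightens_def by metis
    \<comment> \<open>the point that is to become the vertex; elsewhere the knot already passes through the vertex\<close>
    define pt where "pt = (\<lambda>k. if k = a then H p' else if k = b then H q' else K (t k))"
    have shift: "norm (H x - y) \<le> r / 4" if "norm (x - y) \<le> r / 8" for x y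
      using norm_triangle_ineq[of "H x - x" "x - y"] H(3)[of x] that by simp
    have pt: "pt k \<in> (H \<circ> g) ` {0..1}" "norm (pt k - K (t k)) < r / 2" if "k < n" for k
    proof -
      have "(H \<circ> g) (t k) = K (t k)" using H(4) that by (simp add: transversal_def)
      then have "K (t k) \<in> (H \<circ> g) ` {0..1}" using t01[of k] that by (metis image_eqI less_imp_le)
      moreover have "H p' \<in> (H \<circ> g) ` {0..1}" "H q' \<in> (H \<circ> g) ` {0..1}"
        using A by (auto simp: image_comp[symmetric])
      ultimately show "pt k \<in> (H \<circ> g) ` {0..1}" by (simp add: pt_def)
      have "norm (H p' - K (t a)) \<le> r / 4" "norm (H q' - K (t b)) \<le> r / 4"
        by (rule shift, use A in simp)+
      then show "norm (pt k - K (t k)) < r / 2" using r0 by (simp add: pt_def)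
    qed
    have near: "norm ((H \<circ> g) s - K s) \<le> r" if "s \<in> {0..1}" for s
      using shift[OF gK[OF that]] r0 by simp
    define Q where "Q = (\<lambda>k V. continuous_on UNIV V \<and> inj V \<and> (\<forall>x. r \<le> norm (x - K (t k)) \<longrightarrow> V x = x) \<and>
      (\<forall>x. norm (x - K (t k)) \<le> r \<longrightarrow> norm (V x - K (t k)) \<le> r) \<and>
      (\<forall>s\<in>{0..1}. norm ((H \<circ> g) s - K (t k)) \<le> r \<longrightarrow> V ((H \<circ> g) s) \<in> K ` {0..1}) \<and> V (pt k) = K (t k))"
    have "\<exists>V. Q k V" if "k < n" for k
      unfolding Q_def
    proof (rule vertex_ball_homeo[OF r H(4) that near _ pt[OF that]])
      fix j s assume "j < n" "s \<in> piece j" "\<And>m. m < n \<Longrightarrow> r \<le> norm ((H \<circ> g) s - K (t m))"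
      then show "(H \<circ> g) s \<in> K ` piece j" using H(5)[of j s] by simp
    qed
    then have Q: "Q k (SOME V. Q k V)" if "k < n" for k using that someI_ex by metis
    define V where "V = (\<lambda>k. SOME V. Q k V)"
    have V: "continuous_on UNIV (V k)" "inj (V k)"
      "r \<le> norm (x - K (t k)) \<Longrightarrow> V k x = x"
      "norm (x - K (t k)) \<le> r \<Longrightarrow> norm (V k x - K (t k)) \<le> r"
      "s \<in> {0..1} \<Longrightarrow> norm ((H \<circ> g) s - K (t k)) \<le> r \<Longrightarrow> V k ((H \<circ> g) s) \<in> K ` {0..1}"
      "V k (pt k) = K (t k)" if "k < n" for k x s
      using Q[OF that] unfolding Q_def V_def by blast+
    have disj: "2 * r < norm (K (t i) - K (t j))" if "i < n" "j < n" "i \<noteq> j" for i j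
      using r that r0 unfolding good_radius_def by (smt (verit))
    obtain W where W: "continuous_on UNIV W" "inj W" "\<And>k y. k < n \<Longrightarrow> norm (y - K (t k)) \<le> r \<Longrightarrow> W y = V k y"
      "\<And>y. (\<And>k. k < n \<Longrightarrow> r \<le> norm (y - K (t k))) \<Longrightarrow> W y = y"
      by (rule disjoint_support_composition[of n V r "\<lambda>k. K (t k)"]) (use V(1-4) disj in blast)+
    have Wd: "norm (W y - y) \<le> 2 * r" for y
    proof (cases "\<exists>k<n. norm (y - K (t k)) \<le> r")
      case True
      then obtain k where "k < n" "norm (y - K (t k)) \<le> r" by blast
      then show ?thesis using W(3) V(4) norm_triangle_ineq4[of "W y - K (t k)" "y - K (t k)"] by fastforce
    next
      case False
      then have "W y = y" using W(4)[of y] by force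
      then show ?thesis using r0 by simp
    qed
    have d: "norm ((W \<circ> H) x - x) \<le> \<epsilon>" for x
      using norm_triangle_ineq[of "W (H x) - H x" "H x - x"] Wd[of "H x"] H(3)[of x] re r0 by simp
    have "continuous_on UNIV (W \<circ> H)"
      by (rule continuous_on_compose[OF H(1)]) (rule continuous_on_subset[OF W(1)], simp)
    moreover have "inj (W \<circ> H)" using W(2) H(2) by (rule inj_compose)
    ultimately obtain H' where H': "homeomorphism UNIV UNIV (W \<circ> H) H'"
      using bounded_displacement_homeomorphism[of "W \<circ> H" \<epsilon>] d by blast
    have "(W \<circ> H) (g s) \<in> K ` {0..1}" if s: "s \<in> {0..1}" for s
    proof (cases "\<exists>k<n. norm (H (g s) - K (t k)) \<le> r")
      case True
      then obtain k where "k < n" "norm (H (g s) - K (t k)) \<le> r" by blast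
      then show ?thesis using W(3) V(5)[of k s] s by simp
    next
      case False
      then have far: "\<And>k. k < n \<Longrightarrow> r \<le> norm (H (g s) - K (t k))" by force
      obtain j where j: "j < n" "s \<in> piece j" using piece_cover[OF s] by blast
      have "H (g s) \<in> K ` piece j" using H(5)[OF j far] .
      then have "H (g s) \<in> K ` {0..1}" using piece01[OF j(1)] by blast
      then show ?thesis using W(4)[OF far] by simp
    qed
    moreover have Wpt: "W (pt k) = K (t k)" if "k < n" for k
      using W(3)[OF that, of "pt k"] V(6)[OF that] pt(2)[OF that] r0 by simp
    have "(W \<circ> H) p' = K (t a)" "(W \<circ> H) q' = K (t b)"
      using Wpt[OF ab(1)] Wpt[OF ab(2)] ab(3) by (simp_all add: pt_def)
    ultimately show "\<exists>H H'. homeomorphism UNIV UNIV H H' \<and> (\<forall>x. norm (H x - x) \<le> \<epsilon>) \<and>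
         H ` g ` {0..1} \<subseteq> K ` {0..1} \<and> H p' = K (t a) \<and> H q' = K (t b)"
      using H' d by (intro exI[of _ "W \<circ> H"] exI[of _ H']) (auto simp del: o_apply)
  qed
qed

end

section \<open>Subarcs of a knot\<close>

lemma knot_path: "knot g \<Longrightarrow> continuous_on {0..1} g" "knot g \<Longrightarrow> g 1 = g 0"
  by (simp_all add: knot_def simple_path_def path_def pathfinish_def pathstart_def)

lemma knot_inj_on: "knot g \<Longrightarrow> inj_on g {0..<1}"
  by (rule inj_onI) (use knot_inj[of g] in force)

lemma knot_parameter:
  assumes "knot g" "x \<in> path_image g"
  obtains a where "a \<in> {0..<1}" "g a = x"
proof -
  obtain s where s: "s \<in> {0..1}" "g s = x" using assms(2) by (auto simp: path_image_def)
  show ?thesis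
  proof (cases "s = 1")
    case True
    then show ?thesis using that[of 0] s knot_path(2)[OF assms(1)] by simp
  qed (use that[of s] s in auto)
qed

lemma subarc_eq:
  assumes g: "knot g" and ab: "a \<in> {0..<1}" "b \<in> {0..<1}" "a \<noteq> b"
  shows "subarc g (g a) (g b) = (if a < b then g ` {a..b} else g ` {a..1} \<union> g ` {0..b})"
proof -
  define r where "r = shiftpath a g"
  define c where "c = (if a < b then b - a else b - a + 1)"
  have a: "inv_into {0..<1} g (g a) = a" using inv_into_f_f[OF knot_inj_on[OF g] ab(1)] .
  have kr: "knot r"
    using g ab(1) unfolding knot_def r_def
    by (auto intro!: simple_path_shiftpath closed_shiftpath)
  have c: "c \<in> {0..<1}" using ab by (auto simp: c_def)
  have g1: "g 1 = g 0" by (rule knot_path(2)[OF g])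
  have rc: "r c = g b"
    using ab g1 by (cases "b = 0") (auto simp: r_def shiftpath_def c_def)
  have "inv_into {0..<1} r (g b) = c"
    using inv_into_f_f[OF knot_inj_on[OF kr] c] rc by simp
  then have sub: "subarc g (g a) (g b) = r ` {0..c}"
    by (simp add: subarc_def a r_def[symmetric])
  show ?thesis
  proof (cases "a < b")
    case True
    have "r ` {0..c} = (\<lambda>x. g (a + x)) ` {0..b - a}"
      unfolding r_def c_def using True ab by (intro image_cong) (auto simp: shiftpath_def)
    also have "\<dots> = g ` ((\<lambda>x. a + x) ` {0..b - a})" by (simp only: image_image)
    also have "(\<lambda>x. a + x) ` {0..b - a} = {a..b}" by simp
    finally show ?thesis using True sub by simp
  next
    case False
    have "r ` {0..c} = g ` {a..1} \<union> g ` {0..b}"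
    proof (intro equalityI subsetI)
      fix y assume "y \<in> r ` {0..c}"
      then obtain x where x: "x \<in> {0..c}" "y = r x" by blast
      show "y \<in> g ` {a..1} \<union> g ` {0..b}"
      proof (cases "a + x \<le> 1")
        case True
        then have "y = g (a + x)" using x by (simp add: r_def shiftpath_def)
        then show ?thesis using True x by (intro UnI1 image_eqI) auto
      next
        case f: False
        then have "y = g (a + x - 1)" using x by (simp add: r_def shiftpath_def)
        then show ?thesis using f x False by (intro UnI2 image_eqI) (auto simp: c_def)
      qed
    next
      fix y assume "y \<in> g ` {a..1} \<union> g ` {0..b}"
      then consider x where "x \<in> {a..1}" "y = g x" | x where "x \<in> {0..b}" "y = g x" by blast
      then show "y \<in> r ` {0..c}"
      proof cases
        case 1
        then have "y = r (x - a)" by (simp add: r_def shiftpath_def)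
        then show ?thesis using 1 False ab by (intro image_eqI) (auto simp: c_def)
      next
        case 2
        then have "y = r (x - a + 1)" using g1 by (cases "x = 0") (auto simp: r_def shiftpath_def)
        then show ?thesis using 2 False ab by (intro image_eqI) (auto simp: c_def)
      qed
    qed
    then show ?thesis using False sub by simp
  qed
qed

lemma subarc_subset:
  assumes "knot g" "p \<in> path_image g" "q \<in> path_image g" "p \<noteq> q"
  shows "subarc g p q \<subseteq> path_image g"
proof -
  obtain a where a: "a \<in> {0..<1}" "g a = p" using knot_parameter[OF assms(1,2)] .
  obtain b where b: "b \<in> {0..<1}" "g b = q" using knot_parameter[OF assms(1,3)] .
  have "a \<noteq> b" using a b assms(4) by auto
  then have "subarc g p q = (if a < b then g ` {a..b} else g ` {a..1} \<union> g ` {0..b})"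
    using subarc_eq[OF assms(1) a(1) b(1)] a(2) b(2) by simp
  moreover have "{a..b} \<subseteq> {0..1}" "{a..1} \<subseteq> {0..1}" "{0..b} \<subseteq> {0..1}" using a b by auto
  ultimately show ?thesis unfolding path_image_def by (auto split: if_splits)
qed

lemma connected_subarc:
  assumes g: "knot g" and ab: "a \<in> {0..<1}" "b \<in> {0..<1}" "a \<noteq> b"
  shows "connected (subarc g (g a) (g b))" "g a \<in> subarc g (g a) (g b)" "g b \<in> subarc g (g a) (g b)"
proof -
  have con: "connected (g ` {x..y})" if "0 \<le> x" "y \<le> 1" for x y
    using continuous_on_subset[OF knot_path(1)[OF g], of "{x..y}"] that
    by (intro connected_continuous_image) auto
  show "connected (subarc g (g a) (g b))"
  proof (cases "a < b")
    case True
    then show ?thesis using subarc_eq[OF assms] con[of a b] ab by simp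
  next
    case False
    have "g 1 \<in> g ` {a..1}" "g 0 \<in> g ` {0..b}" using ab by auto
    then have "g 1 \<in> g ` {a..1} \<inter> g ` {0..b}" using knot_path(2)[OF g] by simp
    then have "g ` {a..1} \<inter> g ` {0..b} \<noteq> {}" by blast
    then have "connected (g ` {a..1} \<union> g ` {0..b})"
      using con[of a 1] con[of 0 b] ab by (intro connected_Un) auto
    then show ?thesis using subarc_eq[OF assms] False by simp
  qed
  show "g a \<in> subarc g (g a) (g b)" "g b \<in> subarc g (g a) (g b)"
    using subarc_eq[OF assms] ab by auto
qed

text \<open>The two arcs between the missing points are closed and meet only in these points.\<close>

lemma two_points_separate_knot:
  assumes g: "knot g" and lh: "0 \<le> lo" "lo \<le> hi" "hi \<le> 1"
    and C: "connected C" "C \<subseteq> path_image g" "g lo \<notin> C" "g hi \<notin> C"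
    and a: "a \<in> {lo..hi}" "g a \<in> C" and b: "b \<in> {0..lo} \<union> {hi..1}" "g b \<in> C"
  shows False
proof -
  define X where "X = g ` {lo..hi}"
  define Y where "Y = g ` ({0..lo} \<union> {hi..1})"
  have cont: "continuous_on {0..1} g" by (rule knot_path(1)[OF g])
  have "compact X" unfolding X_def
    by (rule compact_continuous_image[OF continuous_on_subset[OF cont]]) (use lh in auto)
  moreover have "compact Y" unfolding Y_def
    by (rule compact_continuous_image[OF continuous_on_subset[OF cont]]) (use lh in auto)
  ultimately have "closed X" "closed Y" by (simp_all add: compact_imp_closed)
  moreover have "C \<subseteq> X \<union> Y"
  proof
    fix x assume "x \<in> C"
    then obtain s where "s \<in> {0..1}" "x = g s" using C(2) by (auto simp: path_image_def)
    then show "x \<in> X \<union> Y" unfolding X_def Y_def by (cases "s \<in> {lo..hi}") auto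
  qed
  moreover have "X \<inter> Y \<inter> C = {}"
  proof (rule ccontr)
    assume "X \<inter> Y \<inter> C \<noteq> {}"
    then obtain y where y: "y \<in> X" "y \<in> Y" "y \<in> C" by blast
    obtain s where s1: "s \<in> {lo..hi}" "y = g s" using y(1) unfolding X_def by blast
    obtain s' where s2: "s' \<in> {0..lo} \<union> {hi..1}" "y = g s'" using y(2) unfolding Y_def by blast
    have s: "s \<in> {lo..hi}" "s' \<in> {0..lo} \<union> {hi..1}" "g s = g s'" "g s \<in> C"
      using s1 s2 y(3) by simp_all
    have "s = s' \<or> s = 0 \<and> s' = 1 \<or> s = 1 \<and> s' = 0"
      using s lh by (intro knot_inj[OF g]) auto
    then have "s = lo \<or> s = hi" using s(1,2) lh by auto
    then show False using s(4) C(3,4) by auto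
  qed
  moreover have "X \<inter> C \<noteq> {}" "Y \<inter> C \<noteq> {}" using a b unfolding X_def Y_def by blast+
  ultimately show False using C(1) unfolding connected_closed by blast
qed

text \<open>If the set missed a point of each subarc, these two points would separate \<open>g a\<close> from \<open>g b\<close> in the knot.\<close>

lemma connected_contains_subarc:
  assumes g: "knot g" and ab: "a \<in> {0..<1}" "b \<in> {0..<1}" "a \<noteq> b"
    and C: "connected C" "C \<subseteq> path_image g" "g a \<in> C" "g b \<in> C"
  shows "subarc g (g a) (g b) \<subseteq> C \<or> subarc g (g b) (g a) \<subseteq> C"
proof -
  have *: "g ` {a..b} \<subseteq> C \<or> g ` {b..1} \<union> g ` {0..a} \<subseteq> C"
    if ab: "a \<in> {0..<1}" "b \<in> {0..<1}" "a < b" and C': "g a \<in> C" "g b \<in> C" for a b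
  proof (rule ccontr)
    assume "\<not> ?thesis"
    then obtain u w where u: "u \<in> {a..b}" "g u \<notin> C" and w: "w \<in> {b..1} \<union> {0..a}" "g w \<notin> C" by blast
    show False
    proof (cases "w \<in> {b..1}")
      case True
      then show ?thesis
        using two_points_separate_knot[OF g _ _ _ C(1,2) u(2) w(2), of b a] u(1) ab C' by auto
    next
      case False
      then have "w \<in> {0..a}" using w by auto
      then show ?thesis
        using two_points_separate_knot[OF g _ _ _ C(1,2) w(2) u(2), of a b] u(1) ab C' by auto
    qed
  qed
  show ?thesis
  proof (cases "a < b")
    case True
    then show ?thesis using *[OF ab(1,2)] C subarc_eq[OF g ab] subarc_eq[OF g ab(2,1)] ab by simp
  next
    case False
    then show ?thesis using *[OF ab(2,1)] C subarc_eq[OF g ab] subarc_eq[OF g ab(2,1)] ab by auto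
  qed
qed

lemma connected_in_arc:
  assumes A: "arc_between p q A" and X: "connected X" "X \<subseteq> A" "p \<in> X" "q \<in> X"
  shows "X = A"
proof -
  obtain c where c: "arc c" "c 0 = p" "c 1 = q" "c ` {0..1} = A"
    using A unfolding arc_between_def by (auto simp: pathstart_def pathfinish_def path_image_def)
  have cont: "continuous_on {0..1} c" and inj: "inj_on c {0..1}" using c(1) by (auto simp: arc_def path_def)
  define k where "k = inv_into {0..1} c"
  have k: "k (c s) = s" if "s \<in> {0..1}" for s using inv_into_f_f[OF inj that] by (simp add: k_def)
  have "continuous_on (c ` {0..1}) k" using k by (intro continuous_on_inv[OF cont compact_Icc]) auto
  then have "continuous_on X k" using X(2) c(4) continuous_on_subset by blast
  then have con: "connected (k ` X)" using X(1) by (rule connected_continuous_image)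
  have "0 \<in> k ` X" "1 \<in> k ` X" using X(3,4) c(2,3) k[of 0] k[of 1] by (metis atLeastAtMost_iff image_eqI order_refl zero_le_one)+
  then have "{0..1} \<subseteq> k ` X" using con by (rule_tac connected_contains_Icc) auto
  show ?thesis
  proof (rule equalityI[OF X(2)], rule subsetI)
    fix y assume "y \<in> A"
    then obtain s where s: "s \<in> {0..1}" "y = c s" using c(4) by blast
    then obtain x where x: "x \<in> X" "s = k x" using \<open>{0..1} \<subseteq> k ` X\<close> by blast
    obtain s' where "s' \<in> {0..1}" "x = c s'" using x(1) X(2) c(4) by blast
    then have "y = x" using s(2) x(2) k by simp
    then show "y \<in> X" using x(1) by simp
  qed
qed

text \<open>The arc contains one of the two subarcs, and no proper connected subset of an arc contains both of its ends.\<close>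

lemma arc_in_knot:
  assumes g: "knot g" and ab: "a \<in> {0..<1}" "b \<in> {0..<1}" "a \<noteq> b"
    and A: "arc_between (g a) (g b) A" "A \<subseteq> path_image g"
  shows "A = subarc g (g a) (g b) \<or> A = subarc g (g b) (g a)"
proof -
  obtain c where c: "arc c" "pathstart c = g a" "pathfinish c = g b" "path_image c = A"
    using A(1) unfolding arc_between_def by blast
  have "connected A" "g a \<in> A" "g b \<in> A"
    using connected_path_image[OF arc_imp_path[OF c(1)]] pathstart_in_path_image[of c] pathfinish_in_path_image[of c] c by auto
  then have "subarc g (g a) (g b) \<subseteq> A \<or> subarc g (g b) (g a) \<subseteq> A"
    using connected_contains_subarc[OF g ab _ A(2)] by blast
  then show ?thesis
    using connected_in_arc[OF A(1)] connected_subarc[OF g ab] connected_subarc[OF g ab(2,1)] ab(3) by metis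
qed

text \<open>The parameters \<open>a\<close>, \<open>m\<close>, \<open>b\<close> come in this cyclic order.\<close>

definition cyc :: "real \<Rightarrow> real \<Rightarrow> real \<Rightarrow> bool" where
  "cyc a m b \<longleftrightarrow> (if a < b then a \<le> m \<and> m \<le> b else a \<le> m \<or> m \<le> b)"

lemma cyc_in_subarc:
  assumes "knot g" "a \<in> {0..<1}" "b \<in> {0..<1}" "a \<noteq> b" "m \<in> {0..<1}" "cyc a m b"
  shows "g m \<in> subarc g (g a) (g b)"
  using subarc_eq[OF assms(1-4)] assms(2-6) by (auto simp: cyc_def split: if_splits)

text \<open>In terms of parameters, \<open>h\<close> is an increasing function followed by a rotation of the circle, and neither
  of them changes the cyclic order.\<close>

lemma orientation_preserving_subarc:
  assumes G: "knot G" and K: "knot K" and ori: "orientation_preserving G K h"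
    and xs: "x \<in> path_image G" "y \<in> path_image G" "z \<in> path_image G"
    and h: "h x = K a" "h y = K m" "h z = K b"
    and abm: "a \<in> {0..<1}" "m \<in> {0..<1}" "b \<in> {0..<1}" "a \<noteq> b" "cyc a m b"
  shows "y \<in> subarc G x z"
proof -
  obtain a0 \<phi> where a0: "0 \<le> a0" "a0 \<le> 1" and \<phi>: "strict_mono_on {0..1} \<phi>" "\<phi> ` {0..1} = {0..1}"
    and hs: "\<And>t. t \<in> {0..1} \<Longrightarrow> h (G t) = shiftpath a0 K (\<phi> t)"
    using ori unfolding orientation_preserving_def by auto
  \<comment> \<open>reduction modulo 1 of a sum of two parameters\<close>
  define N where "N = (\<lambda>x::real. if x < 1 then x else x - 1)"
  have mono: "\<phi> s < \<phi> t \<longleftrightarrow> s < t" if "s \<in> {0..1}" "t \<in> {0..1}" for s t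
    using strict_mono_onD[OF \<phi>(1) that] strict_mono_onD[OF \<phi>(1) that(2,1)]
    by (cases s t rule: linorder_cases) auto
  have \<phi>01: "\<phi> s \<in> {0..<1}" if "s \<in> {0..<1}" for s
  proof -
    have "\<phi> s < \<phi> 1" using mono[of s 1] that by simp
    moreover have "\<phi> 1 \<in> {0..1}" "\<phi> s \<in> {0..1}" using \<phi>(2) that by auto
    ultimately show ?thesis by auto
  qed
  have param: "s \<in> {0..<1} \<Longrightarrow> u \<in> {0..<1} \<Longrightarrow> h (G s) = K u \<Longrightarrow> u = N (\<phi> s + a0)" for s u
  proof -
    assume s: "s \<in> {0..<1}" and u: "u \<in> {0..<1}" "h (G s) = K u"
    have "h (G s) = K (N (\<phi> s + a0))"
      using hs[of s] s knot_path(2)[OF K] by (cases "\<phi> s + a0 = 1") (auto simp: shiftpath_def N_def add.commute)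
    moreover have "N (\<phi> s + a0) \<in> {0..<1}" using \<phi>01[OF s] a0 by (auto simp: N_def)
    ultimately show "u = N (\<phi> s + a0)" using u inj_onD[OF knot_inj_on[OF K]] by metis
  qed
  obtain \<alpha> where \<alpha>: "\<alpha> \<in> {0..<1}" "G \<alpha> = x" using knot_parameter[OF G xs(1)] .
  obtain \<mu> where \<mu>: "\<mu> \<in> {0..<1}" "G \<mu> = y" using knot_parameter[OF G xs(2)] .
  obtain \<beta> where \<beta>: "\<beta> \<in> {0..<1}" "G \<beta> = z" using knot_parameter[OF G xs(3)] .
  have eq: "a = N (\<phi> \<alpha> + a0)" "m = N (\<phi> \<mu> + a0)" "b = N (\<phi> \<beta> + a0)"
    using param \<alpha> \<mu> \<beta> h abm by auto
  have ne: "\<alpha> \<noteq> \<beta>" using eq abm(4) by auto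
  have "cyc (\<phi> \<alpha>) (\<phi> \<mu>) (\<phi> \<beta>)"
    using abm(4,5) \<phi>01[OF \<alpha>(1)] \<phi>01[OF \<mu>(1)] \<phi>01[OF \<beta>(1)] a0
    unfolding eq cyc_def N_def by (simp split: if_splits)
  then have "cyc \<alpha> \<mu> \<beta>"
    using mono[of \<alpha> \<beta>] mono[of \<mu> \<alpha>] mono[of \<beta> \<mu>] \<alpha>(1) \<mu>(1) \<beta>(1)
    unfolding cyc_def by (auto simp: not_less[symmetric] split: if_splits)
  then show ?thesis using cyc_in_subarc[OF G \<alpha>(1) \<beta>(1) ne \<mu>(1)] \<alpha> \<mu> \<beta> by simp
qed

text \<open>The second alternative covers parameters on the other side of the base point.\<close>

lemma close_points_close_parameters:
  assumes g: "knot g" and a: "a \<in> {0..<1}" and "\<eta> > 0"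
  shows "\<exists>\<rho>>0. \<forall>s\<in>{0..1}. norm (g s - g a) < \<rho> \<longrightarrow> \<bar>s - a\<bar> < \<eta> \<or> \<bar>s - a\<bar> > 1 - \<eta>"
proof -
  define T where "T = {0..1} \<inter> {s. \<eta> \<le> \<bar>s - a\<bar>} \<inter> {s. \<bar>s - a\<bar> \<le> 1 - \<eta>}"
  have "closed {s. \<eta> \<le> \<bar>s - a\<bar>}" "closed {s. \<bar>s - a\<bar> \<le> 1 - \<eta>}"
    by (intro closed_Collect_le continuous_intros)+
  then have "compact T" unfolding T_def by (intro compact_Int_closed compact_Icc)
  moreover have "T \<subseteq> {0..1}" by (auto simp: T_def)
  ultimately have "closed (g ` T)"
    using continuous_on_subset[OF knot_path(1)[OF g]] by (intro compact_imp_closed compact_continuous_image) auto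
  moreover have "g a \<notin> g ` T"
  proof
    assume "g a \<in> g ` T"
    then obtain s where s: "s \<in> T" "g s = g a" by auto
    then have "s \<in> {0..1}" using \<open>T \<subseteq> {0..1}\<close> by blast
    then have "s = a \<or> s = 0 \<and> a = 1 \<or> s = 1 \<and> a = 0" using a s(2) by (intro knot_inj[OF g]) auto
    then show False using s(1) a \<open>\<eta> > 0\<close> by (auto simp: T_def)
  qed
  ultimately have "\<exists>d>0. \<forall>y\<in>g ` T. d \<le> dist (g a) y" by (rule separate_point_closed)
  then obtain \<rho> where \<rho>: "\<rho> > 0" "\<forall>y\<in>g ` T. \<rho> \<le> dist (g a) y" by blast
  show ?thesis
  proof (intro exI[of _ \<rho>] conjI ballI impI)
    fix s assume s: "s \<in> {0..1}" "norm (g s - g a) < \<rho>"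
    then have "s \<notin> T" using \<rho>(2) by (force simp: dist_norm norm_minus_commute)
    then show "\<bar>s - a\<bar> < \<eta> \<or> \<bar>s - a\<bar> > 1 - \<eta>" using s(1) by (auto simp: T_def)
  qed (rule \<rho>(1))
qed

text \<open>An interior point of the subarc from \<open>a\<close> to \<open>b\<close> stays between the end points if these move a little, also
  if one of them passes the base point.\<close>

lemma stable_interior_point:
  assumes g: "knot g" and ab: "a \<in> {0..<1}" "b \<in> {0..<1}" "a \<noteq> b"
  obtains m \<rho> where "m \<in> {0..<1}" "\<rho> > 0" "g m \<notin> subarc g (g b) (g a)"
    "\<And>a' b'. a' \<in> {0..<1} \<Longrightarrow> b' \<in> {0..<1} \<Longrightarrow> norm (g a' - g a) < \<rho> \<Longrightarrow> norm (g b' - g b) < \<rho> \<Longrightarrow>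
       a' \<noteq> b' \<and> cyc a' m b'"
proof -
  define m where "m = (if a < b then (a + b) / 2 else (a + 1) / 2)"
  \<comment> \<open>small enough to separate the parameters a, b, m, and 1,
    where 1 stands for the base point approached from below\<close>
  define \<eta> where "\<eta> = min (\<bar>b - a\<bar> / 4) (min ((1 - a) / 4) ((1 - b) / 4))"
  have \<eta>: "\<eta> > 0" "4 * \<eta> \<le> \<bar>b - a\<bar>" "4 * \<eta> \<le> 1 - a" "4 * \<eta> \<le> 1 - b"
  proof -
    have e: "\<eta> \<le> \<bar>b - a\<bar> / 4" "\<eta> \<le> (1 - a) / 4" "\<eta> \<le> (1 - b) / 4"
      unfolding \<eta>_def by linarith+
    show "4 * \<eta> \<le> \<bar>b - a\<bar>" using e(1) by simp
    show "4 * \<eta> \<le> 1 - a" using e(2) by simp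
    show "4 * \<eta> \<le> 1 - b" using e(3) by simp
    show "\<eta> > 0" using ab by (simp add: \<eta>_def)
  qed
  obtain \<rho>1 where \<rho>1: "\<rho>1 > 0" "\<forall>s\<in>{0..1}. norm (g s - g a) < \<rho>1 \<longrightarrow> \<bar>s - a\<bar> < \<eta> \<or> \<bar>s - a\<bar> > 1 - \<eta>"
    using close_points_close_parameters[OF g ab(1) \<eta>(1)] by blast
  obtain \<rho>2 where \<rho>2: "\<rho>2 > 0" "\<forall>s\<in>{0..1}. norm (g s - g b) < \<rho>2 \<longrightarrow> \<bar>s - b\<bar> < \<eta> \<or> \<bar>s - b\<bar> > 1 - \<eta>"
    using close_points_close_parameters[OF g ab(2) \<eta>(1)] by blast
  have m: "m \<in> {0..<1}" using ab by (auto simp: m_def)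
  show ?thesis
  proof (rule that[of m "min \<rho>1 \<rho>2"])
    show "m \<in> {0..<1}" by (rule m)
    show "min \<rho>1 \<rho>2 > 0" using \<rho>1 \<rho>2 by simp
    show "g m \<notin> subarc g (g b) (g a)"
    proof
      assume "g m \<in> subarc g (g b) (g a)"
      then have "g m \<in> (if b < a then g ` {b..a} else g ` ({b..1} \<union> {0..a}))"
        unfolding image_Un subarc_eq[OF g ab(2,1) ab(3)[symmetric], symmetric] .
      then obtain s where s: "g m = g s" "s \<in> (if b < a then {b..a} else {b..1} \<union> {0..a})"
        by (auto simp del: Un_iff split: if_splits)
      have s01: "s \<in> {0..1}" using s(2) ab by (auto split: if_splits)
      have "m = s \<or> m = 0 \<and> s = 1 \<or> m = 1 \<and> s = 0" using m s(1) s01 by (intro knot_inj[OF g]) auto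
      then show False using s(2) ab by (auto simp: m_def split: if_splits)
    qed
    fix a' b' assume A: "a' \<in> {0..<1}" "b' \<in> {0..<1}" "norm (g a' - g a) < min \<rho>1 \<rho>2" "norm (g b' - g b) < min \<rho>1 \<rho>2"
    then have 1: "\<bar>a' - a\<bar> < \<eta> \<or> \<bar>a' - a\<bar> > 1 - \<eta>" and 2: "\<bar>b' - b\<bar> < \<eta> \<or> \<bar>b' - b\<bar> > 1 - \<eta>"
      using \<rho>1(2) \<rho>2(2) by auto
    have bounds: "0 \<le> a'" "a' < 1" "0 \<le> b'" "b' < 1" "0 \<le> a" "a < 1" "0 \<le> b" "b < 1" using A ab by auto
    show "a' \<noteq> b' \<and> cyc a' m b'"
    proof (cases "a < b")
      case True
      then have mm: "2 * m = a + b" "b - a \<ge> 4 * \<eta>" using \<eta> by (auto simp: m_def)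
      have "(a' < m \<and> m < b') \<or> (b' < a' \<and> m < b')"
        using 1 2 mm \<eta> bounds True by (auto simp: abs_if split: if_splits)
      then show ?thesis by (auto simp: cyc_def)
    next
      case False
      then have mm: "2 * m = a + 1" "a - b \<ge> 4 * \<eta>" using \<eta> ab by (auto simp: m_def)
      have "(b' < a' \<and> a' < m) \<or> (a' < m \<and> m < b')"
        using 1 2 mm \<eta> bounds False by (auto simp: abs_if split: if_splits)
      then show ?thesis by (auto simp: cyc_def)
    qed
  qed
qed

section \<open>Transport of essential subarcs\<close>

lemma subdivided_knot_exists:
  assumes g: "knot g" "finite_total_curvature g" and ab: "a \<in> {0..<1}" "b \<in> {0..<1}" "a \<noteq> b"
  obtains n t v i j where "subdivided_knot g n t v" "i < n" "j < n" "i \<noteq> j" "t i = a" "t j = b"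
proof -
  obtain D where D: "finite D" "\<And>a b. 0 \<le> a \<Longrightarrow> a < b \<Longrightarrow> b \<le> 1 \<Longrightarrow> {a<..<b} \<inter> D = {} \<Longrightarrow>
        \<exists>v. norm v = 1 \<and> chords_in_cone g (9999/10000) v a b"
    using nearly_straight_pieces[OF g] by blast
  define E where "E = {0, 1, a, b} \<union> (D \<inter> {0..1})"
  have E: "finite E" "E \<subseteq> {0..1}" "0 \<in> E" "1 \<in> E" "a \<in> E" "b \<in> E"
    using D(1) ab by (auto simp: E_def)
  define ts where "ts = sorted_list_of_set E"
  define n where "n = length ts - 1"
  have ts: "set ts = E" "sorted_wrt (<) ts" "length ts = card E"
    using E(1) by (simp_all add: ts_def)
  have "3 \<le> card E"
  proof -
    obtain c where "c \<in> E" "c \<noteq> 0" "c \<noteq> 1" using ab E(5,6) by (cases "a = 0") auto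
    then have "card {0, 1, c} \<le> card E" using E by (intro card_mono) auto
    then show ?thesis using \<open>c \<noteq> 0\<close> \<open>c \<noteq> 1\<close> by simp
  qed
  then have n: "2 \<le> n" "length ts = Suc n" using ts(3) by (auto simp: n_def)
  have less: "ts ! i < ts ! j" if "i < j" "j \<le> n" for i j
    using sorted_wrt_nth_less[OF ts(2) that(1)] that n(2) by simp
  have idx: "\<exists>i\<le>n. ts ! i = x" if "x \<in> E" for x
    using that n(2) unfolding ts(1)[symmetric] in_set_conv_nth by (metis less_Suc_eq_le)
  have inE: "ts ! i \<in> E" if "i \<le> n" for i
    using that n(2) nth_mem[of i ts] unfolding ts(1) by simp
  have t0: "ts ! 0 = 0"
  proof -
    obtain i where "i \<le> n" "ts ! i = 0" using idx E(3) by blast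
    moreover have "0 \<le> ts ! 0" using inE[of 0] E(2) by auto
    ultimately show ?thesis using less[of 0 i] by (cases "i = 0") auto
  qed
  have tn: "ts ! n = 1"
  proof -
    obtain i where "i \<le> n" "ts ! i = 1" using idx E(4) by blast
    moreover have "ts ! n \<le> 1" using inE[of n] E(2) by auto
    ultimately show ?thesis using less[of i n] by (cases "i = n") auto
  qed
  have ex: "\<exists>v. norm v = 1 \<and> chords_in_cone g (9999/10000) v (ts ! j) (ts ! Suc j)" if "j < n" for j
  proof (rule D(2))
    show "0 \<le> ts ! j" "ts ! Suc j \<le> 1" using inE[of j] inE[of "Suc j"] E(2) that by auto
    show "ts ! j < ts ! Suc j" using less[of j "Suc j"] that by simp
    show "{ts ! j<..<ts ! Suc j} \<inter> D = {}"
    proof (rule ccontr)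
      assume "{ts ! j<..<ts ! Suc j} \<inter> D \<noteq> {}"
      then obtain x where x: "ts ! j < x" "x < ts ! Suc j" "x \<in> D" by auto
      then have "x \<in> {0..1}" using inE[of j] inE[of "Suc j"] E(2) that by fastforce
      then have "x \<in> E" using x(3) by (simp add: E_def)
      then obtain i where i: "i \<le> n" "ts ! i = x" using idx by blast
      consider "i < j" | "i = j" | "i = Suc j" | "Suc j < i" by linarith
      then show False
        using x(1,2) i less[of i j] less[of "Suc j" i] that by cases auto
    qed
  qed
  define v where "v = (\<lambda>j. SOME v. norm v = 1 \<and> chords_in_cone g (9999/10000) v (ts ! j) (ts ! Suc j))"
  have v: "norm (v j) = 1 \<and> chords_in_cone g (9999/10000) (v j) (ts ! j) (ts ! Suc j)" if "j < n" for j
    unfolding v_def using ex[OF that] by (rule someI_ex)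
  have sub: "subdivided_knot g n (\<lambda>i. ts ! i) v"
    by unfold_locales (use g n t0 tn less v in auto)
  obtain i where i: "i \<le> n" "ts ! i = a" using idx E(5) by blast
  obtain j where j: "j \<le> n" "ts ! j = b" using idx E(6) by blast
  have "i \<noteq> n" "j \<noteq> n" "i \<noteq> j" using i j tn ab by auto
  then show ?thesis using that[OF sub, of i j] i j by simp
qed

lemma arc_compose_injective:
  assumes "arc c" "continuous_on UNIV H" "inj H"
  shows "arc (H \<circ> c)"
  unfolding arc_def path_def
proof
  show "continuous_on {0..1} (H \<circ> c)"
    using assms(1) by (intro continuous_on_compose continuous_on_subset[OF assms(2)]) (auto simp: arc_def path_def)
  show "inj_on (H \<circ> c) {0..1}"
    using assms(1) by (intro comp_inj_on inj_on_subset[OF assms(3)]) (auto simp: arc_def)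
qed

lemma arc_between_image:
  assumes "homeomorphism UNIV UNIV H H'" "arc_between p q A"
  shows "arc_between (H p) (H q) (H ` A)"
proof -
  have H: "continuous_on UNIV H" "inj H"
    using assms(1) by (auto simp: homeomorphism_def intro: inj_on_inverseI)
  obtain c where c: "arc c" "pathstart c = p" "pathfinish c = q" "path_image c = A"
    using assms(2) unfolding arc_between_def by blast
  have "arc (H \<circ> c)" by (rule arc_compose_injective[OF c(1) H])
  then show ?thesis
    unfolding arc_between_def using c
    by (intro exI[of _ "H \<circ> c"]) (auto simp: pathstart_compose pathfinish_compose path_image_compose)
qed

lemma theta_graph_image:
  assumes H: "homeomorphism UNIV UNIV H H'" and "theta_graph p q A B C"
  shows "theta_graph (H p) (H q) (H ` A) (H ` B) (H ` C)"
proof -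
  have "inj H" using H by (auto simp: homeomorphism_def intro: inj_on_inverseI)
  then show ?thesis
    using assms(2) arc_between_image[OF H] unfolding theta_graph_def
    by (simp add: image_Int[symmetric])
qed

lemma inessential_triple_image:
  assumes H: "homeomorphism UNIV UNIV H H'" and "inessential_triple A B C"
  shows "inessential_triple (H ` A) (H ` B) (H ` C)"
proof -
  have iH: "inj H" and cH: "continuous_on UNIV H"
    using H by (auto simp: homeomorphism_def intro: inj_on_inverseI)
  obtain D :: "real^2 \<Rightarrow> space" where D: "continuous_on (cball 0 1) D" "inj_on D (sphere 0 1)"
      "D ` sphere 0 1 = A \<union> B" "D ` ball 0 1 \<inter> (A \<union> C) = {}"
    using assms(2) unfolding inessential_triple_def by blast
  show ?thesis unfolding inessential_triple_def
  proof (intro exI[of _ "H \<circ> D"] conjI)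
    show "continuous_on (cball 0 1) (H \<circ> D)"
      by (rule continuous_on_compose[OF D(1) continuous_on_subset[OF cH]]) simp
    show "inj_on (H \<circ> D) (sphere 0 1)"
      by (rule comp_inj_on[OF D(2) inj_on_subset[OF iH]]) simp
    show "(H \<circ> D) ` sphere 0 1 = H ` A \<union> H ` B"
      unfolding image_comp[symmetric] D(3) by (rule image_Un)
    have "(H \<circ> D) ` ball 0 1 \<inter> (H ` A \<union> H ` C) = H ` (D ` ball 0 1 \<inter> (A \<union> C))"
      unfolding image_comp[symmetric] image_Un[symmetric] by (rule image_Int[OF iH, symmetric])
    then show "(H \<circ> D) ` ball 0 1 \<inter> (H ` A \<union> H ` C) = {}" using D(4) by simp
  qed
qed

lemma segment_perturbation_image:
  assumes H: "homeomorphism UNIV UNIV H H'" and d: "\<And>x. norm (H x - x) \<le> \<epsilon>1"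
    and S: "segment_perturbation \<epsilon>2 p q S" and pq: "norm (p - H p) \<le> \<epsilon>3" "norm (q - H q) \<le> \<epsilon>3"
  shows "segment_perturbation (\<epsilon>1 + \<epsilon>2 + \<epsilon>3) (H p) (H q) (H ` S)"
proof -
  have iH: "inj H" and cH: "continuous_on UNIV H"
    using H by (auto simp: homeomorphism_def intro: inj_on_inverseI)
  obtain s where s: "arc s" "pathstart s = p" "pathfinish s = q" "path_image s = S"
    "\<And>t. t \<in> {0..1} \<Longrightarrow> dist (s t) (linepath p q t) \<le> \<epsilon>2"
    using S unfolding segment_perturbation_def by blast
  show ?thesis unfolding segment_perturbation_def
  proof (intro exI[of _ "H \<circ> s"] conjI ballI)
    show "arc (H \<circ> s)" by (rule arc_compose_injective[OF s(1) cH iH])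
    show "pathstart (H \<circ> s) = H p" "pathfinish (H \<circ> s) = H q" "path_image (H \<circ> s) = H ` S"
      using s by (auto simp: pathstart_compose pathfinish_compose path_image_compose)
    fix t :: real assume t: "t \<in> {0..1}"
    have "norm (linepath p q t - linepath (H p) (H q) t) = norm ((1 - t) *\<^sub>R (p - H p) + t *\<^sub>R (q - H q))"
      by (simp add: linepath_def algebra_simps)
    also have "\<dots> \<le> (1 - t) * norm (p - H p) + t * norm (q - H q)"
      using t by (intro norm_triangle_le) auto
    also have "\<dots> \<le> (1 - t) * \<epsilon>3 + t * \<epsilon>3"
      using t pq by (intro add_mono mult_left_mono) auto
    finally have "norm (linepath p q t - linepath (H p) (H q) t) \<le> \<epsilon>3" by (simp add: algebra_simps)
    moreover have "norm (H (s t) - s t) \<le> \<epsilon>1" by (rule d)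
    moreover have "norm (s t - linepath p q t) \<le> \<epsilon>2" using s(5)[OF t] by (simp add: dist_norm)
    moreover have "norm (H (s t) - linepath (H p) (H q) t)
        \<le> norm (H (s t) - s t) + norm (s t - linepath p q t) + norm (linepath p q t - linepath (H p) (H q) t)"
      using norm_triangle_ineq[of "H (s t) - s t" "s t - linepath p q t"]
        norm_triangle_ineq[of "H (s t) - linepath p q t" "linepath p q t - linepath (H p) (H q) t"] by simp
    ultimately show "dist ((H \<circ> s) t) (linepath (H p) (H q) t) \<le> \<epsilon>1 + \<epsilon>2 + \<epsilon>3"
      by (simp add: dist_norm)
  qed
qed

definition essential_via :: "real \<Rightarrow> (real \<Rightarrow> space) \<Rightarrow> space \<Rightarrow> space \<Rightarrow> bool" where
  "essential_via \<epsilon> g p q \<longleftrightarrow> (\<exists>S. segment_perturbation \<epsilon> p q S \<and>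
     theta_graph p q (subarc g p q) S (subarc g q p) \<and>
     \<not> inessential_triple (subarc g p q) S (subarc g q p))"

lemma essential_subarc_iff: "essential_subarc g p q \<longleftrightarrow> (\<forall>\<epsilon>>0. essential_via \<epsilon> g p q)"
  by (simp add: essential_subarc_def essential_via_def)

text \<open>A perturbed segment \<open>S\<close> for \<open>G\<close> is carried by the homeomorphism of \<open>ambient_straightening\<close>, and a spanning disk for
  the image in \<open>K\<close> would give a disk for \<open>S\<close> by the inverse.  The images of the two subarcs of \<open>G\<close> are arcs
  in \<open>K\<close> between the same points, hence subarcs of \<open>K\<close>.  They are not interchanged: the point of the first subarc
  that corresponds to an interior point \<open>K m\<close> of the subarc of \<open>K\<close> ends up close to \<open>K m\<close>, and so not in the other one.\<close>

lemma essential_subarc_if_close: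
  assumes K: "knot K" "finite_total_curvature K" and ab: "a \<in> {0..<1}" "b \<in> {0..<1}" "a \<noteq> b" and "\<epsilon> > 0"
  obtains \<rho> where "\<rho> > 0"
    "\<And>G \<delta> p q. close_knots \<delta> (pi / 10) G K \<Longrightarrow> \<delta> \<le> \<rho> \<Longrightarrow> p \<in> path_image G \<Longrightarrow> q \<in> path_image G \<Longrightarrow>
       norm (p - K a) \<le> \<rho> \<Longrightarrow> norm (q - K b) \<le> \<rho> \<Longrightarrow> essential_subarc G p q \<Longrightarrow>
       essential_via \<epsilon> K (K a) (K b)"
proof -
  let ?\<alpha> = "subarc K (K a) (K b)" and ?\<beta> = "subarc K (K b) (K a)"
  obtain n t v ia ib where sub: "subdivided_knot K n t v" and i: "ia < n" "ib < n" "ia \<noteq> ib" "t ia = a" "t ib = b"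
    using subdivided_knot_exists[OF K ab] .
  interpret subdivided_knot K n t v by (rule sub)
  obtain m \<rho>1 where m: "m \<in> {0..<1}" "\<rho>1 > 0" "K m \<notin> ?\<beta>"
    "\<And>a' b'. a' \<in> {0..<1} \<Longrightarrow> b' \<in> {0..<1} \<Longrightarrow> norm (K a' - K a) < \<rho>1 \<Longrightarrow> norm (K b' - K b) < \<rho>1 \<Longrightarrow>
       a' \<noteq> b' \<and> cyc a' m b'"
    by (rule stable_interior_point[OF K(1) ab]) blast
  have "closed ?\<beta>"
  proof -
    have "compact (K ` {x..y})" if "0 \<le> x" "y \<le> 1" for x y
      by (rule compact_continuous_image[OF continuous_on_subset[OF contK]]) (use that in auto)
    then have "compact ?\<beta>" using subarc_eq[OF K(1) ab(2,1)] ab by (auto intro!: compact_Un)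
    then show ?thesis by (rule compact_imp_closed)
  qed
  from separate_point_closed[OF this m(3)] obtain d where d: "d > 0" "\<And>y. y \<in> ?\<beta> \<Longrightarrow> d \<le> dist (K m) y" by blast
  define \<epsilon>1 where "\<epsilon>1 = min (\<epsilon> / 3) (d / 3)"
  have \<epsilon>1: "\<epsilon>1 > 0" "3 * \<epsilon>1 \<le> \<epsilon>" "3 * \<epsilon>1 \<le> d" using \<open>\<epsilon> > 0\<close> d(1) unfolding \<epsilon>1_def by linarith+
  obtain \<rho>2 where \<rho>2: "\<rho>2 > 0" and amb: "\<forall>g p' q'. follows \<rho>2 g \<and> p' \<in> g ` {0..1} \<and> q' \<in> g ` {0..1} \<and>
      norm (p' - K (t ia)) \<le> \<rho>2 \<and> norm (q' - K (t ib)) \<le> \<rho>2 \<longrightarrow>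
      (\<exists>H H'. homeomorphism UNIV UNIV H H' \<and> (\<forall>x. norm (H x - x) \<le> \<epsilon>1) \<and>
         H ` g ` {0..1} \<subseteq> K ` {0..1} \<and> H p' = K (t ia) \<and> H q' = K (t ib))"
    using ambient_straightening[OF \<epsilon>1(1) i(1-3)] by blast
  define \<rho> where "\<rho> = min (\<rho>1 / 3) (min \<rho>2 \<epsilon>1)"
  have \<rho>: "\<rho> > 0" "3 * \<rho> \<le> \<rho>1" "\<rho> \<le> \<rho>2" "\<rho> \<le> \<epsilon>1"
    using m(2) \<rho>2 \<epsilon>1(1) unfolding \<rho>_def by linarith+
  show ?thesis
  proof (rule that[OF \<rho>(1)])
    fix G \<delta> p q
    assume close: "close_knots \<delta> (pi / 10) G K" and "\<delta> \<le> \<rho>"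
      and pq: "p \<in> path_image G" "q \<in> path_image G" "norm (p - K a) \<le> \<rho>" "norm (q - K b) \<le> \<rho>"
      and ess: "essential_subarc G p q"
    obtain h k N where G: "knot G" "rectifiable G" and rK: "rectifiable K"
      and hk: "homeomorphism (path_image G) (path_image K) h k" and ori: "orientation_preserving G K h"
      and h\<delta>: "\<forall>x\<in>path_image G. dist x (h x) \<le> \<delta>"
      and N: "arclength_null G N" "\<forall>x\<in>path_image G - N. \<exists>T T'.
              has_tangent G x T \<and> has_tangent K (h x) T' \<and> vec_angle T T' \<le> pi / 10"
      using close unfolding close_knots_def by blast
    have K\<delta>: "norm (k y - y) \<le> \<rho>" if "y \<in> path_image K" for y
    proof -
      have "k y \<in> path_image G" "h (k y) = y" using hk that by (auto simp: homeomorphism_def)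
      then have "dist (k y) y \<le> \<delta>" using h\<delta> by metis
      then show ?thesis using \<open>\<delta> \<le> \<rho>\<close> by (simp add: dist_norm)
    qed
    \<comment> \<open>G with the parametrization of K; its pieces correspond to those of K\<close>
    define g where "g = k \<circ> K"
    have gim: "g ` {0..1} = path_image G"
      using hk unfolding g_def image_comp[symmetric] homeomorphism_def path_image_def by blast
    have Kim: "K s \<in> path_image K" if "s \<in> {0..1}" for s using that by (simp add: path_image_def)
    have kg: "knot g"
    proof -
      have "continuous_on {0..1} g" unfolding g_def
        by (rule continuous_on_compose[OF contK]) (use hk in \<open>simp add: homeomorphism_def path_image_def\<close>)
      moreover have "K s = K s'" if "g s = g s'" "s \<in> {0..1}" "s' \<in> {0..1}" for s s'
        using that(1) Kim[OF that(2)] Kim[OF that(3)] hk unfolding g_def homeomorphism_def by (metis comp_apply)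
      then have "loop_free g"
        unfolding loop_free_def using knot_inj[OF K(1)] by blast
      ultimately show ?thesis
        using K01 by (simp add: knot_def simple_path_def path_def pathfinish_def pathstart_def g_def)
    qed
    have "follows \<rho>2 g" unfolding follows_def
    proof (intro conjI ballI allI impI)
      show "knot g" by (rule kg)
      show "norm (g s - K s) \<le> \<rho>2" if "s \<in> {0..1}" for s
        using K\<delta>[OF Kim[OF that]] \<rho>(3) by (simp add: g_def)
      show "chords_in_cone g (94/100) (v j) (t j) (t (Suc j))" if "j < n" for j
        unfolding g_def
        by (rule chords_of_corresponding_arcs[OF G K(1) rK hk ori N(1) _ _ _ v[OF that] straight[OF that]])
           (use N(2) t01[of j] t01[of "Suc j"] that in auto)
    qed
    moreover have "norm (p - K (t ia)) \<le> \<rho>2" "norm (q - K (t ib)) \<le> \<rho>2" using pq \<rho>(3) i by auto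
    ultimately obtain H H' where H: "homeomorphism UNIV UNIV H H'" "\<And>x. norm (H x - x) \<le> \<epsilon>1"
         "H ` g ` {0..1} \<subseteq> K ` {0..1}" "H p = K a" "H q = K b"
      using amb[rule_format, of g p q] pq(1,2) unfolding gim i(4,5) by blast
    have HG: "H ` path_image G \<subseteq> path_image K" using H(3) unfolding gim by (simp add: path_image_def)
    have "K a \<noteq> K b" using knot_inj[OF K(1), of a b] ab by auto
    then have "p \<noteq> q" using H(4,5) by auto
    have "\<epsilon>1 > 0" by (rule \<epsilon>1(1))
    then obtain S where S: "segment_perturbation \<epsilon>1 p q S" "theta_graph p q (subarc G p q) S (subarc G q p)"
        "\<not> inessential_triple (subarc G p q) S (subarc G q p)"
      using ess unfolding essential_subarc_def by blast
    have \<theta>: "theta_graph (K a) (K b) (H ` subarc G p q) (H ` S) (H ` subarc G q p)"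
      using theta_graph_image[OF H(1) S(2)] H(4,5) by simp
    have inK: "H ` subarc G p q \<subseteq> path_image K" "H ` subarc G q p \<subseteq> path_image K"
      using subarc_subset[OF G(1) pq(1,2) \<open>p \<noteq> q\<close>] subarc_subset[OF G(1) pq(2,1)] \<open>p \<noteq> q\<close> HG by blast+
    have arcs: "arc_between (K a) (K b) (H ` subarc G p q)" "arc_between (K a) (K b) (H ` subarc G q p)"
      using \<theta> by (simp_all add: theta_graph_def)
    note cases = arc_in_knot[OF K(1) ab arcs(1) inK(1)] arc_in_knot[OF K(1) ab arcs(2) inK(2)]
    have Km: "K m \<in> path_image K" using m(1) by (simp add: path_image_def)
    have hclose: "norm (h x - y) < \<rho>1" if "x \<in> path_image G" "norm (x - y) \<le> \<rho>" for x y
    proof -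
      have "norm (h x - x) \<le> \<rho>" using h\<delta> that(1) \<open>\<delta> \<le> \<rho>\<close> by (force simp: dist_norm norm_minus_commute)
      then show ?thesis using norm_triangle_ineq[of "h x - x" "x - y"] that(2) \<rho>(1,2) by simp
    qed
    have him: "h x \<in> path_image K" if "x \<in> path_image G" for x using hk that by (auto simp: homeomorphism_def)
    obtain a' where a': "a' \<in> {0..<1}" "K a' = h p" using knot_parameter[OF K(1) him[OF pq(1)]] .
    obtain b' where b': "b' \<in> {0..<1}" "K b' = h q" using knot_parameter[OF K(1) him[OF pq(2)]] .
    have "a' \<noteq> b' \<and> cyc a' m b'"
      using m(4)[OF a'(1) b'(1)] hclose[OF pq(1,3)] hclose[OF pq(2,4)] a'(2) b'(2) by simp
    moreover have "k (K m) \<in> path_image G" "h (k (K m)) = K m" using hk Km by (auto simp: homeomorphism_def)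
    ultimately have "k (K m) \<in> subarc G p q"
      using orientation_preserving_subarc[OF G(1) K(1) ori pq(1) _ pq(2), of "k (K m)" a' m b'] a' b' m(1) by simp
    then have Hm: "H (k (K m)) \<in> H ` subarc G p q" by blast
    have "norm (H (k (K m)) - K m) < d"
      using norm_triangle_ineq[of "H (k (K m)) - k (K m)" "k (K m) - K m"] H(2)[of "k (K m)"] K\<delta>[OF Km] \<rho>(4) \<epsilon>1 by simp
    then have "H (k (K m)) \<notin> ?\<beta>" using d(2)[of "H (k (K m))"] by (auto simp: dist_norm norm_minus_commute)
    then have A: "H ` subarc G p q = ?\<alpha>" using cases(1) Hm by auto
    \<comment> \<open>the images meet in the end points only, so the second one is not the same subarc as the first\<close>
    have "K m \<in> ?\<alpha>"
      using m(4)[OF ab(1,2)] m(2) cyc_in_subarc[OF K(1) ab m(1)] by simp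
    moreover have "K m \<noteq> K a" "K m \<noteq> K b"
      using m(3) connected_subarc(2,3)[OF K(1) ab(2,1)] ab(3) by auto
    ultimately have "?\<alpha> \<inter> ?\<alpha> \<noteq> {K a, K b}" by blast
    then have B: "H ` subarc G q p = ?\<beta>" using cases(2) \<theta> unfolding theta_graph_def A by metis
    have seg: "segment_perturbation \<epsilon> (K a) (K b) (H ` S)"
    proof -
      have "norm (p - H p) \<le> \<epsilon>1" "norm (q - H q) \<le> \<epsilon>1" using pq(3,4) \<rho>(4) H(4,5) by auto
      from segment_perturbation_image[OF H(1,2) S(1) this]
      have "segment_perturbation (\<epsilon>1 + \<epsilon>1 + \<epsilon>1) (K a) (K b) (H ` S)" using H(4,5) by simp
      then show ?thesis using \<epsilon>1(2) unfolding segment_perturbation_def by fastforce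
    qed
    have "\<not> inessential_triple ?\<alpha> (H ` S) ?\<beta>"
    proof
      assume "inessential_triple ?\<alpha> (H ` S) ?\<beta>"
      then have *: "inessential_triple (H ` subarc G p q) (H ` S) (H ` subarc G q p)" using A B by simp
      have inv: "homeomorphism UNIV UNIV H' H" using H(1) by (rule homeomorphism_symD)
      have HH: "H' ` H ` X = X" for X using H(1) by (simp add: homeomorphism_def image_image)
      show False using inessential_triple_image[OF inv *] S(3) unfolding HH by blast
    qed
    then show "essential_via \<epsilon> K (K a) (K b)"
      unfolding essential_via_def using seg \<theta> A B by (intro exI[of _ "H ` S"]) simp
  qed
qed

theorem proposition6p1:
  fixes K :: "real \<Rightarrow> real^3" and Ks :: "nat \<Rightarrow> real \<Rightarrow> real^3"
    and \<delta> :: "nat \<Rightarrow> real"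
    and p q :: "real^3" and ps qs :: "nat \<Rightarrow> real^3"
  assumes "\<And>i. knot (Ks i)" and "\<And>i. rectifiable (Ks i)"
    and "knot K" and "finite_total_curvature K"
    and "\<And>i. close_knots (\<delta> i) (pi / 10) (Ks i) K" and "\<delta> \<longlonglongrightarrow> 0"
    and "\<And>i. ps i \<in> path_image (Ks i)" and "\<And>i. qs i \<in> path_image (Ks i)"
    and "\<And>i. ps i \<noteq> qs i"
    and "\<And>i. essential_subarc (Ks i) (ps i) (qs i)"
    and "ps \<longlonglongrightarrow> p" and "qs \<longlonglongrightarrow> q"
    and "p \<in> path_image K" and "q \<in> path_image K" and "p \<noteq> q"
  shows "essential_subarc K p q"
proof -
  obtain a where a: "a \<in> {0..<1}" "K a = p" using knot_parameter[OF assms(3) assms(13)] .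
  obtain b where b: "b \<in> {0..<1}" "K b = q" using knot_parameter[OF assms(3) assms(14)] .
  have "a \<noteq> b" using a b assms(15) by auto
  show ?thesis
    unfolding essential_subarc_iff
  proof (intro allI impI)
    fix \<epsilon> :: real assume "\<epsilon> > 0"
    obtain \<rho> where "\<rho> > 0" and \<rho>:
      "\<And>G \<delta> p q. close_knots \<delta> (pi / 10) G K \<Longrightarrow> \<delta> \<le> \<rho> \<Longrightarrow> p \<in> path_image G \<Longrightarrow> q \<in> path_image G \<Longrightarrow>
       norm (p - K a) \<le> \<rho> \<Longrightarrow> norm (q - K b) \<le> \<rho> \<Longrightarrow> essential_subarc G p q \<Longrightarrow>
       essential_via \<epsilon> K (K a) (K b)"
      using essential_subarc_if_close[OF assms(3,4) a(1) b(1) \<open>a \<noteq> b\<close> \<open>\<epsilon> > 0\<close>] by blast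
    have "\<forall>\<^sub>F i in sequentially. dist (\<delta> i) 0 < \<rho>" "\<forall>\<^sub>F i in sequentially. dist (ps i) p < \<rho>"
        "\<forall>\<^sub>F i in sequentially. dist (qs i) q < \<rho>"
      by (rule tendstoD[OF assms(6) \<open>\<rho> > 0\<close>] tendstoD[OF assms(11) \<open>\<rho> > 0\<close>] tendstoD[OF assms(12) \<open>\<rho> > 0\<close>])+
    then have "\<forall>\<^sub>F i in sequentially. dist (\<delta> i) 0 < \<rho> \<and> dist (ps i) p < \<rho> \<and> dist (qs i) q < \<rho>"
      by (intro eventually_conj)
    then obtain i where i: "dist (\<delta> i) 0 < \<rho>" "dist (ps i) p < \<rho>" "dist (qs i) q < \<rho>"
      by (auto dest: eventually_happens)
    show "essential_via \<epsilon> K p q"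
      using \<rho>[OF assms(5) _ assms(7,8) _ _ assms(10), of i] i a(2) b(2) by (simp add: dist_norm)
  qed
qed


end
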